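(* Let $n\in\mathbb{N}$, let $\boldsymbol{D}=\mathrm{diag}(d_1,\dots,d_n)$ be a positive diagonal matrix (all $d_i>0$), and let $0\le t_0<t<\infty$. Consider the partial differential equation $$\frac{\partial \widehat{\eta}}{\partial t}=\Delta_{\boldsymbol{y}}\widehat{\eta}-\left(\boldsymbol{y}^{\top}\boldsymbol{D}\boldsymbol{y}\right)\widehat{\eta}$$ with initial condition $\widehat{\eta}_0(\boldsymbol{y}):=\widehat{\eta}(t_0,\boldsymbol{y})$, whose unique solution is given by the series $$\widehat{\eta}(t,\boldsymbol{y})=\sum_{m_n=0}^{\infty}\cdots\sum_{m_1=0}^{\infty}\int_{-\infty}^{\infty}\cdots\int_{-\infty}^{\infty}\left(\prod_{i=1}^{n}\frac{d_i^{1/4}}{\sqrt{\pi}\,2^{m_i}\,(m_i!)}\exp\left(-(t-t_0)\sqrt{d_i}(2m_i+1)-\frac{(y_i^2+z_i^2)\sqrt{d_i}}{2}\right)H_{m_i}\big(d_i^{1/4}y_i\big)H_{m_i}\big(d_i^{1/4}z_i\big)\right)\widehat{\eta}_0(\boldsymbol{z})\,\mathrm{d}z_1\cdots\mathrm{d}z_n .$$ This solution simplifies to $$\widehat{\eta}(t,\boldsymbol{y})=\int_{-\infty}^{\infty}\cdots\int_{-\infty}^{\infty}\kappa_{++}(t_0,\boldsymbol{y},t,\boldsymbol{z})\,\widehat{\eta}_0(\boldsymbol{z})\,\mathrm{d}z_1\cdots\mathrm{d}z_n,$$ where the kernel is $$\kappa_{++}(t_0,\boldsymbol{y},t,\boldsymbol{z})=\frac{(\det(\boldsymbol{M}_{tt_0}))^{1/4}}{(2\pi)^{n/2}\sqrt{\det\left(\sinh(2(t-t_0)\sqrt{\boldsymbol{D}})\right)}}\exp\left(-\frac12\begin{pmatrix}\boldsymbol{y}^{\top}&\boldsymbol{z}^{\top}\end{pmatrix}\boldsymbol{M}_{tt_0}\begin{pmatrix}\boldsymbol{y}\\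 \boldsymbol{z}\end{pmatrix}\right)$$ and the matrix is $$\boldsymbol{M}_{tt_0}=\begin{bmatrix}\sqrt{\boldsymbol{D}}\coth\left(2(t-t_0)\sqrt{\boldsymbol{D}}\right)&-\sqrt{\boldsymbol{D}}\,\mathrm{csch}\left(2(t-t_0)\sqrt{\boldsymbol{D}}\right)\\-\sqrt{\boldsymbol{D}}\,\mathrm{csch}\left(2(t-t_0)\sqrt{\boldsymbol{D}}\right)&\sqrt{\boldsymbol{D}}\coth\left(2(t-t_0)\sqrt{\boldsymbol{D}}\right)\end{bmatrix}.$$
   Context: $H_m(x)=(-1)^m e^{x^2}\frac{\mathrm{d}^m}{\mathrm{d}x^m}e^{-x^2}$ ($m\in\mathbb{N}_0=\{0,1,2,\dots\}$) are the physicist's Hermite polynomials. $\Delta_{\boldsymbol{y}}$ is the Laplacian in $\boldsymbol{y}\in\mathbb{R}^n$. A scalar function applied to a diagonal matrix means the diagonal matrix obtained by applying the function to each diagonal entry; $\mathrm{csch}=1/\sinh$, $\coth=\cosh/\sinh$.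
   Formalization: The initial function is assumed integrable against every Gaussian (else the series may diverge); existence and uniqueness are for continuous initial data and solutions continuous up to t_0, growing slower than every exp(ε|y|^2), since uniqueness fails without a growth class. *)

theory Defs
  imports "HOL-Analysis.Analysis"
begin

definition hermite :: "nat \<Rightarrow> real \<Rightarrow> real" where
  "hermite m x = (-1) ^ m * exp (x\<^sup>2) * (deriv ^^ m) (\<lambda>u. exp (- (u\<^sup>2))) x"

definition csch :: "real \<Rightarrow> real" where
  "csch x = 1 / sinh x"

definition coth :: "real \<Rightarrow> real" where
  "coth x = cosh x / sinh x"


definition diag :: "real ^ 'n \<Rightarrow> real ^ 'n ^ 'n" where
  "diag d = (\<chi> i j. if i = j then d $ i else 0)"

text \<open>A scalar function applied to a diagonal matrix; off-diagonal entries are ignored.\<close>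

definition diag_map :: "(real \<Rightarrow> real) \<Rightarrow> real ^ 'n ^ 'n \<Rightarrow> real ^ 'n ^ 'n" where
  "diag_map f A = (\<chi> i j. if i = j then f (A $ i $ i) else 0)"

definition block_matrix ::
  "real ^ 'n ^ 'n \<Rightarrow> real ^ 'n ^ 'n \<Rightarrow> real ^ 'n ^ 'n \<Rightarrow> real ^ 'n ^ 'n \<Rightarrow> real ^ ('n + 'n) ^ ('n + 'n)" where
  "block_matrix A B C E = (\<chi> r s. case (r, s) of
       (Inl i, Inl j) \<Rightarrow> A $ i $ j
     | (Inl i, Inr j) \<Rightarrow> B $ i $ j
     | (Inr i, Inl j) \<Rightarrow> C $ i $ j
     | (Inr i, Inr j) \<Rightarrow> E $ i $ j)"

definition stack :: "real ^ 'n \<Rightarrow> real ^ 'n \<Rightarrow> real ^ ('n + 'n)" where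
  "stack y z = (\<chi> r. case r of Inl i \<Rightarrow> y $ i | Inr i \<Rightarrow> z $ i)"


definition M_mat :: "real ^ 'n ^ 'n \<Rightarrow> real \<Rightarrow> real \<Rightarrow> real ^ ('n + 'n) ^ ('n + 'n)" where
  "M_mat D t0 t =
     (let S = diag_map sqrt D;
          P = S ** diag_map coth ((2 * (t - t0)) *\<^sub>R S);
          Q = S ** diag_map csch ((2 * (t - t0)) *\<^sub>R S)
      in block_matrix P (- Q) (- Q) P)"

definition kappa :: "real ^ 'n ^ 'n \<Rightarrow> real \<Rightarrow> real ^ 'n \<Rightarrow> real \<Rightarrow> real ^ 'n \<Rightarrow> real" where
  "kappa D t0 y t z =
     det (M_mat D t0 t) powr (1/4) /
     ((2 * pi) powr (real CARD('n) / 2) *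
       sqrt (det (diag_map sinh ((2 * (t - t0)) *\<^sub>R diag_map sqrt D)))) *
     exp (- (1/2) * (stack y z \<bullet> (M_mat D t0 t *v stack y z)))"

definition hermite_term ::
  "real ^ 'n \<Rightarrow> real \<Rightarrow> real ^ 'n \<Rightarrow> real \<Rightarrow> real ^ 'n \<Rightarrow> ('n \<Rightarrow> nat) \<Rightarrow> real" where
  "hermite_term d t0 y t z m =
     (\<Prod>i\<in>UNIV. (d $ i) powr (1/4) / (sqrt pi * 2 ^ m i * fact (m i)) *
        exp (- (t - t0) * sqrt (d $ i) * (2 * real (m i) + 1)
             - ((y $ i)\<^sup>2 + (z $ i)\<^sup>2) * sqrt (d $ i) / 2) *
        hermite (m i) ((d $ i) powr (1/4) * y $ i) *
        hermite (m i) ((d $ i) powr (1/4) * z $ i))"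


definition partial_deriv :: "'n \<Rightarrow> (real ^ 'n \<Rightarrow> real) \<Rightarrow> real ^ 'n \<Rightarrow> real" where
  "partial_deriv i f x = deriv (\<lambda>s. f (x + s *\<^sub>R axis i 1)) 0"

definition partially_differentiable :: "'n \<Rightarrow> (real ^ 'n \<Rightarrow> real) \<Rightarrow> real ^ 'n \<Rightarrow> bool" where
  "partially_differentiable i f x \<longleftrightarrow> (\<lambda>s. f (x + s *\<^sub>R axis i 1)) field_differentiable (at 0)"

definition laplacian :: "(real ^ 'n \<Rightarrow> real) \<Rightarrow> real ^ 'n \<Rightarrow> real" where
  "laplacian f x = (\<Sum>i\<in>UNIV. partial_deriv i (partial_deriv i f) x)"

definition solves_pde :: "real ^ 'n ^ 'n \<Rightarrow> real \<Rightarrow> (real \<Rightarrow> real ^ 'n \<Rightarrow> real) \<Rightarrow> bool" where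
  "solves_pde D t0 \<eta> \<longleftrightarrow> (\<forall>t>t0. \<forall>y.
     (\<forall>i. partially_differentiable i (\<eta> t) y \<and>
          partially_differentiable i (partial_deriv i (\<eta> t)) y) \<and>
     ((\<lambda>s. \<eta> s y) has_real_derivative
        laplacian (\<eta> t) y - (y \<bullet> (D *v y)) * \<eta> t y) (at t))"

text \<open>The growth class of the Cauchy problem on \<open>\<real>\<^sup>n\<close>: smaller than every
  \<open>exp (\<epsilon> \<bar>y\<bar>\<^sup>2)\<close>. For data growing like \<open>exp (\<epsilon> \<bar>y\<bar>\<^sup>2)\<close> with a fixed
  \<open>\<epsilon> > 0\<close> the Hermite series may diverge for \<open>t\<close> close to \<open>t0\<close>.\<close>

definition subgaussian_growth :: "(real ^ 'n \<Rightarrow> real) \<Rightarrow> bool" where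
  "subgaussian_growth f \<longleftrightarrow> (\<forall>\<epsilon>>0. \<exists>C. \<forall>y. \<bar>f y\<bar> \<le> C * exp (\<epsilon> * (norm y)\<^sup>2))"

definition is_solution ::
  "real ^ 'n ^ 'n \<Rightarrow> real \<Rightarrow> (real ^ 'n \<Rightarrow> real) \<Rightarrow> (real \<Rightarrow> real ^ 'n \<Rightarrow> real) \<Rightarrow> bool" where
  "is_solution D t0 \<eta>0 \<eta> \<longleftrightarrow>
     solves_pde D t0 \<eta> \<and>
     (\<forall>y. \<eta> t0 y = \<eta>0 y) \<and>
     continuous_on ({t0..} \<times> UNIV) (\<lambda>(t, y). \<eta> t y) \<and>
     (\<forall>T\<ge>t0. \<forall>\<epsilon>>0. \<exists>C. \<forall>t\<in>{t0..T}. \<forall>y. \<bar>\<eta> t y\<bar> \<le> C * exp (\<epsilon> * (norm y)\<^sup>2))"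

end

theory Submission
  imports Defs "HOL-Complex_Analysis.Laurent_Convergence" "HOL-Probability.Distributions"
begin

text \<open>
  The equation is the heat equation of the harmonic oscillator, and both the Hermite series and
  the kernel factorise over the coordinates. Put \<open>\<omega>\<^sub>i = sqrt (d $ i)\<close> and \<open>\<tau> = t - t0\<close>.

  \<^emph>\<open>Summing the series.\<close> In one coordinate the terms of the series are, up to a common factor,
  \<open>H\<^sub>m(x) H\<^sub>m(y) q\<^sup>m / (2\<^sup>m m!)\<close> with \<open>q = exp (- 2 \<omega> \<tau>)\<close>. Mehler's formula
  (\<open>mehler_formula\<close>) sums them to a Gaussian, so the series of a coordinate sums to
  \<open>mehler_kernel\<close>; the product of these kernels is \<open>kappa\<close> because the \<open>2n \<times> 2n\<close> matrix \<open>M\<close> has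
  determinant \<open>\<Prod>i. d $ i\<close> (\<open>kappa_eq_mehler_prod\<close>). Mehler's formula itself is proved by power series: the
  closed form is holomorphic in the unit disc and solves a first-order linear differential
  equation, which turns into a recurrence for its Taylor coefficients, and the three-term
  recurrence of the Hermite polynomials makes their products satisfy the same recurrence.

  \<^emph>\<open>Exchanging sum and integral.\<close> By the Cauchy-Schwarz inequality the sum of the absolute values
  of the terms at \<open>(y, z)\<close> is at most the geometric mean of the sums at \<open>(y, y)\<close> and \<open>(z, z)\<close>.
  Mehler's formula evaluates those: the bound decays like \<open>exp (- c \<bar>z\<bar>\<^sup>2)\<close>, and data
  that are integrable against every Gaussian are integrable against it.

  \<^emph>\<open>The equation.\<close> The derivatives of the kernel are polynomials in \<open>z\<close> times the kernel. They
  are dominated by a fixed Gaussian while the parameters stay in a bounded region away from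
  \<open>\<tau> = 0\<close>, so one may differentiate under the integral.

  \<^emph>\<open>The initial value.\<close> The substitution \<open>z = y + s \<xi>\<close> with \<open>s\<^sup>2 = sinh (2 \<omega> \<tau>) / \<omega>\<close> turns the
  kernel into the standard normal density times a factor at most \<open>1\<close>. The integral
  so obtained makes sense for \<open>\<tau> = 0\<close> as well, where it is the initial value, and dominated
  convergence gives continuity on \<open>\<tau> \<ge> 0\<close> together with the growth bound.

  \<^emph>\<open>Uniqueness.\<close> This is a maximum principle with the barrier \<open>exp (a \<bar>y\<bar>\<^sup>2 + b (t - t0))\<close>
  (\<open>solution_nonpos\<close>). The potential \<open>y \<bullet> (D *v y)\<close> absorbs the term \<open>4 a\<^sup>2 \<bar>y\<bar>\<^sup>2\<close> of the Laplacian of the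
  barrier when \<open>a\<close> is small, so a single barrier works for all times.
\<close>

text \<open>The symbol \<open>$\<close> denotes components of vectors only; coefficients of power series are written
  with \<open>fps_nth\<close>.\<close>

unbundle no Formal_Power_Series.fps_syntax

section \<open>Hermite polynomials\<close>

text \<open>The recurrence makes the polynomial nature of \<open>hermite\<close> visible, which its definition by
  iterated \<open>deriv\<close> hides: smoothness and all algebra below go through it.\<close>
fun herm :: "nat \<Rightarrow> real \<Rightarrow> real" where
  "herm 0 x = 1"
| "herm (Suc 0) x = 2 * x"
| "herm (Suc (Suc m)) x = 2 * x * herm (Suc m) x - 2 * (real m + 1) * herm m x"

lemma DERIV_herm: "(herm m has_real_derivative 2 * real m * herm (m - 1) x) (at x)"
proof (induction m rule: less_induct)
  case (less m)
  consider "m = 0" | "m = 1" | k where "m = Suc (Suc k)"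
    by (metis One_nat_def not0_implies_Suc)
  then show ?case
  proof cases
    case 1
    have "herm 0 = (\<lambda>_. 1)" by (rule ext) simp
    then show ?thesis using 1 by simp
  next
    case 2
    have "herm 1 = (\<lambda>x. 2 * x)" by (rule ext) simp
    then show ?thesis using 2 by (auto intro!: derivative_eq_intros)
  next
    case 3
    have e: "herm m = (\<lambda>x. 2 * x * herm (Suc k) x - 2 * (real k + 1) * herm k x)"
      using 3 by (intro ext) simp
    have a: "(herm (Suc k) has_real_derivative 2 * real (Suc k) * herm k x) (at x)"
      using less[of "Suc k"] 3 by simp
    have b: "(herm k has_real_derivative 2 * real k * herm (k - 1) x) (at x)"
      using less[of k] 3 by simp
    have "((\<lambda>x. 2 * x * herm (Suc k) x - 2 * (real k + 1) * herm k x) has_real_derivative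
       2 * herm (Suc k) x + 2 * x * (2 * real (Suc k) * herm k x) - 2 * (real k + 1) * (2 * real k * herm (k - 1) x)) (at x)"
      by (rule derivative_eq_intros a b refl | simp)+
    moreover have "2 * herm (Suc k) x + 2 * x * (2 * real (Suc k) * herm k x) - 2 * (real k + 1) * (2 * real k * herm (k - 1) x)
        = 2 * real m * herm (m - 1) x"
      by (cases k) (simp_all add: 3 algebra_simps)
    ultimately show ?thesis unfolding e by simp
  qed
qed

lemma herm_Suc: "herm (Suc m) x = 2 * x * herm m x - 2 * real m * herm (m - 1) x"
  by (cases m) auto

text \<open>Differentiating \<open>herm m u * exp (- u\<^sup>2)\<close> once more reproduces the recurrence up to sign, so
  the iterated derivatives of the Gaussian are found by induction.\<close>
lemma hermite_eq_herm: "hermite m x = herm m x"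
proof -
  have "(deriv ^^ m) (\<lambda>u. exp (- (u\<^sup>2))) = (\<lambda>u. (-1) ^ m * herm m u * exp (- (u\<^sup>2)))"
  proof (induction m)
    case 0
    then show ?case by simp
  next
    case (Suc m)
    have "deriv (\<lambda>u. (-1) ^ m * herm m u * exp (- (u\<^sup>2))) u = (-1) ^ Suc m * herm (Suc m) u * exp (- (u\<^sup>2))" for u
    proof (rule DERIV_imp_deriv)
      show "((\<lambda>u. (-1) ^ m * herm m u * exp (- (u\<^sup>2))) has_real_derivative (-1) ^ Suc m * herm (Suc m) u * exp (- (u\<^sup>2))) (at u)"
        by (rule derivative_eq_intros DERIV_herm refl | simp add: herm_Suc algebra_simps)+
    qed
    then show ?case using Suc by auto
  qed
  then show ?thesis
    by (simp add: hermite_def exp_minus field_simps flip: power_mult_distrib)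
qed

lemma hermite_Suc_Suc:
  "hermite (Suc (Suc m)) x = 2 * x * hermite (Suc m) x - 2 * (real m + 1) * hermite m x"
  by (simp add: hermite_eq_herm)

definition mehler_coeff :: "real \<Rightarrow> real \<Rightarrow> nat \<Rightarrow> real" where
  "mehler_coeff x y m = hermite m x * hermite m y / (2 ^ m * fact m)"

text \<open>Comparing coefficients in the differential equation of the generating function (see
  \<open>mehler_gen_deriv\<close>) yields this recurrence. For the products of Hermite polynomials it is a
  polynomial identity: three-term recurrences express the values at \<open>m + 2\<close>, \<open>m + 3\<close>,
  \<open>m + 4\<close> through those at \<open>m\<close> and \<open>m + 1\<close>.\<close>
lemma mehler_coeff_rec:
  defines "a \<equiv> mehler_coeff"
  shows "(real m + 4) * a x y (m + 4) = (2 * real m + 5 - 2 * (x\<^sup>2 + y\<^sup>2)) * a x y (m + 2)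
     - (real m + 1) * a x y m + 2 * x * y * (a x y (m + 3) + a x y (m + 1))"
proof -
  define N where "N = real m"
  define K :: real where "K = 2 ^ m * fact m"
  define u v U V where uv: "u = hermite m x" "v = hermite (Suc m) x" "U = hermite m y" "V = hermite (Suc m) y"
  define w W where wW: "w = 2 * x * v - 2 * (N + 1) * u" "W = 2 * y * V - 2 * (N + 1) * U"
  define p P where pP: "p = 2 * x * w - 2 * (N + 2) * v" "P = 2 * y * W - 2 * (N + 2) * V"
  define r R where rR: "r = 2 * x * p - 2 * (N + 3) * w" "R = 2 * y * P - 2 * (N + 3) * W"
  have K: "K > 0" by (simp add: K_def)
  have N: "N \<ge> 0" by (simp add: N_def)
  have w: "hermite (m + 2) x = w" "hermite (m + 2) y = W"
    by (simp_all add: hermite_Suc_Suc uv wW N_def)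
  then have w': "hermite (Suc (Suc m)) x = w" "hermite (Suc (Suc m)) y = W" by simp_all
  have p: "hermite (m + 3) x = p" "hermite (m + 3) y = P"
    by (simp_all add: hermite_Suc_Suc[of "Suc m"] w' numeral_3_eq_3 uv(2,4) pP N_def algebra_simps)
  then have p': "hermite (Suc (Suc (Suc m))) x = p" "hermite (Suc (Suc (Suc m))) y = P"
    by (simp_all add: numeral_3_eq_3)
  have r: "hermite (m + 4) x = r" "hermite (m + 4) y = R"
    by (simp_all add: hermite_Suc_Suc[of "Suc (Suc m)"] w' p' eval_nat_numeral rR N_def algebra_simps)
  have k1: "2 ^ (m + 1) * fact (m + 1) = 2 * (N + 1) * K"
    by (simp add: K_def N_def algebra_simps)
  have k2: "2 ^ (m + 2) * fact (m + 2) = 4 * (N + 1) * (N + 2) * K"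
    by (simp add: K_def N_def algebra_simps)
  have k3: "2 ^ (m + 3) * fact (m + 3) = 8 * (N + 1) * (N + 2) * (N + 3) * K"
    by (simp add: K_def N_def algebra_simps eval_nat_numeral)
  have k4: "2 ^ (m + 4) * fact (m + 4) = 16 * (N + 1) * (N + 2) * (N + 3) * (N + 4) * K"
    by (simp add: K_def N_def algebra_simps eval_nat_numeral)
  have nz: "N + 1 \<noteq> 0" "N + 2 \<noteq> 0" "N + 3 \<noteq> 0" "N + 4 \<noteq> 0" using N by auto
  have key: "r * R = 4 * (N + 3) * (2 * N + 5 - 2 * (x\<^sup>2 + y\<^sup>2)) * (w * W)
     - 16 * (N + 1) * (N + 2) * (N + 3) * (N + 1) * (u * U)
     + 4 * x * y * (p * P) + 16 * (N + 2) * (N + 3) * x * y * (v * V)"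
    unfolding rR pP wW by algebra
  have "(N + 4) * (r * R / (16 * (N + 1) * (N + 2) * (N + 3) * (N + 4) * K))
      = (2 * N + 5 - 2 * (x\<^sup>2 + y\<^sup>2)) * (w * W / (4 * (N + 1) * (N + 2) * K))
       - (N + 1) * (u * U / K) + 2 * x * y * (p * P / (8 * (N + 1) * (N + 2) * (N + 3) * K) + v * V / (2 * (N + 1) * K))"
    unfolding key using nz K by (simp add: divide_simps) algebra
  then show ?thesis
    unfolding a_def mehler_coeff_def w p r k1 k2 k3 k4
    by (simp add: uv N_def K_def)
qed

section \<open>Mehler's formula\<close>

text \<open>The cases of the recurrence in which some coefficient would have a negative index.\<close>
lemma mehler_coeff_initial:
  shows "mehler_coeff x y 0 = 1"
    and "mehler_coeff x y 1 = 2 * x * y"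
    and "2 * mehler_coeff x y 2 = (1 - 2 * (x\<^sup>2 + y\<^sup>2)) * mehler_coeff x y 0 + 2 * x * y * mehler_coeff x y 1"
    and "3 * mehler_coeff x y 3 = (3 - 2 * (x\<^sup>2 + y\<^sup>2)) * mehler_coeff x y 1 + 2 * x * y * (mehler_coeff x y 2 + mehler_coeff x y 0)"
  by (simp_all add: mehler_coeff_def hermite_eq_herm eval_nat_numeral field_simps)

text \<open>The closed form in Mehler's formula. The inverse square root of \<open>1 - q\<^sup>2\<close> is written with the
  principal logarithm, which is holomorphic here because \<open>1 - q\<^sup>2\<close> has positive real part on the unit disc.\<close>
definition mehler_gen :: "real \<Rightarrow> real \<Rightarrow> complex \<Rightarrow> complex" where
  "mehler_gen x y q = exp ((2 * x * y * q - (x\<^sup>2 + y\<^sup>2) * q\<^sup>2) / (1 - q\<^sup>2) - Ln (1 - q\<^sup>2) / 2)"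

lemma one_minus_square_slit:
  assumes "norm (q :: complex) < 1"
  shows "1 - q\<^sup>2 \<notin> \<real>\<^sub>\<le>\<^sub>0" "1 - q\<^sup>2 \<noteq> 0"
proof -
  have "norm (q\<^sup>2) < 1"
    using assms by (simp add: norm_power power_less_one_iff abs_square_less_1)
  then have "Re (q\<^sup>2) < 1"
    using complex_Re_le_cmod[of "q\<^sup>2"] by linarith
  then have "Re (1 - q\<^sup>2) > 0" by simp
  then show "1 - q\<^sup>2 \<notin> \<real>\<^sub>\<le>\<^sub>0" "1 - q\<^sup>2 \<noteq> 0"
    by (auto simp: complex_nonpos_Reals_iff)
qed

lemma mehler_gen_deriv:
  assumes "norm q < 1"
  shows "(mehler_gen x y has_field_derivative
    mehler_gen x y q * ((2 * x * y + (1 - 2 * (x\<^sup>2 + y\<^sup>2)) * q + 2 * x * y * q\<^sup>2 - q ^ 3) / (1 - q\<^sup>2)\<^sup>2)) (at q)"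
proof -
  note nz = one_minus_square_slit[OF assms]
  define w where "w = 1 - q\<^sup>2"
  define X Y where "X = complex_of_real x" "Y = complex_of_real y"
  have w: "w \<noteq> 0" using nz by (simp add: w_def)
  have q: "q\<^sup>2 = 1 - w" by (simp add: w_def)
  have "((\<lambda>q. exp ((2 * X * Y * q - (X\<^sup>2 + Y\<^sup>2) * q\<^sup>2) / (1 - q\<^sup>2) - Ln (1 - q\<^sup>2) / 2)) has_field_derivative
     exp ((2 * X * Y * q - (X\<^sup>2 + Y\<^sup>2) * q\<^sup>2) / (1 - q\<^sup>2) - Ln (1 - q\<^sup>2) / 2) *
      (((2 * X * Y - (X\<^sup>2 + Y\<^sup>2) * (2 * q)) * (1 - q\<^sup>2) - (2 * X * Y * q - (X\<^sup>2 + Y\<^sup>2) * q\<^sup>2) * (- (2 * q))) / ((1 - q\<^sup>2) * (1 - q\<^sup>2)) + inverse (1 - q\<^sup>2) * q)) (at q)"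
    using nz by (auto intro!: derivative_eq_intros)
  moreover have "((2 * X * Y - (X\<^sup>2 + Y\<^sup>2) * (2 * q)) * (1 - q\<^sup>2) - (2 * X * Y * q - (X\<^sup>2 + Y\<^sup>2) * q\<^sup>2) * (- (2 * q))) / ((1 - q\<^sup>2) * (1 - q\<^sup>2)) + inverse (1 - q\<^sup>2) * q
     = (2 * X * Y + (1 - 2 * (X\<^sup>2 + Y\<^sup>2)) * q + 2 * X * Y * q\<^sup>2 - q ^ 3) / (1 - q\<^sup>2)\<^sup>2"
    using nz(2) by (simp add: divide_simps) algebra
  ultimately show ?thesis
    by (simp add: mehler_gen_def[abs_def] X_Y_def)
qed

text \<open>The Taylor coefficients of \<open>mehler_gen\<close> and the numbers \<open>mehler_coeff\<close> obey one recurrence with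
  the same initial value, hence agree. Convergence in the whole disc comes for free, since
  a holomorphic function is the sum of its Taylor series.\<close>
lemma mehler_sums_complex:
  assumes "norm q < 1"
  shows "(\<lambda>m. of_real (mehler_coeff x y m) * q ^ m) sums mehler_gen x y q"
proof -
  define F where "F = fps_expansion (mehler_gen x y) 0"
  define s where "s = complex_of_real (x\<^sup>2 + y\<^sup>2)"
  define r where "r = complex_of_real (2 * x * y)"
  have holo: "mehler_gen x y holomorphic_on ball 0 1"
    using mehler_gen_deriv[of _ x y] unfolding holomorphic_on_def
    by (metis field_differentiable_at_within field_differentiable_def mem_ball_0)
  have F: "mehler_gen x y has_fps_expansion F"
    unfolding F_def by (rule has_fps_expansion_fps_expansion[OF _ _ holo]) auto
  let ?X = "fps_X :: complex fps"
  let ?p = "fps_const r + fps_const (1 - 2 * s) * ?X + fps_const r * ?X\<^sup>2 - ?X ^ 3"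
  have 1: "(\<lambda>q. (1 - q\<^sup>2)\<^sup>2 * deriv (mehler_gen x y) q) has_fps_expansion (1 - ?X\<^sup>2)\<^sup>2 * fps_deriv F"
    by (intro fps_expansion_intros F)
  have 2: "(\<lambda>q. (r + (1 - 2 * s) * q + r * q\<^sup>2 - q ^ 3) * mehler_gen x y q) has_fps_expansion ?p * F"
    by (intro fps_expansion_intros F)
  have "(\<lambda>q. (1 - q\<^sup>2)\<^sup>2 * deriv (mehler_gen x y) q) has_fps_expansion ?p * F"
  proof (subst has_fps_expansion_cong[OF _ refl])
    show "(\<lambda>q. (r + (1 - 2 * s) * q + r * q\<^sup>2 - q ^ 3) * mehler_gen x y q) has_fps_expansion ?p * F"
      by (fact 2)
    have "\<forall>\<^sub>F q in nhds 0. q \<in> ball (0::complex) 1"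
      by (intro eventually_nhds_in_open) auto
    then show "\<forall>\<^sub>F q in nhds 0. (1 - q\<^sup>2)\<^sup>2 * deriv (mehler_gen x y) q =
         (r + (1 - 2 * s) * q + r * q\<^sup>2 - q ^ 3) * mehler_gen x y q"
    proof eventually_elim
      case (elim q)
      then have n: "norm q < 1" by simp
      have "deriv (mehler_gen x y) q = mehler_gen x y q * ((r + (1 - 2 * s) * q + r * q\<^sup>2 - q ^ 3) / (1 - q\<^sup>2)\<^sup>2)"
        using DERIV_imp_deriv[OF mehler_gen_deriv[OF n, of x y]] by (simp add: r_def s_def)
      then show ?case using one_minus_square_slit(2)[OF n] by simp
    qed
  qed
  from fps_expansion_unique_complex[OF 1 this]
  have ode: "(1 - ?X\<^sup>2)\<^sup>2 * fps_deriv F = ?p * F" .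
  have "fps_deriv F - fps_const 2 * (?X\<^sup>2 * fps_deriv F) + ?X ^ 4 * fps_deriv F = (1 - ?X\<^sup>2)\<^sup>2 * fps_deriv F"
    by (simp add: power2_eq_square algebra_simps eval_nat_numeral numeral_fps_const[symmetric])
  also have "\<dots> = fps_const r * F + fps_const (1 - 2 * s) * (?X * F) + fps_const r * (?X\<^sup>2 * F) - ?X ^ 3 * F"
    unfolding ode by (simp add: algebra_simps)
  finally have "fps_nth (fps_deriv F - fps_const 2 * (?X\<^sup>2 * fps_deriv F) + ?X ^ 4 * fps_deriv F) n =
    fps_nth (fps_const r * F + fps_const (1 - 2 * s) * (?X * F) + fps_const r * (?X\<^sup>2 * F) - ?X ^ 3 * F) n" for n
    by simp
  note rec = this[simplified fps_add_nth fps_sub_nth fps_mult_left_const_nth fps_X_power_mult_nth fps_deriv_nth fps_X_mult_nth]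
  have F0: "fps_nth F 0 = 1"
    using has_fps_expansion_imp_0_eq_fps_nth_0[OF F] by (simp add: mehler_gen_def)
  have eq: "fps_nth F n = of_real (mehler_coeff x y n)" for n
  proof (induction n rule: less_induct)
    case (less n)
    consider "n = 0" | "n = 1" | "n = 2" | "n = 3" | m where "n = m + 4"
      by (metis One_nat_def Suc_1 add.commute add_Suc_right le_add_diff_inverse less_2_cases not_less_eq_eq numeral_3_eq_3 numeral_eq_Suc pred_numeral_simps(2) semiring_norm(26,27) linorder_not_less not_less_less_Suc_eq add_2_eq_Suc less_Suc_eq_le)
    then show ?case
    proof cases
      case 1
      then show ?thesis using F0 by (simp add: mehler_coeff_initial)
    next
      case 2
      then show ?thesis using rec[of 0] F0 mehler_coeff_initial(2)[of x y] by (simp add: r_def)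
    next
      case 3
      have "fps_nth F 1 = of_real (mehler_coeff x y 1)" using less[of 1] 3 by simp
      then have "2 * fps_nth F 2 = of_real (2 * mehler_coeff x y 2)"
        unfolding mehler_coeff_initial(3)
        using rec[of 1] F0 by (simp add: r_def s_def mehler_coeff_initial(1) eval_nat_numeral)
      then show ?thesis using 3 by simp
    next
      case 4
      have "fps_nth F 1 = of_real (mehler_coeff x y 1)" "fps_nth F 2 = of_real (mehler_coeff x y 2)"
        using less 4 by simp_all
      then have "3 * fps_nth F 3 = of_real (3 * mehler_coeff x y 3)"
        unfolding mehler_coeff_initial(4)
        using rec[of 2] F0 by (simp add: r_def s_def mehler_coeff_initial(1) eval_nat_numeral algebra_simps)
      then show ?thesis using 4 by simp
    next
      case 5
      have *: "fps_nth F (m + 3) = of_real (mehler_coeff x y (m + 3))"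
        "fps_nth F (m + 2) = of_real (mehler_coeff x y (m + 2))"
        "fps_nth F (m + 1) = of_real (mehler_coeff x y (m + 1))"
        "fps_nth F m = of_real (mehler_coeff x y m)"
        using less 5 by simp_all
      have "of_nat (m + 4) * fps_nth F (m + 4) = (2 * of_nat m + 5 - 2 * s) * fps_nth F (m + 2)
     - (of_nat m + 1) * fps_nth F m + r * (fps_nth F (m + 3) + fps_nth F (m + 1))"
        using rec[of "m + 3"] by (cases m) (simp_all add: eval_nat_numeral algebra_simps)
      also have "\<dots> = of_real ((real m + 4) * mehler_coeff x y (m + 4))"
        unfolding mehler_coeff_rec * by (simp add: s_def r_def)
      also have "\<dots> = of_nat (m + 4) * of_real (mehler_coeff x y (m + 4))"
        by simp
      finally show ?thesis
        using 5 by (metis mult_cancel_left of_nat_eq_0_iff add_eq_0_iff_both_eq_0 zero_neq_numeral)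
    qed
  qed
  have "(\<lambda>n. fps_nth F n * q ^ n) sums mehler_gen x y q"
    by (rule has_fps_expansion_imp_sums_complex[OF F, of 1]) (use holo assms in \<open>auto simp: one_ereal_def\<close>)
  then show ?thesis by (simp add: eq)
qed

theorem mehler_formula:
  fixes q :: real
  assumes "\<bar>q\<bar> < 1"
  shows "(\<lambda>m. hermite m x * hermite m y / (2 ^ m * fact m) * q ^ m) sums
     (exp ((2 * x * y * q - (x\<^sup>2 + y\<^sup>2) * q\<^sup>2) / (1 - q\<^sup>2)) / sqrt (1 - q\<^sup>2))"
proof -
  have pos: "1 - q\<^sup>2 > 0"
    using assms by (simp add: abs_square_less_1)
  have c: "complex_of_real (1 - q\<^sup>2) = 1 - (complex_of_real q)\<^sup>2" by simp
  have "mehler_gen x y (of_real q) = of_real (exp ((2 * x * y * q - (x\<^sup>2 + y\<^sup>2) * q\<^sup>2) / (1 - q\<^sup>2) - ln (1 - q\<^sup>2) / 2))"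
    unfolding mehler_gen_def c[symmetric] Ln_of_real[OF pos]
    by (simp flip: exp_of_real)
  also have "exp ((2 * x * y * q - (x\<^sup>2 + y\<^sup>2) * q\<^sup>2) / (1 - q\<^sup>2) - ln (1 - q\<^sup>2) / 2)
     = exp ((2 * x * y * q - (x\<^sup>2 + y\<^sup>2) * q\<^sup>2) / (1 - q\<^sup>2)) / sqrt (1 - q\<^sup>2)"
    using pos by (simp add: exp_diff ln_sqrt[symmetric])
  finally have g: "mehler_gen x y (of_real q) = of_real (exp ((2 * x * y * q - (x\<^sup>2 + y\<^sup>2) * q\<^sup>2) / (1 - q\<^sup>2)) / sqrt (1 - q\<^sup>2))" .
  have "(\<lambda>m. of_real (mehler_coeff x y m) * complex_of_real q ^ m) sums mehler_gen x y (of_real q)"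
    by (rule mehler_sums_complex) (use assms in simp)
  then have "(\<lambda>m. complex_of_real (mehler_coeff x y m * q ^ m)) sums of_real (exp ((2 * x * y * q - (x\<^sup>2 + y\<^sup>2) * q\<^sup>2) / (1 - q\<^sup>2)) / sqrt (1 - q\<^sup>2))"
    unfolding g by simp
  then show ?thesis
    unfolding sums_of_real_iff by (simp add: mehler_coeff_def)
qed

section \<open>Lebesgue integrals on Euclidean space\<close>

text \<open>Product integrals over a Euclidean space are indexed by \<open>Basis\<close>; for \<open>real ^ 'n\<close> the
  natural index is the coordinate.\<close>
lemma prod_Basis_vec:
  fixes f :: "real ^ 'n \<Rightarrow> real ^ 'n \<Rightarrow> 'a :: comm_monoid_mult"
  shows "(\<Prod>b\<in>Basis. f b b) = (\<Prod>i\<in>UNIV. f (axis i 1) (axis i (1::real)))"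
proof -
  have B: "(Basis :: (real ^ 'n) set) = range (\<lambda>i. axis i 1)"
    by (auto simp: Basis_vec_def)
  have "inj (\<lambda>i::'n. axis i (1::real))"
    by (auto simp: inj_on_def axis_eq_axis)
  then show ?thesis
    unfolding B by (subst prod.reindex) (auto simp: o_def)
qed

lemma has_bochner_integral_prod_vec:
  fixes f :: "'n :: finite \<Rightarrow> real \<Rightarrow> real"
  assumes int: "\<And>i. integrable lborel (f i)" and nn: "\<And>i x. 0 \<le> f i x"
  shows "has_bochner_integral lborel (\<lambda>z :: real ^ 'n. \<Prod>i\<in>UNIV. f i (z $ i)) (\<Prod>i\<in>UNIV. \<integral>x. f i x \<partial>lborel)"
proof (rule has_bochner_integral_nn_integral)
  have [measurable]: "f i \<in> borel_measurable borel" for i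
    using borel_measurable_integrable[OF int[of i]] by simp
  show "(\<lambda>z :: real ^ 'n. \<Prod>i\<in>UNIV. f i (z $ i)) \<in> borel_measurable lborel"
    by measurable
  \<comment> \<open>the same family of factors, indexed by basis vectors instead of coordinates\<close>
  define g where "g b = f (SOME i. b = axis i 1)" for b :: "real ^ 'n"
  have g: "g (axis i 1) = f i" for i
    by (simp add: g_def axis_eq_axis)
  have gm: "g b \<in> borel_measurable borel" and gn: "g b x \<ge> 0" for b x
    by (simp_all add: g_def nn)
  have "(\<integral>\<^sup>+z. ennreal (\<Prod>i\<in>UNIV. f i (z $ i)) \<partial>(lborel :: (real ^ 'n) measure))
      = (\<integral>\<^sup>+z. (\<Prod>b\<in>Basis. ennreal (g b (z \<bullet> b))) \<partial>(lborel :: (real ^ 'n) measure))"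
    by (subst prod_Basis_vec[where f = "\<lambda>b c. ennreal (g b (_ \<bullet> c))"])
       (simp add: g inner_axis prod_ennreal nn)
  also have "\<dots> = (\<Prod>b\<in>Basis. \<integral>\<^sup>+x. ennreal (g b x) \<partial>lborel)"
    by (rule nn_integral_lborel_prod) (use gm in auto)
  also have "\<dots> = (\<Prod>i\<in>UNIV. \<integral>\<^sup>+x. ennreal (f i x) \<partial>lborel)"
    by (subst prod_Basis_vec[where f = "\<lambda>b c. \<integral>\<^sup>+x. ennreal (g b x) \<partial>lborel"]) (simp add: g)
  also have "\<dots> = (\<Prod>i\<in>UNIV. ennreal (\<integral>x. f i x \<partial>lborel))"
    by (intro prod.cong refl nn_integral_eq_integral int) (auto simp: nn)
  also have "\<dots> = ennreal (\<Prod>i\<in>UNIV. \<integral>x. f i x \<partial>lborel)"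
    by (rule prod_ennreal) (simp add: nn)
  finally show "(\<integral>\<^sup>+z. ennreal (\<Prod>i\<in>UNIV. f i (z $ i)) \<partial>(lborel :: (real ^ 'n) measure)) = ennreal (\<Prod>i\<in>UNIV. \<integral>x. f i x \<partial>lborel)" .
qed (auto simp: nn prod_nonneg)

lemma norm_vec_sq: "(norm (z :: real ^ 'n))\<^sup>2 = (\<Sum>i\<in>UNIV. (z $ i)\<^sup>2)"
  by (simp add: norm_vec_def L2_set_def sum_nonneg)

text \<open>A rescaled normal density of variance \<open>1 / (2 c)\<close>.\<close>
lemma has_bochner_integral_exp_neg_square:
  assumes "c > 0"
  shows "has_bochner_integral lborel (\<lambda>x. exp (- c * x\<^sup>2)) (sqrt (pi / c))"
proof -
  define \<sigma> where "\<sigma> = 1 / sqrt (2 * c)"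
  have s: "\<sigma> > 0" "\<sigma>\<^sup>2 = 1 / (2 * c)" using assms by (simp_all add: \<sigma>_def power_divide)
  have "has_bochner_integral lborel (\<lambda>x. sqrt (pi / c) * normal_density 0 \<sigma> x) (sqrt (pi / c) * 1)"
    using s integral_normal_density[of \<sigma> 0] by (intro has_bochner_integral_mult_right) (auto simp: has_bochner_integral_iff)
  moreover have "(\<lambda>x. sqrt (pi / c) * normal_density 0 \<sigma> x) = (\<lambda>x. exp (- c * x\<^sup>2))"
    using assms by (auto simp: fun_eq_iff normal_density_def s real_sqrt_divide)
  ultimately show ?thesis by simp
qed

text \<open>Differentiation under the integral sign. The mean value theorem bounds the difference quotients
  by the dominating function \<open>g\<close>, so dominated convergence applies along every sequence tending to \<open>s0\<close>.\<close>
lemma DERIV_lebesgue_integral: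
  fixes f f' :: "real \<Rightarrow> 'a \<Rightarrow> real"
  assumes r: "r > 0"
    and int: "\<And>s. \<bar>s - s0\<bar> < r \<Longrightarrow> integrable M (f s)"
    and der: "\<And>s x. \<bar>s - s0\<bar> < r \<Longrightarrow> x \<in> space M \<Longrightarrow> ((\<lambda>s. f s x) has_real_derivative f' s x) (at s)"
    and meas: "f' s0 \<in> borel_measurable M"
    and bound: "\<And>s x. \<bar>s - s0\<bar> < r \<Longrightarrow> x \<in> space M \<Longrightarrow> \<bar>f' s x\<bar> \<le> g x"
    and g: "integrable M g"
  shows "((\<lambda>s. \<integral>x. f s x \<partial>M) has_real_derivative (\<integral>x. f' s0 x \<partial>M)) (at s0)"
proof -
  have lip: "\<bar>(f s x - f s0 x) / (s - s0)\<bar> \<le> g x" if s: "\<bar>s - s0\<bar> < r" and x: "x \<in> space M" for s x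
  proof (cases "s = s0")
    case True
    then show ?thesis using bound[OF s x] by simp
  next
    case False
    have seg: "\<bar>u - s0\<bar> < r" if "u \<in> closed_segment s0 s" for u
      using that s by (auto simp: closed_segment_eq_real_ivl split: if_splits)
    have "norm (f s x - f s0 x) \<le> g x * norm (s - s0)"
    proof (rule field_differentiable_bound[where S = "closed_segment s0 s" and f' = "\<lambda>s. f' s x"])
      show "((\<lambda>s. f s x) has_field_derivative f' u x) (at u within closed_segment s0 s)" if "u \<in> closed_segment s0 s" for u
        using der[OF seg[OF that] x] by (rule has_field_derivative_at_within)
    qed (use bound seg x in auto)
    then show ?thesis using False by (simp add: field_simps)
  qed
  have "((\<lambda>s. ((\<integral>x. f s x \<partial>M) - (\<integral>x. f s0 x \<partial>M)) / (s - s0)) \<longlongrightarrow> (\<integral>x. f' s0 x \<partial>M)) (at s0)"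
    unfolding tendsto_at_iff_sequentially comp_def
  proof (intro allI impI)
    fix X :: "nat \<Rightarrow> real" assume X: "\<forall>i. X i \<in> UNIV - {s0}" "X \<longlonglongrightarrow> s0"
    have "eventually (\<lambda>n. \<bar>X n - s0\<bar> < r) sequentially"
      using X(2) r by (auto simp: tendsto_iff dist_real_def)
    then obtain N where N: "\<And>n. n \<ge> N \<Longrightarrow> \<bar>X n - s0\<bar> < r"
      by (auto simp: eventually_sequentially)
    have "(\<lambda>n. \<integral>x. (f (X (n + N)) x - f s0 x) / (X (n + N) - s0) \<partial>M) \<longlonglongrightarrow> (\<integral>x. f' s0 x \<partial>M)"
    proof (rule integral_dominated_convergence[where w = g])
      show "(\<lambda>x. (f (X (i + N)) x - f s0 x) / (X (i + N) - s0)) \<in> borel_measurable M" for i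
        using int[of s0] int[OF N[of "i + N"]] r by (auto dest!: borel_measurable_integrable)
      show "AE x in M. (\<lambda>i. (f (X (i + N)) x - f s0 x) / (X (i + N) - s0)) \<longlonglongrightarrow> f' s0 x"
      proof (rule AE_I2)
        fix x assume x: "x \<in> space M"
        have "((\<lambda>s. (f s x - f s0 x) / (s - s0)) \<longlongrightarrow> f' s0 x) (at s0)"
          using der[of s0 x] r x by (simp add: has_field_derivative_iff)
        then have "(\<lambda>i. (f (X i) x - f s0 x) / (X i - s0)) \<longlonglongrightarrow> f' s0 x"
          using X unfolding tendsto_at_iff_sequentially comp_def by blast
        then show "(\<lambda>i. (f (X (i + N)) x - f s0 x) / (X (i + N) - s0)) \<longlonglongrightarrow> f' s0 x"
          by (rule LIMSEQ_ignore_initial_segment)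
      qed
      show "AE x in M. norm ((f (X (i + N)) x - f s0 x) / (X (i + N) - s0)) \<le> g x" for i
        using lip[OF N[of "i + N"]] by (auto intro!: AE_I2)
    qed (use meas g in auto)
    moreover have "(\<integral>x. (f (X (n + N)) x - f s0 x) / (X (n + N) - s0) \<partial>M)
        = ((\<integral>x. f (X (n + N)) x \<partial>M) - (\<integral>x. f s0 x \<partial>M)) / (X (n + N) - s0)" for n
      using int[of s0] int[OF N[of "n + N"]] r
      by (subst integral_divide_zero) (simp add: Bochner_Integration.integral_diff)
    ultimately have "(\<lambda>n. ((\<integral>x. f (X (n + N)) x \<partial>M) - (\<integral>x. f s0 x \<partial>M)) / (X (n + N) - s0)) \<longlonglongrightarrow> (\<integral>x. f' s0 x \<partial>M)"
      by (simp only:)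
    then show "(\<lambda>n. ((\<integral>x. f (X n) x \<partial>M) - (\<integral>x. f s0 x \<partial>M)) / (X n - s0)) \<longlonglongrightarrow> (\<integral>x. f' s0 x \<partial>M)"
      by (rule LIMSEQ_offset)
  qed
  then show ?thesis by (simp add: has_field_derivative_iff)
qed

section \<open>Block matrices with diagonal blocks\<close>

lemma sum_UNIV_Plus:
  fixes f :: "'n :: finite + 'm :: finite \<Rightarrow> 'a :: comm_monoid_add"
  shows "(\<Sum>r\<in>UNIV. f r) = (\<Sum>i\<in>UNIV. f (Inl i)) + (\<Sum>i\<in>UNIV. f (Inr i))"
  by (simp add: UNIV_Plus_UNIV[symmetric] sum.Plus del: UNIV_Plus_UNIV)

lemma prod_UNIV_Plus:
  fixes f :: "'n :: finite + 'm :: finite \<Rightarrow> 'a :: comm_monoid_mult"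
  shows "(\<Prod>r\<in>UNIV. f r) = (\<Prod>i\<in>UNIV. f (Inl i)) * (\<Prod>i\<in>UNIV. f (Inr i))"
  by (simp add: UNIV_Plus_UNIV[symmetric] prod.Plus del: UNIV_Plus_UNIV)

text \<open>Triangularity with respect to a ranking of the indices, so that it applies to the index type
  \<open>'n + 'n\<close>, which carries no order. A permutation with nonzero contribution never
  raises the rank; as it preserves the sum of all ranks, it fixes every index.\<close>
lemma det_triangular_rank:
  fixes A :: "'a :: comm_ring_1 ^ 'n ^ 'n" and rk :: "'n \<Rightarrow> nat"
  assumes "\<And>i j. i \<noteq> j \<Longrightarrow> rk i \<le> rk j \<Longrightarrow> A $ i $ j = 0"
  shows "det A = (\<Prod>i\<in>UNIV. A $ i $ i)"
proof -
  have zero: "(\<Prod>i\<in>UNIV. A $ i $ p i) = 0" if p: "p permutes UNIV" and ne: "p \<noteq> id" for p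
  proof (rule ccontr)
    assume "(\<Prod>i\<in>UNIV. A $ i $ p i) \<noteq> 0"
    then have nz: "A $ i $ p i \<noteq> 0" for i by (metis UNIV_I finite prod_zero)
    have lt: "p i = i \<or> rk (p i) < rk i" for i
      using assms[of i "p i"] nz[of i] by (metis not_le)
    then have le: "\<And>i. rk (p i) \<le> rk i" by (metis less_imp_le order_refl)
    obtain j where "p j \<noteq> j" using ne by (auto simp: fun_eq_iff)
    then have "rk (p j) < rk j" using lt by blast
    then have "(\<Sum>i\<in>UNIV. rk (p i)) < (\<Sum>i\<in>UNIV. rk i)"
      using le by (intro sum_strict_mono_ex1) auto
    moreover have "(\<Sum>i\<in>UNIV. rk (p i)) = (\<Sum>i\<in>UNIV. rk i)"
      using sum.permute[OF p, of rk] by (simp add: o_def)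
    ultimately show False by simp
  qed
  have "det A = (\<Sum>p\<in>{id}. of_int (sign p) * (\<Prod>i\<in>UNIV. A $ i $ p i))"
    unfolding det_def
    by (rule sum.mono_neutral_right) (auto simp: permutes_id zero finite_permutations)
  then show ?thesis by simp
qed

lemma det_diag: "det (diag p) = (\<Prod>i\<in>UNIV. p $ i)"
  by (subst det_diagonal) (auto simp: diag_def)

text \<open>Eliminating the lower left block factors the matrix into a lower and an upper triangular
  one.\<close>
lemma det_block_diag:
  fixes p r q u :: "real ^ 'n"
  assumes "\<And>i. p $ i \<noteq> 0"
  shows "det (block_matrix (diag p) (diag r) (diag q) (diag u)) = (\<Prod>i\<in>UNIV. p $ i * u $ i - r $ i * q $ i)"
proof -
  define L where "L = block_matrix (mat 1) 0 (diag (\<chi> i. q $ i / p $ i)) (mat 1 :: real ^ 'n ^ 'n)"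
  define R where "R = block_matrix (diag p) (diag r) 0 (diag (\<chi> i. u $ i - q $ i * r $ i / p $ i))"
  have "block_matrix (diag p) (diag r) (diag q) (diag u) = L ** R"
  proof (intro vec_eq_iff[THEN iffD2] allI)
    fix a b
    show "block_matrix (diag p) (diag r) (diag q) (diag u) $ a $ b = (L ** R) $ a $ b"
      using assms
      by (cases a; cases b)
        (simp_all add: L_def R_def block_matrix_def matrix_matrix_mult_def sum_UNIV_Plus diag_def mat_def
          if_distrib[of "\<lambda>x. x * _"] if_distrib[of "\<lambda>x. _ * x"] if_distrib[of "\<lambda>x. x / _"] cong: if_cong)
  qed
  then have "det (block_matrix (diag p) (diag r) (diag q) (diag u)) = det L * det R"
    by (simp add: det_mul)
  also have "det L = 1"
    by (subst det_triangular_rank[where rk = "\<lambda>r. case r of Inl _ \<Rightarrow> 0 | Inr _ \<Rightarrow> 1"])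
       (auto simp: L_def block_matrix_def diag_def mat_def prod_UNIV_Plus split: sum.splits)
  also have "det R = (\<Prod>i\<in>UNIV. p $ i) * (\<Prod>i\<in>UNIV. u $ i - q $ i * r $ i / p $ i)"
    by (subst det_triangular_rank[where rk = "\<lambda>r. case r of Inl _ \<Rightarrow> 1 | Inr _ \<Rightarrow> 0"])
       (auto simp: R_def block_matrix_def diag_def mat_def prod_UNIV_Plus split: sum.splits)
  also have "1 * \<dots> = (\<Prod>i\<in>UNIV. p $ i * u $ i - r $ i * q $ i)"
    unfolding mult_1 prod.distrib[symmetric] using assms by (intro prod.cong refl) (simp add: field_simps)
  finally show ?thesis .
qed

lemma quadratic_form_block_diag:
  "stack y z \<bullet> (block_matrix (diag p) (diag r) (diag r) (diag p) *v stack y z) =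
    (\<Sum>i\<in>UNIV. p $ i * ((y $ i)\<^sup>2 + (z $ i)\<^sup>2) + 2 * r $ i * y $ i * z $ i)"
proof -
  let ?v = "block_matrix (diag p) (diag r) (diag r) (diag p) *v stack y z"
  have "?v $ Inl i = p $ i * y $ i + r $ i * z $ i" "?v $ Inr i = r $ i * y $ i + p $ i * z $ i" for i
    by (simp_all add: matrix_vector_mult_def sum_UNIV_Plus block_matrix_def stack_def diag_def
      if_distrib[of "\<lambda>x. x * _"] cong: if_cong)
  then show ?thesis
    by (simp add: inner_vec_def sum_UNIV_Plus stack_def sum.distrib[symmetric] power2_eq_square algebra_simps)
qed

lemma diag_map_diag: "diag_map f (diag d) = diag (\<chi> i. f (d $ i))"
  by (simp add: diag_map_def diag_def vec_eq_iff)

lemma scaleR_diag: "c *\<^sub>R diag d = diag (\<chi> i. c * d $ i)"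
  by (simp add: diag_def vec_eq_iff)

lemma uminus_diag: "- diag d = diag (\<chi> i. - d $ i)"
  by (simp add: diag_def vec_eq_iff)

lemma diag_mult_diag: "diag p ** diag q = diag (\<chi> i. p $ i * q $ i)"
  by (simp add: diag_def vec_eq_iff matrix_matrix_mult_def if_distrib[of "\<lambda>x. x * _"] cong: if_cong)

lemma M_mat_diag:
  fixes d :: "real ^ 'n" and t t0 :: real
  defines "P \<equiv> diag (\<chi> i. sqrt (d $ i) * coth (2 * (t - t0) * sqrt (d $ i)))"
    and "Q \<equiv> diag (\<chi> i. - (sqrt (d $ i) * csch (2 * (t - t0) * sqrt (d $ i))))"
  shows "M_mat (diag d) t0 t = block_matrix P Q Q P"
  by (simp add: M_mat_def Let_def diag_map_diag scaleR_diag diag_mult_diag uminus_diag P_def Q_def)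

section \<open>Maximum principle and uniqueness\<close>

lemma quadratic_form_diag: "y \<bullet> (diag d *v y) = (\<Sum>i\<in>UNIV. d $ i * (y $ i)\<^sup>2)"
proof -
  have "(diag d *v y) $ i = d $ i * y $ i" for i
    by (simp add: diag_def matrix_vector_mult_def if_distrib[of "\<lambda>x. x * _"] cong: if_cong)
  then show ?thesis
    by (simp add: inner_vec_def power2_eq_square algebra_simps)
qed

lemma norm_add_axis_sq: "(norm (y + s *\<^sub>R axis i 1 :: real ^ 'n))\<^sup>2 = (norm y)\<^sup>2 + 2 * s * y $ i + s\<^sup>2"
  unfolding power2_norm_eq_inner
  by (simp add: inner_add_left inner_add_right inner_axis inner_axis' power2_eq_square algebra_simps)

text \<open>Partial derivatives are defined by a derivative at \<open>0\<close>; along the line in direction \<open>i\<close> they are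
  derivatives at every point.\<close>
lemma partially_differentiable_DERIV:
  assumes "partially_differentiable i f (x + s *\<^sub>R axis i 1)"
  shows "((\<lambda>s. f (x + s *\<^sub>R axis i 1)) has_real_derivative partial_deriv i f (x + s *\<^sub>R axis i 1)) (at s)"
proof -
  have "((\<lambda>u. f (x + s *\<^sub>R axis i 1 + u *\<^sub>R axis i 1)) has_real_derivative partial_deriv i f (x + s *\<^sub>R axis i 1)) (at 0)"
    using assms unfolding partially_differentiable_def partial_deriv_def
    by (simp add: DERIV_deriv_iff_field_differentiable)
  then have "((\<lambda>u. f (x + (s + u) *\<^sub>R axis i 1)) has_real_derivative partial_deriv i f (x + s *\<^sub>R axis i 1)) (at 0)"
    by (simp add: scaleR_add_left add.assoc)
  then show ?thesis
    using DERIV_at_within_shift[of "\<lambda>u. f (x + u *\<^sub>R axis i 1)" "partial_deriv i f (x + s *\<^sub>R axis i 1)" s 0 UNIV] by simp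
qed

text \<open>Only pointwise differentiability is assumed, as this is all that a solution provides: a positive
  second derivative would make \<open>f'\<close> positive just to the right of the maximum.\<close>
lemma second_derivative_at_max:
  fixes f :: "real \<Rightarrow> real"
  assumes f: "\<And>s. (f has_real_derivative f' s) (at s)"
    and f': "(f' has_real_derivative L) (at 0)" and max: "\<And>s. f s \<le> f 0"
  shows "L \<le> 0"
proof (rule ccontr)
  assume "\<not> L \<le> 0"
  then obtain e where e: "e > 0" "\<And>h. h > 0 \<Longrightarrow> h < e \<Longrightarrow> f' 0 < f' (0 + h)"
    using DERIV_pos_inc_right[OF f'] by (metis not_le)
  have "f' 0 = 0"
    by (rule DERIV_local_max[OF f, of 1]) (use max in auto)
  have "\<exists>z. 0 < z \<and> z < e / 2 \<and> f (e / 2) - f 0 = (e / 2 - 0) * f' z"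
    by (rule MVT2) (use e f in auto)
  then obtain z where z: "0 < z" "z < e / 2" "f (e / 2) - f 0 = (e / 2) * f' z" by auto
  then have "f' z > 0" using e(2)[of z] e(1) \<open>f' 0 = 0\<close> by simp
  then have "e / 2 * f' z > 0" using e(1) by simp
  then have "f (e / 2) - f 0 > 0" using z(3) by linarith
  then show False using max[of "e / 2"] by simp
qed

text \<open>The maximum principle. Subtracting a small multiple \<open>\<delta> \<phi>\<close> of the barrier \<open>\<phi>\<close> from \<open>w\<close> gives a
  function \<open>v\<close> that is nonpositive far away, because \<open>w\<close> grows slower than \<open>\<phi>\<close>, and negative
  at time \<open>t0\<close>. If \<open>v\<close> were positive somewhere, it would have a positive maximum at a later
  time. There the second derivatives in space are nonpositive and the derivative in time is
  nonnegative, while \<open>\<phi>\<close> is a strict supersolution of the equation.\<close>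
lemma solution_nonpos:
  fixes d :: "real ^ 'n"
  assumes d: "\<And>i. 0 < d $ i" and sol: "is_solution (diag d) t0 \<eta>0 w" and init: "\<And>y. \<eta>0 y \<le> 0"
    and "t0 \<le> T"
  shows "w T ys \<le> 0"
proof (rule ccontr)
  assume "\<not> w T ys \<le> 0"
  then have pos: "w T ys > 0" by simp
  have w0: "w t0 y \<le> 0" for y using sol init by (simp add: is_solution_def)
  define c where "c = Min (range (\<lambda>i. d $ i))"
  have c: "c > 0" "\<And>i. c \<le> d $ i" using d by (auto simp: c_def)
  \<comment> \<open>\<open>a\<close> and \<open>b\<close> are chosen so that \<open>b - 4 a\<^sup>2 \<bar>y\<bar>\<^sup>2 - 2 n a + y \<bullet> (D *v y) \<ge> 1\<close>,
    which makes \<open>\<phi>\<close> a strict supersolution\<close>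
  define a where "a = sqrt c / 2"
  have a: "a > 0" "4 * a\<^sup>2 = c" using c by (simp_all add: a_def power_divide)
  define b where "b = 2 * real CARD('n) * a + 1"
  define \<phi> where "\<phi> t y = exp (a * (norm (y :: real ^ 'n))\<^sup>2 + b * (t - t0))" for t y
  have b: "b > 0" using a by (simp add: b_def add_nonneg_pos)
  \<comment> \<open>half of the largest multiple of the barrier that keeps \<open>v\<close> nonnegative at \<open>(T, ys)\<close>\<close>
  define \<delta> where "\<delta> = w T ys / (2 * \<phi> T ys)"
  have \<phi>: "\<phi> t y > 0" for t y by (simp add: \<phi>_def)
  have \<delta>: "\<delta> > 0" using pos \<phi> by (simp add: \<delta>_def)
  define v where "v t y = w t y - \<delta> * \<phi> t y" for t y
  have vs: "v T ys > 0" using pos \<phi>[of T ys] by (simp add: v_def \<delta>_def)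
  have v0: "v t0 y < 0" for y using w0[of y] mult_pos_pos[OF \<delta> \<phi>[of t0 y]] by (simp add: v_def)
  obtain C where C: "\<And>t y. t \<in> {t0..T} \<Longrightarrow> \<bar>w t y\<bar> \<le> C * exp ((a / 2) * (norm y)\<^sup>2)"
  proof -
    have "\<forall>T\<ge>t0. \<forall>\<epsilon>>0. \<exists>C. \<forall>t\<in>{t0..T}. \<forall>y. \<bar>w t y\<bar> \<le> C * exp (\<epsilon> * (norm y)\<^sup>2)"
      using sol by (simp add: is_solution_def)
    from this[rule_format, OF \<open>t0 \<le> T\<close>, of "a / 2"] a
    obtain C where "\<forall>t\<in>{t0..T}. \<forall>y. \<bar>w t y\<bar> \<le> C * exp (a / 2 * (norm y)\<^sup>2)" by auto
    then show ?thesis by (intro that) blast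
  qed
  have C0: "C \<ge> 0" using C[of T 0] \<open>t0 \<le> T\<close> by simp
  \<comment> \<open>beyond this radius \<open>C exp (a \<bar>y\<bar>\<^sup>2 / 2) \<le> \<delta> exp (a \<bar>y\<bar>\<^sup>2)\<close>; the summand \<open>norm ys\<close>
    keeps \<open>ys\<close> inside\<close>
  define R where "R = sqrt (2 * C / (a * \<delta>)) + norm ys"
  have R: "R \<ge> norm ys" using a \<delta> C0 by (simp add: R_def)
  have far: "v t y \<le> 0" if t: "t \<in> {t0..T}" and y: "norm y > R" for t y
  proof -
    have "norm y \<ge> sqrt (2 * C / (a * \<delta>))" using y by (simp add: R_def) (smt (verit) norm_ge_zero)
    then have "(norm y)\<^sup>2 \<ge> 2 * C / (a * \<delta>)"
      using real_le_rsqrt sqrt_le_D by blast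
    then have "C \<le> \<delta> * (a / 2 * (norm y)\<^sup>2)"
      using a \<delta> by (simp add: field_simps)
    also have "\<dots> \<le> \<delta> * exp (a / 2 * (norm y)\<^sup>2)"
      using \<delta> exp_ge_add_one_self[of "a / 2 * (norm y)\<^sup>2"] by (intro mult_left_mono) linarith+
    finally have 1: "C \<le> \<delta> * exp (a / 2 * (norm y)\<^sup>2)" .
    have "w t y \<le> C * exp (a / 2 * (norm y)\<^sup>2)" using C[OF t, of y] by linarith
    also have "\<dots> \<le> \<delta> * exp (a / 2 * (norm y)\<^sup>2) * exp (a / 2 * (norm y)\<^sup>2)"
      using 1 by (intro mult_right_mono) auto
    also have "\<dots> = \<delta> * exp (a * (norm y)\<^sup>2)" by (simp flip: exp_add)
    also have "\<dots> \<le> \<delta> * \<phi> t y"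
      using \<delta> b t by (simp add: \<phi>_def)
    finally show ?thesis by (simp add: v_def)
  qed
  define K where "K = {t0..T} \<times> cball (0 :: real ^ 'n) R"
  have "continuous_on K (\<lambda>(t, y). w t y)"
    using sol unfolding is_solution_def K_def by (auto elim!: continuous_on_subset)
  then have "continuous_on K (\<lambda>p. v (fst p) (snd p))"
    unfolding v_def \<phi>_def case_prod_beta by (intro continuous_intros)
  moreover have "compact K" unfolding K_def by (intro compact_Times) auto
  moreover have "(T, ys) \<in> K" using R \<open>t0 \<le> T\<close> by (simp add: K_def)
  ultimately obtain p where p: "p \<in> K" "\<And>q. q \<in> K \<Longrightarrow> v (fst q) (snd q) \<le> v (fst p) (snd p)"
    using continuous_attains_sup[of K "\<lambda>p. v (fst p) (snd p)"] by blast
  define t1 y1 where "t1 = fst p" "y1 = snd p"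
  have m0: "v t1 y1 > 0" using p(2)[OF \<open>(T, ys) \<in> K\<close>] vs by (simp add: t1_y1_def)
  have t1: "t1 \<in> {t0..T}" using p(1) by (auto simp: K_def t1_y1_def)
  have max: "v t y \<le> v t1 y1" if "t \<in> {t0..T}" for t y
  proof (cases "norm y > R")
    case True
    then show ?thesis using far[OF that True] m0 by simp
  next
    case False
    then show ?thesis using p(2)[of "(t, y)"] that by (simp add: K_def t1_y1_def)
  qed
  have t1': "t1 > t0" using t1 v0[of y1] m0 by (cases "t1 = t0") auto
  have pde: "solves_pde (diag d) t0 w" using sol by (simp add: is_solution_def)
  define V where "V = (\<Sum>i\<in>UNIV. d $ i * (y1 $ i)\<^sup>2)"
  have "((\<lambda>s. w s y1) has_real_derivative laplacian (w t1) y1 - V * w t1 y1) (at t1)"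
    using pde t1' unfolding solves_pde_def quadratic_form_diag V_def by blast
  then have dt: "((\<lambda>s. v s y1) has_real_derivative laplacian (w t1) y1 - V * w t1 y1 - \<delta> * (b * \<phi> t1 y1)) (at t1)"
    unfolding v_def \<phi>_def by (auto intro!: derivative_eq_intros)
  have dt_nonneg: "laplacian (w t1) y1 - V * w t1 y1 - \<delta> * (b * \<phi> t1 y1) \<ge> 0"
  proof (rule ccontr)
    assume "\<not> ?thesis"
    then obtain e where e: "e > 0" "\<And>h. h > 0 \<Longrightarrow> h < e \<Longrightarrow> v t1 y1 < v (t1 - h) y1"
      using DERIV_neg_dec_left[OF dt] by (metis not_le)
    define h where "h = min (e / 2) ((t1 - t0) / 2)"
    have "h > 0" "h < e" "h \<le> t1 - t0" using e t1' by (simp_all add: h_def min_def field_simps)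
    then show False using e(2)[of h] max[of "t1 - h" y1] t1 by force
  qed
  have dxx: "partial_deriv i (partial_deriv i (w t1)) y1 \<le> \<delta> * \<phi> t1 y1 * (2 * a + 4 * a\<^sup>2 * (y1 $ i)\<^sup>2)" for i
  proof -
    let ?x = "\<lambda>s. y1 + s *\<^sub>R axis i 1"
    have \<phi>x: "\<phi> t1 (?x s) = exp (a * ((norm y1)\<^sup>2 + 2 * s * y1 $ i + s\<^sup>2) + b * (t1 - t0))" for s
      by (simp add: \<phi>_def norm_add_axis_sq)
    have d\<phi>: "((\<lambda>s. \<phi> t1 (?x s)) has_real_derivative \<phi> t1 (?x s) * (a * (2 * y1 $ i + 2 * s))) (at s)" for s
      unfolding \<phi>x by (auto intro!: derivative_eq_intros)
    have p1: "partially_differentiable i (w t1) y" and p2: "partially_differentiable i (partial_deriv i (w t1)) y" for y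
      using pde t1' by (auto simp: solves_pde_def)
    have "partial_deriv i (partial_deriv i (w t1)) (?x 0) - \<delta> * (\<phi> t1 (?x 0) * (a * (2 * y1 $ i + 2 * 0)) * (a * (2 * y1 $ i + 2 * 0)) + \<phi> t1 (?x 0) * (a * 2)) \<le> 0"
    proof (rule second_derivative_at_max[where f = "\<lambda>s. v t1 (?x s)" and
          f' = "\<lambda>s. partial_deriv i (w t1) (?x s) - \<delta> * (\<phi> t1 (?x s) * (a * (2 * y1 $ i + 2 * s)))"])
      show "((\<lambda>s. v t1 (?x s)) has_real_derivative partial_deriv i (w t1) (?x s) - \<delta> * (\<phi> t1 (?x s) * (a * (2 * y1 $ i + 2 * s)))) (at s)" for s
        unfolding v_def by (intro derivative_intros d\<phi> DERIV_cmult partially_differentiable_DERIV p1)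
      show "((\<lambda>s. partial_deriv i (w t1) (?x s) - \<delta> * (\<phi> t1 (?x s) * (a * (2 * y1 $ i + 2 * s)))) has_real_derivative
        partial_deriv i (partial_deriv i (w t1)) (?x 0) - \<delta> * (\<phi> t1 (?x 0) * (a * (2 * y1 $ i + 2 * 0)) * (a * (2 * y1 $ i + 2 * 0)) + \<phi> t1 (?x 0) * (a * 2))) (at 0)"
        by (rule derivative_eq_intros d\<phi> partially_differentiable_DERIV p2 refl | simp add: algebra_simps)+
      show "v t1 (?x s) \<le> v t1 (?x 0)" for s using max[OF t1] by simp
    qed
    then show ?thesis by (simp add: algebra_simps power2_eq_square)
  qed
  have "laplacian (w t1) y1 \<le> (\<Sum>i\<in>UNIV. \<delta> * \<phi> t1 y1 * (2 * a + 4 * a\<^sup>2 * (y1 $ i)\<^sup>2))"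
    unfolding laplacian_def by (intro sum_mono dxx)
  also have "\<dots> = \<delta> * \<phi> t1 y1 * (2 * real CARD('n) * a + (\<Sum>i\<in>UNIV. c * (y1 $ i)\<^sup>2))"
    by (simp add: sum_distrib_left[symmetric] sum.distrib a(2))
  also have "\<dots> \<le> \<delta> * \<phi> t1 y1 * (2 * real CARD('n) * a + V)"
    using \<delta> \<phi>[of t1 y1] unfolding V_def
    by (intro mult_left_mono add_left_mono sum_mono mult_right_mono c) auto
  finally have lap: "laplacian (w t1) y1 \<le> \<delta> * \<phi> t1 y1 * (b - 1 + V)" by (simp add: b_def)
  have "V \<ge> 0" unfolding V_def using d by (intro sum_nonneg) (simp add: less_imp_le)
  then have "V * v t1 y1 \<ge> 0" using m0 by simp
  then have "laplacian (w t1) y1 - V * w t1 y1 - \<delta> * (b * \<phi> t1 y1) \<le> - (\<delta> * \<phi> t1 y1)"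
    using lap by (simp add: v_def algebra_simps)
  also have "\<dots> < 0" using \<delta> \<phi>[of t1 y1] by simp
  finally show False using dt_nonneg by simp
qed

lemma partial_deriv_diff:
  assumes "partially_differentiable i f x" "partially_differentiable i g x"
  shows "partial_deriv i (\<lambda>x. f x - g x) x = partial_deriv i f x - partial_deriv i g x"
    and "partially_differentiable i (\<lambda>x. f x - g x) x"
  using assms unfolding partial_deriv_def partially_differentiable_def
  by (auto intro!: field_differentiable_diff)

lemma is_solution_diff:
  assumes f: "is_solution D t0 f0 f" and g: "is_solution D t0 g0 g"
  shows "is_solution D t0 (\<lambda>y. f0 y - g0 y) (\<lambda>t y. f t y - g t y)"
  unfolding is_solution_def
proof (intro conjI allI impI)
  have pf: "solves_pde D t0 f" and pg: "solves_pde D t0 g" using f g by (auto simp: is_solution_def)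
  show "solves_pde D t0 (\<lambda>t y. f t y - g t y)"
    unfolding solves_pde_def
  proof (intro allI impI conjI)
    fix t y i assume t: "t > t0"
    have 1: "partially_differentiable i (f t) y" "partially_differentiable i (partial_deriv i (f t)) y"
      "partially_differentiable i (g t) y" "partially_differentiable i (partial_deriv i (g t)) y" for i y
      using pf pg t by (auto simp: solves_pde_def)
    have p1: "partial_deriv i (\<lambda>y. f t y - g t y) = (\<lambda>y. partial_deriv i (f t) y - partial_deriv i (g t) y)" for i
      by (intro ext partial_deriv_diff 1)
    show "partially_differentiable i (\<lambda>y. f t y - g t y) y"
      "partially_differentiable i (partial_deriv i (\<lambda>y. f t y - g t y)) y"
      unfolding p1 by (intro partial_deriv_diff 1)+
    have "laplacian (\<lambda>y. f t y - g t y) y = laplacian (f t) y - laplacian (g t) y"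
      unfolding laplacian_def p1 by (simp add: partial_deriv_diff 1 sum_subtractf)
    moreover have "((\<lambda>s. f s y) has_real_derivative laplacian (f t) y - (y \<bullet> (D *v y)) * f t y) (at t)"
      "((\<lambda>s. g s y) has_real_derivative laplacian (g t) y - (y \<bullet> (D *v y)) * g t y) (at t)"
      using pf pg t by (auto simp: solves_pde_def)
    ultimately show "((\<lambda>s. f s y - g s y) has_real_derivative
        laplacian (\<lambda>y. f t y - g t y) y - (y \<bullet> (D *v y)) * (f t y - g t y)) (at t)"
      by (auto intro!: derivative_eq_intros simp: algebra_simps)
  qed
  show "f t0 y - g t0 y = f0 y - g0 y" for y
    using f g by (simp add: is_solution_def)
  show "continuous_on ({t0..} \<times> UNIV) (\<lambda>(t, y). f t y - g t y)"
    using f g unfolding is_solution_def case_prod_beta by (auto intro!: continuous_on_diff)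
  fix T \<epsilon> :: real assume T: "T \<ge> t0" "\<epsilon> > 0"
  obtain A B where A: "\<forall>t\<in>{t0..T}. \<forall>y. \<bar>f t y\<bar> \<le> A * exp (\<epsilon> * (norm y)\<^sup>2)"
    and B: "\<forall>t\<in>{t0..T}. \<forall>y. \<bar>g t y\<bar> \<le> B * exp (\<epsilon> * (norm y)\<^sup>2)"
    using f g T unfolding is_solution_def by meson
  show "\<exists>C. \<forall>t\<in>{t0..T}. \<forall>y. \<bar>f t y - g t y\<bar> \<le> C * exp (\<epsilon> * (norm y)\<^sup>2)"
  proof (intro exI[of _ "A + B"] ballI allI)
    fix t y assume "t \<in> {t0..T}"
    then show "\<bar>f t y - g t y\<bar> \<le> (A + B) * exp (\<epsilon> * (norm y)\<^sup>2)"
      using A[rule_format, of t y] B[rule_format, of t y] by (simp add: distrib_right)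
  qed
qed

lemma solution_unique:
  fixes d :: "real ^ 'n"
  assumes d: "\<And>i. 0 < d $ i" and f: "is_solution (diag d) t0 \<eta>0 f" and g: "is_solution (diag d) t0 \<eta>0 g"
    and "t0 \<le> t"
  shows "f t y = g t y"
  using solution_nonpos[OF d is_solution_diff[OF f g] _ \<open>t0 \<le> t\<close>, of y]
    solution_nonpos[OF d is_solution_diff[OF g f] _ \<open>t0 \<le> t\<close>, of y] by simp

section \<open>The one-dimensional kernel and its Hermite series\<close>

definition mehler_term :: "real \<Rightarrow> real \<Rightarrow> real \<Rightarrow> real \<Rightarrow> nat \<Rightarrow> real" where
  "mehler_term \<omega> \<tau> y z m = sqrt \<omega> / (sqrt pi * 2 ^ m * fact m) *
     exp (- \<tau> * \<omega> * (2 * real m + 1) - (y\<^sup>2 + z\<^sup>2) * \<omega> / 2) * hermite m (sqrt \<omega> * y) * hermite m (sqrt \<omega> * z)"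

definition mehler_kernel :: "real \<Rightarrow> real \<Rightarrow> real \<Rightarrow> real \<Rightarrow> real" where
  "mehler_kernel \<omega> \<tau> y z = sqrt (\<omega> / (2 * pi * sinh (2 * \<omega> * \<tau>))) *
     exp (- (\<omega> / 2) * ((cosh (2 * \<omega> * \<tau>) * (y\<^sup>2 + z\<^sup>2) - 2 * y * z) / sinh (2 * \<omega> * \<tau>)))"

text \<open>The geometric mean of the kernel values at \<open>(y, y)\<close> and \<open>(z, z)\<close>.\<close>
definition mehler_majorant :: "real \<Rightarrow> real \<Rightarrow> real \<Rightarrow> real \<Rightarrow> real" where
  "mehler_majorant \<omega> \<tau> y z = sqrt (\<omega> / (2 * pi * sinh (2 * \<omega> * \<tau>))) * exp (- (\<omega> / 2) * tanh (\<omega> * \<tau>) * (y\<^sup>2 + z\<^sup>2))"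

lemma mehler_mehler_log_dyos: "\<omega> > 0 \<Longrightarrow> \<tau> > 0 \<Longrightarrow> mehler_kernel \<omega> \<tau> y z > 0"
  by (simp add: mehler_kernel_def)

lemma tanh_half_sinh: "sinh (2 * x) * tanh x = cosh (2 * x) - (1::real)"
proof -
  have "sinh (2 * x) * tanh x = 2 * (sinh x)\<^sup>2"
    by (simp add: sinh_double tanh_def power2_eq_square)
  also have "\<dots> = cosh (2 * x) - 1"
    by (simp add: cosh_double cosh_square_eq)
  finally show ?thesis .
qed

text \<open>The off-diagonal decay separated from the diagonal decay, by means of
  \<open>(cosh s - 1) / sinh s = tanh (s / 2)\<close>. The first exponential is that of a normal density in \<open>z - y\<close>.\<close>
lemma mehler_kernel_split:
  assumes "\<omega> > 0" "\<tau> > 0"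
  shows "mehler_kernel \<omega> \<tau> y z = sqrt (\<omega> / (2 * pi * sinh (2 * \<omega> * \<tau>))) *
     exp (- ((z - y)\<^sup>2 * \<omega> / (2 * sinh (2 * \<omega> * \<tau>)))) * exp (- (\<omega> / 2) * tanh (\<omega> * \<tau>) * (y\<^sup>2 + z\<^sup>2))"
proof -
  define S where "S = sinh (2 * \<omega> * \<tau>)"
  have S: "S > 0" using assms by (simp add: S_def)
  have "cosh (2 * \<omega> * \<tau>) = S * tanh (\<omega> * \<tau>) + 1"
    using tanh_half_sinh[of "\<omega> * \<tau>"] by (simp add: S_def mult.assoc)
  then have "- (\<omega> / 2) * ((cosh (2 * \<omega> * \<tau>) * (y\<^sup>2 + z\<^sup>2) - 2 * y * z) / S) =
      - ((z - y)\<^sup>2 * \<omega> / (2 * S)) + - (\<omega> / 2) * tanh (\<omega> * \<tau>) * (y\<^sup>2 + z\<^sup>2)"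
    using S by (simp add: field_simps power2_eq_square)
  then show ?thesis
    unfolding mehler_kernel_def S_def[symmetric] by (simp only: exp_add mult.assoc)
qed

lemma mehler_kernel_le_majorant:
  assumes "\<omega> > 0" "\<tau> > 0"
  shows "mehler_kernel \<omega> \<tau> y z \<le> mehler_majorant \<omega> \<tau> y z"
proof -
  have "exp (- ((z - y)\<^sup>2 * \<omega> / (2 * sinh (2 * \<omega> * \<tau>)))) \<le> 1"
    using assms by simp
  then show ?thesis
    unfolding mehler_kernel_split[OF assms] mehler_majorant_def
    using assms by (intro mult_right_mono mult_left_le) auto
qed

lemma mehler_kernel_diagonal:
  assumes "\<omega> > 0" "\<tau> > 0"
  shows "mehler_kernel \<omega> \<tau> y y * mehler_kernel \<omega> \<tau> z z = (mehler_majorant \<omega> \<tau> y z)\<^sup>2"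
proof -
  have "exp (- (\<omega> / 2) * tanh (\<omega> * \<tau>) * (y\<^sup>2 + y\<^sup>2)) * exp (- (\<omega> / 2) * tanh (\<omega> * \<tau>) * (z\<^sup>2 + z\<^sup>2))
     = (exp (- (\<omega> / 2) * tanh (\<omega> * \<tau>) * (y\<^sup>2 + z\<^sup>2)))\<^sup>2"
    by (simp add: power2_eq_square exp_add[symmetric] algebra_simps)
  then show ?thesis
    unfolding mehler_kernel_split[OF assms] mehler_majorant_def
    by (simp add: power2_eq_square)
qed

lemma mehler_majorant_nonneg: "\<omega> > 0 \<Longrightarrow> \<tau> > 0 \<Longrightarrow> mehler_majorant \<omega> \<tau> y z \<ge> 0"
  by (simp add: mehler_majorant_def)

text \<open>Mehler's formula at \<open>x = sqrt \<omega> y\<close>, \<open>sqrt \<omega> z\<close> and \<open>q = exp (- s)\<close> with \<open>s = 2 \<omega> \<tau>\<close>, where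
  \<open>1 - q\<^sup>2 = 2 q sinh s\<close> and \<open>1 + q\<^sup>2 = 2 q cosh s\<close>.\<close>
lemma mehler_term_sums:
  assumes "\<omega> > 0" "\<tau> > 0"
  shows "mehler_term \<omega> \<tau> y z sums mehler_kernel \<omega> \<tau> y z"
proof -
  define s where "s = 2 * \<omega> * \<tau>"
  define q where "q = exp (- s)"
  define S where "S = sinh s"
  have s: "s > 0" using assms by (simp add: s_def)
  have S: "S > 0" using s by (simp add: S_def)
  have q: "\<bar>q\<bar> < 1" using s by (simp add: q_def)
  have q0: "q > 0" by (simp add: q_def)
  have e: "exp s = 1 / q" by (simp add: q_def exp_minus field_simps)
  have w: "1 - q\<^sup>2 = 2 * S * q"
    using q0 by (simp add: S_def sinh_field_def q_def[symmetric] e field_simps power2_eq_square)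
  have ch: "cosh s = (1 + q\<^sup>2) / (2 * q)"
    using q0 by (simp add: cosh_field_def q_def[symmetric] e field_simps power2_eq_square)
  define X Y where "X = sqrt \<omega> * y" "Y = sqrt \<omega> * z"
  have XY: "X\<^sup>2 = \<omega> * y\<^sup>2" "Y\<^sup>2 = \<omega> * z\<^sup>2" "X * Y = \<omega> * y * z"
    using assms by (simp_all add: X_Y_def power_mult_distrib)
  define c where "c = sqrt \<omega> / sqrt pi * exp (- \<tau> * \<omega> - (y\<^sup>2 + z\<^sup>2) * \<omega> / 2)"
  have "(\<lambda>m. c * (hermite m X * hermite m Y / (2 ^ m * fact m) * q ^ m)) sums
     (c * (exp ((2 * X * Y * q - (X\<^sup>2 + Y\<^sup>2) * q\<^sup>2) / (1 - q\<^sup>2)) / sqrt (1 - q\<^sup>2)))"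
    by (intro sums_mult mehler_formula q)
  moreover have "c * (hermite m X * hermite m Y / (2 ^ m * fact m) * q ^ m) = mehler_term \<omega> \<tau> y z m" for m
  proof -
    have "exp (- \<tau> * \<omega> * (2 * real m + 1) - (y\<^sup>2 + z\<^sup>2) * \<omega> / 2) = exp (- \<tau> * \<omega> - (y\<^sup>2 + z\<^sup>2) * \<omega> / 2) * q ^ m"
      unfolding q_def exp_of_nat_mult[symmetric] exp_add[symmetric] s_def by (simp add: algebra_simps)
    note e = this
    show ?thesis
      unfolding mehler_term_def e c_def X_Y_def by (simp add: mult_ac)
  qed
  moreover have "c * (exp ((2 * X * Y * q - (X\<^sup>2 + Y\<^sup>2) * q\<^sup>2) / (1 - q\<^sup>2)) / sqrt (1 - q\<^sup>2)) = mehler_kernel \<omega> \<tau> y z"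
  proof -
    define E where "E = (2 * X * Y * q - (X\<^sup>2 + Y\<^sup>2) * q\<^sup>2) / (1 - q\<^sup>2)"
    have "exp (- \<tau> * \<omega>) = sqrt q"
    proof (rule real_sqrt_unique[symmetric])
      show "(exp (- \<tau> * \<omega>))\<^sup>2 = q"
        by (simp add: q_def s_def power2_eq_square exp_add[symmetric])
    qed simp
    then have pre: "sqrt \<omega> / sqrt pi * exp (- \<tau> * \<omega>) / sqrt (1 - q\<^sup>2) = sqrt (\<omega> / (2 * pi * S))"
      unfolding w using q0 by (simp add: real_sqrt_mult real_sqrt_divide field_simps)
    have expo: "- ((y\<^sup>2 + z\<^sup>2) * \<omega> / 2) + E =
       - (\<omega> / 2) * ((cosh s * (y\<^sup>2 + z\<^sup>2) - 2 * y * z) / S)"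
    proof -
      have "2 * X * Y * q - (X\<^sup>2 + Y\<^sup>2) * q\<^sup>2 = \<omega> * (2 * y * z * q - (y\<^sup>2 + z\<^sup>2) * q\<^sup>2)"
        using XY by (simp add: algebra_simps)
      moreover have "S = (1 - q\<^sup>2) / (2 * q)" using w q0 by (simp add: field_simps)
      moreover have "1 - q\<^sup>2 \<noteq> 0" using w S q0 by simp
      ultimately show ?thesis
        using q0 unfolding ch E_def by (simp add: divide_simps) algebra
    qed
    have "c = sqrt \<omega> / sqrt pi * exp (- \<tau> * \<omega>) * exp (- ((y\<^sup>2 + z\<^sup>2) * \<omega> / 2))"
      by (simp add: c_def flip: exp_add)
    then have "c * (exp E / sqrt (1 - q\<^sup>2)) = (sqrt \<omega> / sqrt pi * exp (- \<tau> * \<omega>) / sqrt (1 - q\<^sup>2)) * exp (- ((y\<^sup>2 + z\<^sup>2) * \<omega> / 2) + E)"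
      by (simp only: exp_add) (simp only: times_divide_eq_left times_divide_eq_right mult.assoc)
    also have "\<dots> = sqrt (\<omega> / (2 * pi * S)) * exp (- (\<omega> / 2) * ((cosh s * (y\<^sup>2 + z\<^sup>2) - 2 * y * z) / S))"
      unfolding pre expo ..
    finally show ?thesis
      unfolding mehler_kernel_def s_def[symmetric] S_def[symmetric] E_def .
  qed
  ultimately show ?thesis by simp
qed

lemma mehler_term_square:
  assumes "\<omega> > 0" 
  shows "mehler_term \<omega> \<tau> y y m \<ge> 0" and "(mehler_term \<omega> \<tau> y z m)\<^sup>2 = mehler_term \<omega> \<tau> y y m * mehler_term \<omega> \<tau> z z m"
proof -
  show "mehler_term \<omega> \<tau> y y m \<ge> 0"
    using assms by (simp add: mehler_term_def mult.assoc)
  have "(exp (- \<tau> * \<omega> * (2 * real m + 1) - (y\<^sup>2 + z\<^sup>2) * \<omega> / 2))\<^sup>2 =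
     exp (- \<tau> * \<omega> * (2 * real m + 1) - (y\<^sup>2 + y\<^sup>2) * \<omega> / 2) * exp (- \<tau> * \<omega> * (2 * real m + 1) - (z\<^sup>2 + z\<^sup>2) * \<omega> / 2)"
    by (simp add: power2_eq_square exp_add[symmetric] algebra_simps)
  then show "(mehler_term \<omega> \<tau> y z m)\<^sup>2 = mehler_term \<omega> \<tau> y y m * mehler_term \<omega> \<tau> z z m"
    by (simp add: mehler_term_def power2_eq_square)
qed

text \<open>Cauchy-Schwarz with \<open>\<bar>e\<^sub>m(y,z)\<bar> = sqrt (e\<^sub>m(y,y)) sqrt (e\<^sub>m(z,z))\<close>, where the terms on
  the diagonal are nonnegative and their sums are known.\<close>
lemma sum_abs_mehler_term_le:
  assumes "\<omega> > 0" "\<tau> > 0" "finite F"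
  shows "(\<Sum>m\<in>F. \<bar>mehler_term \<omega> \<tau> y z m\<bar>) \<le> mehler_majorant \<omega> \<tau> y z"
proof -
  have D: "(\<Sum>m\<in>F. mehler_term \<omega> \<tau> x x m) \<le> mehler_kernel \<omega> \<tau> x x" for x
    using mehler_term_sums[OF assms(1,2), of x x] assms
    by (metis sum_le_suminf mehler_term_square(1) sums_iff)
  have "(\<Sum>m\<in>F. \<bar>mehler_term \<omega> \<tau> y z m\<bar>) = (\<Sum>m\<in>F. \<bar>sqrt (mehler_term \<omega> \<tau> y y m)\<bar> * \<bar>sqrt (mehler_term \<omega> \<tau> z z m)\<bar>)"
    by (intro sum.cong refl)
       (simp add: mehler_term_square(1) assms real_sqrt_mult[symmetric] mehler_term_square(2)[symmetric])
  also have "\<dots> \<le> L2_set (\<lambda>m. sqrt (mehler_term \<omega> \<tau> y y m)) F * L2_set (\<lambda>m. sqrt (mehler_term \<omega> \<tau> z z m)) F"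
    by (rule L2_set_mult_ineq)
  also have "\<dots> = sqrt (\<Sum>m\<in>F. mehler_term \<omega> \<tau> y y m) * sqrt (\<Sum>m\<in>F. mehler_term \<omega> \<tau> z z m)"
    by (simp add: L2_set_def mehler_term_square(1) assms)
  also have "\<dots> \<le> sqrt (mehler_kernel \<omega> \<tau> y y) * sqrt (mehler_kernel \<omega> \<tau> z z)"
    by (intro mult_mono real_sqrt_le_mono D) (auto intro!: sum_nonneg mehler_term_square assms mehler_mehler_log_dyos[THEN less_imp_le])
  also have "\<dots> = mehler_majorant \<omega> \<tau> y z"
    by (simp add: real_sqrt_mult[symmetric] mehler_kernel_diagonal assms mehler_majorant_nonneg)
  finally show ?thesis .
qed

text \<open>A finite set of multi-indices lies in the box spanned by its projections, and the sum over a box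
  factorises.\<close>
lemma sum_prod_abs_le:
  fixes e :: "'n :: finite \<Rightarrow> 'b \<Rightarrow> real"
  assumes "\<And>i F. finite F \<Longrightarrow> (\<Sum>k\<in>F. \<bar>e i k\<bar>) \<le> s i" and P: "finite P"
  shows "(\<Sum>m\<in>P. \<bar>\<Prod>i\<in>UNIV. e i (m i)\<bar>) \<le> (\<Prod>i\<in>UNIV. s i)"
proof -
  define B where "B i = (\<lambda>m. m i) ` P" for i
  have "P \<subseteq> Pi\<^sub>E UNIV B" by (auto simp: B_def)
  then have "(\<Sum>m\<in>P. \<bar>\<Prod>i\<in>UNIV. e i (m i)\<bar>) \<le> (\<Sum>m\<in>Pi\<^sub>E UNIV B. \<bar>\<Prod>i\<in>UNIV. e i (m i)\<bar>)"
    using P by (intro sum_mono2 finite_PiE) (auto simp: B_def)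
  also have "\<dots> = (\<Prod>i\<in>UNIV. \<Sum>k\<in>B i. \<bar>e i k\<bar>)"
    unfolding abs_prod using P by (subst prod_sum_PiE) (auto simp: B_def)
  also have "\<dots> \<le> (\<Prod>i\<in>UNIV. s i)"
    using assms P by (intro prod_mono) (auto simp: B_def sum_nonneg)
  finally show ?thesis .
qed

lemma hermite_term_eq_prod:
  fixes d :: "real ^ 'n"
  assumes "\<And>i. 0 < d $ i"
  shows "hermite_term d t0 y t z m = (\<Prod>i\<in>UNIV. mehler_term (sqrt (d $ i)) (t - t0) (y $ i) (z $ i) (m i))"
proof -
  have "d $ i powr (1/4) = sqrt (sqrt (d $ i))" for i
    using assms[of i] by (simp add: powr_half_sqrt[symmetric] powr_powr)
  then show ?thesis
    unfolding hermite_term_def mehler_term_def by (intro prod.cong refl) simp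
qed

lemma has_sum_prod_mehler_term:
  fixes y z :: "real ^ 'n"
  assumes "\<And>i. \<omega> i > 0" "\<tau> > 0"
  shows "((\<lambda>m. \<Prod>i\<in>UNIV. mehler_term (\<omega> i) \<tau> (y $ i) (z $ i) (m i)) has_sum
     (\<Prod>i\<in>UNIV. mehler_kernel (\<omega> i) \<tau> (y $ i) (z $ i))) UNIV"
proof -
  let ?e = "\<lambda>i. mehler_term (\<omega> i) \<tau> (y $ i) (z $ i)"
  have bd: "\<And>i F. finite F \<Longrightarrow> (\<Sum>k\<in>F. \<bar>?e i k\<bar>) \<le> mehler_majorant (\<omega> i) \<tau> (y $ i) (z $ i)"
    by (intro sum_abs_mehler_term_le assms)
  have abs1: "(\<lambda>k. norm (?e i k)) summable_on UNIV" for i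
    unfolding real_norm_def
    by (rule nonneg_bounded_partial_sums_imp_summable_on[where C = "mehler_majorant (\<omega> i) \<tau> (y $ i) (z $ i)"])
       (auto intro!: eventually_finite_subsets_at_top_weakI bd)
  have "infsum (?e i) UNIV = mehler_kernel (\<omega> i) \<tau> (y $ i) (z $ i)" for i
  proof -
    have "(?e i has_sum mehler_kernel (\<omega> i) \<tau> (y $ i) (z $ i)) UNIV"
      by (intro norm_summable_imp_has_sum mehler_term_sums assms summable_on_imp_summable abs1)
    then show ?thesis by (rule infsumI)
  qed
  moreover have "infsum (\<lambda>m. \<Prod>i\<in>UNIV. ?e i (m i)) (Pi\<^sub>E UNIV (\<lambda>_. UNIV)) = (\<Prod>i\<in>UNIV. infsum (?e i) UNIV)"
    by (rule infsum_prod_PiE_abs[OF finite abs1])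
  moreover have "(\<lambda>m. \<Prod>i\<in>UNIV. ?e i (m i)) summable_on UNIV"
    by (rule abs_summable_summable, unfold real_norm_def,
        rule nonneg_bounded_partial_sums_imp_summable_on[where C = "\<Prod>i\<in>UNIV. mehler_majorant (\<omega> i) \<tau> (y $ i) (z $ i)"])
       (auto intro!: eventually_finite_subsets_at_top_weakI sum_prod_abs_le bd)
  ultimately show ?thesis
    by (simp add: has_sum_iff)
qed

section \<open>The kernel in several dimensions and the Hermite series\<close>

text \<open>The heat kernel of the oscillator with frequencies \<open>\<omega>\<close>; for \<open>\<omega> i = sqrt (d $ i)\<close> it is
  \<open>kappa\<close>.\<close>
definition mehler_prod :: "('n \<Rightarrow> real) \<Rightarrow> real \<Rightarrow> real ^ 'n \<Rightarrow> real ^ 'n \<Rightarrow> real" where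
  "mehler_prod \<omega> \<tau> y z = (\<Prod>i\<in>UNIV. mehler_kernel (\<omega> i) \<tau> (y $ i) (z $ i))"

lemma sqrt_prod: "sqrt (\<Prod>i\<in>A. f i) = (\<Prod>i\<in>A. sqrt (f i))"
  by (induction A rule: infinite_finite_induct) (auto simp: real_sqrt_mult)

text \<open>The identity \<open>coth\<^sup>2 - csch\<^sup>2 = 1\<close> reduces the determinant of \<open>M\<close> to \<open>\<Prod>i. d $ i\<close>, and the quadratic form of
  \<open>M\<close> is a sum over the coordinates.\<close>
lemma kappa_eq_mehler_prod:
  fixes d :: "real ^ 'n"
  assumes d: "\<And>i. 0 < d $ i" and t: "t0 < t"
  shows "kappa (diag d) t0 y t z = mehler_prod (\<lambda>i. sqrt (d $ i)) (t - t0) y z"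
proof -
  define \<omega> where "\<omega> i = sqrt (d $ i)" for i
  define s where "s i = 2 * \<omega> i * (t - t0)" for i
  have \<omega>: "\<omega> i > 0" "(\<omega> i)\<^sup>2 = d $ i" for i using d[of i] by (simp_all add: \<omega>_def)
  have s: "s i > 0" for i using \<omega>[of i] t by (simp add: s_def)
  have S: "sinh (s i) > 0" for i using s by simp
  have C: "cosh (s i) > 0" for i by simp
  have sa: "2 * (t - t0) * sqrt (d $ i) = s i" for i by (simp add: s_def \<omega>_def)
  have M: "M_mat (diag d) t0 t = block_matrix (diag (\<chi> i. \<omega> i * coth (s i))) (diag (\<chi> i. - (\<omega> i * csch (s i))))
     (diag (\<chi> i. - (\<omega> i * csch (s i)))) (diag (\<chi> i. \<omega> i * coth (s i)))"
    unfolding M_mat_diag sa unfolding \<omega>_def ..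
  have nz: "(\<chi> i. \<omega> i * coth (s i)) $ i \<noteq> 0" for i
    using \<omega>(1)[of i] S[of i] C[of i] by (simp add: coth_def)
  have "det (M_mat (diag d) t0 t) = (\<Prod>i\<in>UNIV. d $ i)"
    unfolding M det_block_diag[OF nz]
  proof (intro prod.cong refl)
    fix i
    have "(\<omega> i * coth (s i)) * (\<omega> i * coth (s i)) - (\<omega> i * csch (s i)) * (\<omega> i * csch (s i)) = d $ i * (((cosh (s i))\<^sup>2 - 1) / (sinh (s i))\<^sup>2)"
      using S[of i] unfolding \<omega>(2)[symmetric] coth_def csch_def by (simp add: field_simps power2_eq_square)
    also have "((cosh (s i))\<^sup>2 - 1) / (sinh (s i))\<^sup>2 = 1" using S[of i] by (simp add: cosh_square_eq)
    finally show "(\<chi> i. \<omega> i * coth (s i)) $ i * (\<chi> i. \<omega> i * coth (s i)) $ i -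
         (\<chi> i. - (\<omega> i * csch (s i))) $ i * (\<chi> i. - (\<omega> i * csch (s i))) $ i = d $ i" by simp
  qed
  then have "det (M_mat (diag d) t0 t) powr (1/4) = (\<Prod>i\<in>UNIV. d $ i powr (1/4))"
    using d by (simp add: prod_powr_distrib less_imp_le)
  also have "\<dots> = (\<Prod>i\<in>UNIV. sqrt (\<omega> i))"
    using d by (intro prod.cong refl) (simp add: less_imp_le \<omega>_def powr_half_sqrt[symmetric] powr_powr)
  finally have 1: "det (M_mat (diag d) t0 t) powr (1/4) = (\<Prod>i\<in>UNIV. sqrt (\<omega> i))" .
  have "(2 * pi) powr (real CARD('n) / 2) = ((2 * pi) powr (1 / 2)) powr real CARD('n)"
    unfolding powr_powr by simp
  also have "\<dots> = (\<Prod>i\<in>(UNIV :: 'n set). sqrt (2 * pi))"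
    by (simp add: powr_half_sqrt powr_realpow)
  finally have 2: "(2 * pi) powr (real CARD('n) / 2) = (\<Prod>i\<in>(UNIV :: 'n set). sqrt (2 * pi))" .
  have "diag_map sinh ((2 * (t - t0)) *\<^sub>R diag_map sqrt (diag d)) = diag (\<chi> i. sinh (s i))"
    by (simp only: diag_map_diag scaleR_diag vec_lambda_beta sa)
  then have 3: "sqrt (det (diag_map sinh ((2 * (t - t0)) *\<^sub>R diag_map sqrt (diag d)))) = (\<Prod>i\<in>UNIV. sqrt (sinh (s i)))"
    by (simp add: det_diag sqrt_prod)
  have 4: "exp (- (1/2) * (stack y z \<bullet> (M_mat (diag d) t0 t *v stack y z))) =
     (\<Prod>i\<in>UNIV. exp (- (1/2) * (\<omega> i * coth (s i) * ((y $ i)\<^sup>2 + (z $ i)\<^sup>2) - 2 * (\<omega> i * csch (s i)) * y $ i * z $ i)))"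
    unfolding M quadratic_form_block_diag sum_distrib_left by (simp add: exp_sum)
  show ?thesis
    unfolding kappa_def 1 2 3 4 mehler_prod_def prod_dividef[symmetric] prod.distrib[symmetric] \<omega>_def[symmetric]
  proof (intro prod.cong refl)
    fix i
    have "- (1/2) * (\<omega> i * coth (s i) * ((y $ i)\<^sup>2 + (z $ i)\<^sup>2) - 2 * (\<omega> i * csch (s i)) * y $ i * z $ i)
       = - (\<omega> i / 2) * ((cosh (s i) * ((y $ i)\<^sup>2 + (z $ i)\<^sup>2) - 2 * y $ i * z $ i) / sinh (s i))"
      using S[of i] by (simp add: coth_def csch_def field_simps)
    then show "sqrt (\<omega> i) / (sqrt (2 * pi) * sqrt (sinh (s i))) *
         exp (- (1/2) * (\<omega> i * coth (s i) * ((y $ i)\<^sup>2 + (z $ i)\<^sup>2) - 2 * (\<omega> i * csch (s i)) * y $ i * z $ i)) =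
         mehler_kernel (\<omega> i) (t - t0) (y $ i) (z $ i)"
      unfolding mehler_kernel_def s_def[symmetric] by (simp add: real_sqrt_mult real_sqrt_divide)
  qed
qed

text \<open>Dominated convergence for unordered sums, with a bound on the absolute values of all finite partial sums
  as the domination. An enumeration of the indices reduces it to sequences.\<close>
lemma has_sum_integral_dominated:
  fixes f :: "'i :: countable \<Rightarrow> 'a \<Rightarrow> real"
  assumes inf: "infinite (UNIV :: 'i set)"
    and meas: "\<And>m. f m \<in> borel_measurable M"
    and bound: "\<And>F x. finite F \<Longrightarrow> x \<in> space M \<Longrightarrow> (\<Sum>m\<in>F. \<bar>f m x\<bar>) \<le> g x"
    and g: "integrable M g"
    and h: "\<And>x. x \<in> space M \<Longrightarrow> ((\<lambda>m. f m x) has_sum h x) UNIV"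
  shows "integrable M (f m)" "integrable M h" "((\<lambda>m. \<integral>x. f m x \<partial>M) has_sum (\<integral>x. h x \<partial>M)) UNIV"
proof -
  define b where "b = from_nat_into (UNIV :: 'i set)"
  have b: "bij_betw b UNIV UNIV" unfolding b_def using inf by (intro bij_betw_from_nat_into) auto
  then have injb: "inj b" by (simp add: bij_betw_def)
  have int: "integrable M (f m)" for m
    by (rule Bochner_Integration.integrable_bound[OF g meas]) (use bound[of "{m}"] in \<open>auto intro!: AE_I2 abs_ge_self[THEN order_trans[rotated]]\<close>)
  then show "integrable M (f m)" .
  have part: "(\<Sum>k<n. \<bar>f (b k) x\<bar>) \<le> g x" if "x \<in> space M" for x n
  proof -
    have "(\<Sum>k<n. \<bar>f (b k) x\<bar>) = (\<Sum>m\<in>b ` {..<n}. \<bar>f m x\<bar>)"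
      using injb by (subst sum.reindex) (auto intro: inj_on_subset)
    then show ?thesis using bound[of "b ` {..<n}" x] that by simp
  qed
  have sm: "summable (\<lambda>k. \<bar>f (b k) x\<bar>)" if "x \<in> space M" for x
    by (rule bounded_imp_summable[where B = "g x"]) (use part[OF that, of "Suc _"] in \<open>auto simp: lessThan_Suc_atMost\<close>)
  have sI: "summable (\<lambda>k. \<integral>x. \<bar>f (b k) x\<bar> \<partial>M)"
  proof (rule bounded_imp_summable[where B = "\<integral>x. g x \<partial>M"])
    fix n
    have "(\<Sum>k\<le>n. \<integral>x. \<bar>f (b k) x\<bar> \<partial>M) = (\<integral>x. (\<Sum>k\<le>n. \<bar>f (b k) x\<bar>) \<partial>M)"
      using int by simp
    also have "\<dots> \<le> (\<integral>x. g x \<partial>M)"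
      using int part[of _ "Suc n"] by (intro integral_mono g) (auto simp: lessThan_Suc_atMost)
    finally show "(\<Sum>k\<le>n. \<integral>x. \<bar>f (b k) x\<bar> \<partial>M) \<le> (\<integral>x. g x \<partial>M)" .
  qed (auto intro: integral_nonneg_AE)
  have hs: "(\<lambda>k. f (b k) x) sums h x" if "x \<in> space M" for x
  proof -
    have "((\<lambda>k. f (b k) x) has_sum h x) UNIV"
      using h[OF that] has_sum_reindex_bij_betw[OF b, of "\<lambda>m. f m x" "h x"] by simp
    then show ?thesis by (rule has_sum_imp_sums)
  qed
  have 1: "(\<lambda>k. \<integral>x. f (b k) x \<partial>M) sums (\<integral>x. (\<Sum>k. f (b k) x) \<partial>M)"
    by (rule sums_integral) (use sm sI in \<open>auto intro!: AE_I2 int\<close>)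
  have i1: "integrable M (\<lambda>x. (\<Sum>k. f (b k) x))"
    by (rule integrable_suminf) (use sm sI in \<open>auto intro!: AE_I2 int\<close>)
  have e: "(\<Sum>k. f (b k) x) = h x" if "x \<in> space M" for x using hs[OF that] by (simp add: sums_iff)
  show "integrable M h"
    using i1 e by (subst Bochner_Integration.integrable_cong[OF refl]) (auto simp: e[symmetric])
  have 2: "(\<integral>x. (\<Sum>k. f (b k) x) \<partial>M) = (\<integral>x. h x \<partial>M)"
    by (rule Bochner_Integration.integral_cong) (auto simp: e)
  have "summable (\<lambda>k. norm (\<integral>x. f (b k) x \<partial>M))"
    by (rule summable_comparison_test'[OF sI, of 0]) (use integral_norm_bound[of M "f (b _)"] in auto)
  from norm_summable_imp_has_sum[OF this 1[unfolded 2]]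
  show "((\<lambda>m. \<integral>x. f m x \<partial>M) has_sum (\<integral>x. h x \<partial>M)) UNIV"
    using has_sum_reindex_bij_betw[OF b, of "\<lambda>m. \<integral>x. f m x \<partial>M"] by simp
qed

lemma sinh_ge_self: "x \<ge> 0 \<Longrightarrow> sinh x \<ge> (x :: real)"
proof -
  assume x: "x \<ge> 0"
  have "sinh 0 - 0 \<le> sinh x - x"
  proof (rule DERIV_nonneg_imp_nondecreasing[OF x])
    fix u :: real
    have "((\<lambda>x. sinh x - x) has_real_derivative cosh u - 1) (at u)"
      by (auto intro!: derivative_eq_intros)
    then show "\<exists>y. ((\<lambda>x. sinh x - x) has_real_derivative y) (at u) \<and> 0 \<le> y"
      using cosh_real_ge_1[of u] by (intro exI[of _ "cosh u - 1"]) simp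
  qed
  then show ?thesis by simp
qed

text \<open>One Gaussian bound for all times \<open>\<tau> \<ge> \<tau>1\<close>: \<open>tanh\<close> increases, and \<open>sinh s \<ge> s\<close> bounds the
  prefactor.\<close>
lemma mehler_majorant_prod_bound:
  fixes \<omega> :: "'n :: finite \<Rightarrow> real"
  assumes \<omega>: "\<And>i. \<omega> i > 0" and \<tau>1: "\<tau>1 > 0"
  obtains A c where "A \<ge> 0" "c > 0"
    "\<And>\<tau> y z :: real ^ 'n. \<tau> \<ge> \<tau>1 \<Longrightarrow> (\<Prod>i\<in>UNIV. mehler_majorant (\<omega> i) \<tau> (y $ i) (z $ i)) \<le> A * exp (- c * (norm z)\<^sup>2)"
proof -
  define c where "c = Min (range (\<lambda>i. \<omega> i / 2 * tanh (\<omega> i * \<tau>1)))"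
  have "c > 0"
    using \<omega> \<tau>1 unfolding c_def by (subst Min_gr_iff) auto
  moreover have "\<And>i. c \<le> \<omega> i / 2 * tanh (\<omega> i * \<tau>1)"
    unfolding c_def by (rule Min_le) (rule finite_imageI finite_class.finite_UNIV rangeI)+
  ultimately have c: "c > 0" "\<And>i. c \<le> \<omega> i / 2 * tanh (\<omega> i * \<tau>1)" .
  define A where "A = (\<Prod>i\<in>(UNIV :: 'n set). sqrt (1 / (4 * pi * \<tau>1)))"
  show ?thesis
  proof (rule that[of A c])
    show "A \<ge> 0" using \<tau>1 by (simp add: A_def)
    fix \<tau> :: real and y z :: "real ^ 'n" assume \<tau>: "\<tau> \<ge> \<tau>1"
    have "(\<Prod>i\<in>UNIV. mehler_majorant (\<omega> i) \<tau> (y $ i) (z $ i)) \<le> (\<Prod>i\<in>UNIV. sqrt (1 / (4 * pi * \<tau>1)) * exp (- c * (z $ i)\<^sup>2))"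
    proof (intro prod_mono conjI)
      fix i
      show "0 \<le> mehler_majorant (\<omega> i) \<tau> (y $ i) (z $ i)" using \<omega> \<tau> \<tau>1 by (simp add: mehler_majorant_nonneg)
      have "2 * \<omega> i * \<tau>1 \<le> 2 * \<omega> i * \<tau>" using \<omega>[of i] \<tau> by simp
      also have "\<dots> \<le> sinh (2 * \<omega> i * \<tau>)" using \<omega>[of i] \<tau> \<tau>1 by (intro sinh_ge_self) simp
      finally have "\<omega> i / (2 * pi * sinh (2 * \<omega> i * \<tau>)) \<le> \<omega> i / (2 * pi * (2 * \<omega> i * \<tau>1))"
        using \<omega>[of i] \<tau>1 \<tau> by (intro divide_left_mono mult_left_mono mult_pos_pos) auto
      also have "\<dots> = 1 / (4 * pi * \<tau>1)" using \<omega>[of i] by simp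
      finally have 1: "sqrt (\<omega> i / (2 * pi * sinh (2 * \<omega> i * \<tau>))) \<le> sqrt (1 / (4 * pi * \<tau>1))" by simp
      have "c \<le> \<omega> i / 2 * tanh (\<omega> i * \<tau>1)" by (rule c)
      also have "\<dots> \<le> \<omega> i / 2 * tanh (\<omega> i * \<tau>)" using \<omega>[of i] \<tau> by (intro mult_left_mono) auto
      finally have "c * (z $ i)\<^sup>2 \<le> \<omega> i / 2 * tanh (\<omega> i * \<tau>) * ((y $ i)\<^sup>2 + (z $ i)\<^sup>2)"
        using c(1) by (intro mult_mono) auto
      then have 2: "exp (- (\<omega> i / 2) * tanh (\<omega> i * \<tau>) * ((y $ i)\<^sup>2 + (z $ i)\<^sup>2)) \<le> exp (- c * (z $ i)\<^sup>2)" by simp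
      show "mehler_majorant (\<omega> i) \<tau> (y $ i) (z $ i) \<le> sqrt (1 / (4 * pi * \<tau>1)) * exp (- c * (z $ i)\<^sup>2)"
        unfolding mehler_majorant_def using 1 2 \<tau>1 by (intro mult_mono) auto
    qed
    also have "\<dots> = A * exp (- c * (norm z)\<^sup>2)"
      unfolding prod.distrib A_def norm_vec_sq by (simp add: exp_sum sum_distrib_left flip: sum_negf)
    finally show "(\<Prod>i\<in>UNIV. mehler_majorant (\<omega> i) \<tau> (y $ i) (z $ i)) \<le> A * exp (- c * (norm z)\<^sup>2)" .
  qed (fact c(1))
qed

lemma mehler_prod_bounds:
  assumes "\<And>i. \<omega> i > 0" "\<tau> > 0"
  shows "mehler_prod \<omega> \<tau> y z \<ge> 0"
    and "mehler_prod \<omega> \<tau> y z \<le> (\<Prod>i\<in>UNIV. mehler_majorant (\<omega> i) \<tau> (y $ i) (z $ i))"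
  unfolding mehler_prod_def using assms
  by (auto intro!: prod_nonneg prod_mono mehler_kernel_le_majorant less_imp_le[OF mehler_mehler_log_dyos])

lemma continuous_on_hermite [continuous_intros]:
  "continuous_on A f \<Longrightarrow> continuous_on A (\<lambda>x. hermite m (f x))"
proof -
  have "continuous_on UNIV (hermite m)"
    unfolding hermite_eq_herm[abs_def]
    by (intro continuous_at_imp_continuous_on ballI DERIV_isCont[OF DERIV_herm])
  then show "continuous_on A f \<Longrightarrow> continuous_on A (\<lambda>x. hermite m (f x))"
    by (rule continuous_on_compose2) auto
qed

lemma borel_measurable_of_gaussian_integrable:
  fixes \<eta> :: "'a :: euclidean_space \<Rightarrow> real"
  assumes "\<And>\<epsilon>. 0 < \<epsilon> \<Longrightarrow> integrable lborel (\<lambda>z. exp (- \<epsilon> * (norm z)\<^sup>2) * \<eta> z)"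
  shows "\<eta> \<in> borel_measurable borel"
proof -
  have [measurable]: "(\<lambda>z. exp (- 1 * (norm z)\<^sup>2) * \<eta> z) \<in> borel_measurable borel"
    using borel_measurable_integrable[OF assms[OF zero_less_one]] unfolding measurable_lborel1 measurable_lborel2 .
  have "(\<lambda>z. exp ((norm z)\<^sup>2) * (exp (- 1 * (norm z)\<^sup>2) * \<eta> z)) \<in> borel_measurable borel"
    by measurable
  also have "(\<lambda>z. exp ((norm z)\<^sup>2) * (exp (- 1 * (norm z)\<^sup>2) * \<eta> z)) = \<eta>"
    by (simp add: fun_eq_iff mult.assoc[symmetric] flip: exp_add)
  finally show ?thesis .
qed

lemma integrable_gaussian_bound:
  fixes \<eta> :: "'a :: euclidean_space \<Rightarrow> real"
  assumes \<eta>: "\<And>\<epsilon>. 0 < \<epsilon> \<Longrightarrow> integrable lborel (\<lambda>z. exp (- \<epsilon> * (norm z)\<^sup>2) * \<eta> z)"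
    and F: "F \<in> borel_measurable borel" and c: "c > 0" and bound: "\<And>z. \<bar>F z\<bar> \<le> A * exp (- c * (norm z)\<^sup>2)"
  shows "integrable lborel (\<lambda>z. F z * \<eta> z)"
proof (rule Bochner_Integration.integrable_bound)
  show "integrable lborel (\<lambda>z. A * (exp (- c * (norm z)\<^sup>2) * \<eta> z))"
    using \<eta>[OF c] by simp
  show "(\<lambda>z. F z * \<eta> z) \<in> borel_measurable lborel"
    using F borel_measurable_of_gaussian_integrable[OF \<eta>] by simp
  show "AE z in lborel. norm (F z * \<eta> z) \<le> norm (A * (exp (- c * (norm z)\<^sup>2) * \<eta> z))"
  proof (rule AE_I2)
    fix z
    have "\<bar>F z\<bar> * \<bar>\<eta> z\<bar> \<le> \<bar>A * exp (- c * (norm z)\<^sup>2)\<bar> * \<bar>\<eta> z\<bar>"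
      using bound[of z] by (intro mult_right_mono) linarith+
    then show "norm (F z * \<eta> z) \<le> norm (A * (exp (- c * (norm z)\<^sup>2) * \<eta> z))"
      by (simp add: abs_mult)
  qed
qed

text \<open>The first part of the theorem: the terms are dominated, uniformly over finite sets of
  multi-indices, by a Gaussian times \<open>\<bar>\<eta>0 z\<bar>\<close>.\<close>
lemma hermite_series_has_sum:
  fixes d :: "real ^ 'n"
  assumes d: "\<And>i. 0 < d $ i" and t: "t0 < t"
    and \<eta>: "\<And>\<epsilon>. 0 < \<epsilon> \<Longrightarrow> integrable lborel (\<lambda>z. exp (- \<epsilon> * (norm z)\<^sup>2) * \<eta>0 z)"
  shows "integrable lborel (\<lambda>z. hermite_term d t0 y t z m * \<eta>0 z)"
    and "integrable lborel (\<lambda>z. kappa (diag d) t0 y t z * \<eta>0 z)"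
    and "((\<lambda>m. \<integral>z. hermite_term d t0 y t z m * \<eta>0 z \<partial>lborel) has_sum (\<integral>z. kappa (diag d) t0 y t z * \<eta>0 z \<partial>lborel)) UNIV"
proof -
  define \<omega> where "\<omega> i = sqrt (d $ i)" for i
  have \<omega>: "\<omega> i > 0" for i using d by (simp add: \<omega>_def)
  have \<tau>: "t - t0 > 0" using t by simp
  obtain A c where Ac: "A \<ge> 0" "c > 0" 
    "\<And>\<tau> y z :: real ^ 'n. \<tau> \<ge> t - t0 \<Longrightarrow> (\<Prod>i\<in>UNIV. mehler_majorant (\<omega> i) \<tau> (y $ i) (z $ i)) \<le> A * exp (- c * (norm z)\<^sup>2)"
    by (rule mehler_majorant_prod_bound[OF \<omega> \<tau>]) (rule that)
  have \<eta>m: "\<eta>0 \<in> borel_measurable borel" by (rule borel_measurable_of_gaussian_integrable[OF \<eta>])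
  have eq: "hermite_term d t0 y t z m = (\<Prod>i\<in>UNIV. mehler_term (\<omega> i) (t - t0) (y $ i) (z $ i) (m i))" for z m
    unfolding \<omega>_def by (rule hermite_term_eq_prod[OF d])
  have inf: "infinite (UNIV :: ('n \<Rightarrow> nat) set)"
  proof
    assume "finite (UNIV :: ('n \<Rightarrow> nat) set)"
    then have "finite (range (\<lambda>k::nat. (\<lambda>_::'n. k)))" by (rule finite_subset[rotated]) simp
    moreover have "inj (\<lambda>k::nat. (\<lambda>_::'n. k))" by (auto simp: inj_on_def fun_eq_iff)
    ultimately show False using finite_imageD by fastforce
  qed
  have meas: "(\<lambda>z. hermite_term d t0 y t z m * \<eta>0 z) \<in> borel_measurable lborel" for m
  proof -
    have "continuous_on UNIV (\<lambda>z. hermite_term d t0 y t z m)"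
      unfolding eq mehler_term_def by (intro continuous_intros) auto
    then have "(\<lambda>z. hermite_term d t0 y t z m) \<in> borel_measurable borel"
      by (rule borel_measurable_continuous_onI)
    then show ?thesis using \<eta>m by simp
  qed
  have bound: "(\<Sum>m\<in>F. \<bar>hermite_term d t0 y t z m * \<eta>0 z\<bar>) \<le> A * \<bar>exp (- c * (norm z)\<^sup>2) * \<eta>0 z\<bar>" if "finite F" for F z
  proof -
    have "(\<Sum>m\<in>F. \<bar>hermite_term d t0 y t z m * \<eta>0 z\<bar>) = (\<Sum>m\<in>F. \<bar>\<Prod>i\<in>UNIV. mehler_term (\<omega> i) (t - t0) (y $ i) (z $ i) (m i)\<bar>) * \<bar>\<eta>0 z\<bar>"
      by (simp add: eq abs_mult sum_distrib_right)
    also have "\<dots> \<le> (\<Prod>i\<in>UNIV. mehler_majorant (\<omega> i) (t - t0) (y $ i) (z $ i)) * \<bar>\<eta>0 z\<bar>"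
      by (intro mult_right_mono sum_prod_abs_le sum_abs_mehler_term_le that \<omega> \<tau>) auto
    also have "\<dots> \<le> (A * exp (- c * (norm z)\<^sup>2)) * \<bar>\<eta>0 z\<bar>"
      by (intro mult_right_mono Ac(3)) auto
    finally show ?thesis by (simp add: abs_mult)
  qed
  have g: "integrable lborel (\<lambda>z. A * \<bar>exp (- c * (norm z)\<^sup>2) * \<eta>0 z\<bar>)"
    using \<eta>[OF Ac(2)] by (intro integrable_mult_right integrable_abs)
  have h: "((\<lambda>m. hermite_term d t0 y t z m * \<eta>0 z) has_sum (kappa (diag d) t0 y t z * \<eta>0 z)) UNIV" for z
    unfolding eq kappa_eq_mehler_prod[OF d t] mehler_prod_def \<omega>_def[symmetric]
    by (intro has_sum_cmult_left has_sum_prod_mehler_term \<omega> \<tau>)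
  note * = has_sum_integral_dominated[OF inf meas bound g h]
  show "integrable lborel (\<lambda>z. hermite_term d t0 y t z m * \<eta>0 z)"
    "integrable lborel (\<lambda>z. kappa (diag d) t0 y t z * \<eta>0 z)"
    "((\<lambda>m. \<integral>z. hermite_term d t0 y t z m * \<eta>0 z \<partial>lborel) has_sum (\<integral>z. kappa (diag d) t0 y t z * \<eta>0 z \<partial>lborel)) UNIV"
    by (rule *; assumption?)+
qed

section \<open>Derivatives of the kernel\<close>

text \<open>Stated through the logarithmic derivatives \<open>c i\<close>, so that no quotients by \<open>f i s\<close> occur.\<close>
lemma DERIV_prod_logarithmic:
  fixes f :: "'i \<Rightarrow> real \<Rightarrow> real"
  assumes "\<And>i. i \<in> I \<Longrightarrow> (f i has_real_derivative f i s * c i) (at s)"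
  shows "((\<lambda>s. \<Prod>i\<in>I. f i s) has_real_derivative (\<Prod>i\<in>I. f i s) * (\<Sum>i\<in>I. c i)) (at s)"
  using assms
proof (induction I rule: infinite_finite_induct)
  case (insert x F)
  then have "((\<lambda>s. f x s * (\<Prod>i\<in>F. f i s)) has_real_derivative
     f x s * c x * (\<Prod>i\<in>F. f i s) + (\<Prod>i\<in>F. f i s) * (\<Sum>i\<in>F. c i) * f x s) (at s)"
    by (intro DERIV_mult) auto
  then show ?case using insert by (simp add: algebra_simps)
qed auto

text \<open>The logarithmic derivative of the kernel in \<open>y\<close>.\<close>
definition mehler_log_dy :: "real \<Rightarrow> real \<Rightarrow> real \<Rightarrow> real \<Rightarrow> real" where
  "mehler_log_dy \<omega> \<tau> y z = \<omega> * (z - cosh (2 * \<omega> * \<tau>) * y) / sinh (2 * \<omega> * \<tau>)"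

text \<open>The second derivative of the kernel in \<open>y\<close>, divided by the kernel.\<close>
definition mehler_rel_dyy :: "real \<Rightarrow> real \<Rightarrow> real \<Rightarrow> real \<Rightarrow> real" where
  "mehler_rel_dyy \<omega> \<tau> y z = (mehler_log_dy \<omega> \<tau> y z)\<^sup>2 - \<omega> * cosh (2 * \<omega> * \<tau>) / sinh (2 * \<omega> * \<tau>)"

lemma DERIV_mehler_log_dy:
  assumes "\<omega> > 0" "\<tau> > 0"
  shows "((\<lambda>y. mehler_log_dy \<omega> \<tau> y z) has_real_derivative - (\<omega> * cosh (2 * \<omega> * \<tau>) / sinh (2 * \<omega> * \<tau>))) (at y)"
  unfolding mehler_log_dy_def using assms by (auto intro!: derivative_eq_intros simp: field_simps)

lemma DERIV_mehler_kernel_y: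
  assumes "\<omega> > 0" "\<tau> > 0"
  shows "((\<lambda>y. mehler_kernel \<omega> \<tau> y z) has_real_derivative mehler_kernel \<omega> \<tau> y z * mehler_log_dy \<omega> \<tau> y z) (at y)"
proof -
  define S C where "S = sinh (2 * \<omega> * \<tau>)" "C = cosh (2 * \<omega> * \<tau>)"
  have S: "S > 0" using assms by (simp add: S_C_def)
  have "((\<lambda>y. - (\<omega> / 2) * ((C * (y\<^sup>2 + z\<^sup>2) - 2 * y * z) / S)) has_real_derivative \<omega> * (z - C * y) / S) (at y)"
    using S by (auto intro!: derivative_eq_intros simp: field_simps)
  then have "((\<lambda>y. sqrt (\<omega> / (2 * pi * S)) * exp (- (\<omega> / 2) * ((C * (y\<^sup>2 + z\<^sup>2) - 2 * y * z) / S))) has_real_derivative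
     sqrt (\<omega> / (2 * pi * S)) * (exp (- (\<omega> / 2) * ((C * (y\<^sup>2 + z\<^sup>2) - 2 * y * z) / S)) * (\<omega> * (z - C * y) / S))) (at y)"
    by (intro DERIV_cmult DERIV_fun_exp)
  then show ?thesis
    unfolding mehler_kernel_def mehler_log_dy_def S_C_def by (simp only: mult.assoc)
qed

text \<open>The one-dimensional equation for the kernel: the time derivative is the second derivative in \<open>y\<close>
  minus \<open>\<omega>\<^sup>2 y\<^sup>2\<close> times the kernel. The kernel is written as \<open>exp E\<close> to reduce
  the claim to an identity between rational functions of \<open>sinh\<close> and \<open>cosh\<close>.\<close>
lemma DERIV_mehler_kernel_time:
  assumes \<omega>: "\<omega> > 0" and \<tau>: "\<tau> > 0"
  shows "((\<lambda>\<tau>. mehler_kernel \<omega> \<tau> y z) has_real_derivative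
     mehler_kernel \<omega> \<tau> y z * (mehler_rel_dyy \<omega> \<tau> y z - \<omega>\<^sup>2 * y\<^sup>2)) (at \<tau>)"
proof -
  define E where "E \<tau> = (1/2) * (ln (\<omega> / (2 * pi)) - ln (sinh (2 * \<omega> * \<tau>))) +
    - (\<omega> / 2) * ((cosh (2 * \<omega> * \<tau>) * (y\<^sup>2 + z\<^sup>2) - 2 * y * z) / sinh (2 * \<omega> * \<tau>))" for \<tau>
  have E: "exp (E x) = mehler_kernel \<omega> x y z" if "x > 0" for x
  proof -
    have S: "sinh (2 * \<omega> * x) > 0" using that \<omega> by simp
    have "exp ((1/2) * (ln (\<omega> / (2 * pi)) - ln (sinh (2 * \<omega> * x)))) = exp (ln (\<omega> / (2 * pi * sinh (2 * \<omega> * x))) / 2)"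
      using S \<omega> that by (simp add: ln_div ln_mult)
    also have "\<dots> = sqrt (\<omega> / (2 * pi * sinh (2 * \<omega> * x)))"
      using S \<omega> by (subst ln_sqrt[symmetric]) auto
    finally show ?thesis
      unfolding E_def exp_add mehler_kernel_def by simp
  qed
  define S C where "S = sinh (2 * \<omega> * \<tau>)" "C = cosh (2 * \<omega> * \<tau>)"
  have S: "S > 0" using assms by (simp add: S_C_def)
  have C: "C\<^sup>2 = 1 + S\<^sup>2" by (simp add: S_C_def cosh_square_eq)
  have dS: "((\<lambda>x. sinh (2 * \<omega> * x)) has_real_derivative 2 * \<omega> * C) (at \<tau>)"
    and dC: "((\<lambda>x. cosh (2 * \<omega> * x)) has_real_derivative 2 * \<omega> * S) (at \<tau>)"
    unfolding S_C_def by (auto intro!: derivative_eq_intros)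
  have "((\<lambda>x. ln (sinh (2 * \<omega> * x))) has_real_derivative 2 * \<omega> * C / S) (at \<tau>)"
    using DERIV_chain2[OF DERIV_ln dS] S by (simp add: S_C_def divide_inverse mult_ac)
  moreover have "((\<lambda>x. (cosh (2 * \<omega> * x) * (y\<^sup>2 + z\<^sup>2) - 2 * y * z) / sinh (2 * \<omega> * x)) has_real_derivative
      ((2 * \<omega> * S * (y\<^sup>2 + z\<^sup>2)) * S - (C * (y\<^sup>2 + z\<^sup>2) - 2 * y * z) * (2 * \<omega> * C)) / (S * S)) (at \<tau>)"
    using DERIV_divide[OF DERIV_diff[OF DERIV_mult[OF dC DERIV_const[of "y\<^sup>2 + z\<^sup>2"]] DERIV_const[of "2 * y * z"]] dS] S assms
    by (simp add: S_C_def)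
  ultimately have "(E has_real_derivative (1/2) * (0 - 2 * \<omega> * C / S) +
     - (\<omega> / 2) * (((2 * \<omega> * S * (y\<^sup>2 + z\<^sup>2)) * S - (C * (y\<^sup>2 + z\<^sup>2) - 2 * y * z) * (2 * \<omega> * C)) / (S * S))) (at \<tau>)"
    unfolding E_def by (intro DERIV_add DERIV_cmult DERIV_diff DERIV_const)
  moreover have "(1/2) * (0 - 2 * \<omega> * C / S) +
     - (\<omega> / 2) * (((2 * \<omega> * S * (y\<^sup>2 + z\<^sup>2)) * S - (C * (y\<^sup>2 + z\<^sup>2) - 2 * y * z) * (2 * \<omega> * C)) / (S * S))
     = mehler_rel_dyy \<omega> \<tau> y z - \<omega>\<^sup>2 * y\<^sup>2"
    unfolding mehler_rel_dyy_def mehler_log_dy_def S_C_def[symmetric]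
    using S C by (simp add: divide_simps) algebra
  ultimately have "(E has_real_derivative mehler_rel_dyy \<omega> \<tau> y z - \<omega>\<^sup>2 * y\<^sup>2) (at \<tau>)"
    by (simp only:)
  from DERIV_fun_exp[OF this]
  have "((\<lambda>\<tau>. exp (E \<tau>)) has_real_derivative mehler_kernel \<omega> \<tau> y z * (mehler_rel_dyy \<omega> \<tau> y z - \<omega>\<^sup>2 * y\<^sup>2)) (at \<tau>)"
    by (simp add: E \<tau>)
  then show ?thesis
    by (rule has_field_derivative_transform_within_open[of _ _ _ "{0<..}"]) (use \<tau> E in auto)
qed

text \<open>The coefficients are polynomials of degree at most two in \<open>z\<close>. For \<open>\<tau> \<ge> \<tau>1\<close> their
  coefficients stay bounded, because \<open>1 / sinh (2 \<omega> \<tau>) \<le> c1\<close> and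
  \<open>cosh (2 \<omega> \<tau>) / sinh (2 \<omega> \<tau>) \<le> 1 + c1\<close>.\<close>
lemma kernel_coeff_bound:
  assumes \<omega>: "\<omega> > 0" and \<tau>1: "\<tau>1 > 0" and Y: "Y \<ge> 0"
  shows "\<exists>B\<ge>0. \<forall>\<tau>\<ge>\<tau>1. \<forall>y z. \<bar>y\<bar> \<le> Y \<longrightarrow>
    \<bar>mehler_log_dy \<omega> \<tau> y z\<bar> + \<bar>mehler_rel_dyy \<omega> \<tau> y z\<bar> + \<bar>mehler_rel_dyy \<omega> \<tau> y z - \<omega>\<^sup>2 * y\<^sup>2\<bar> \<le> B * (1 + z\<^sup>2)"
proof -
  define c1 where "c1 = 1 / (2 * \<omega> * \<tau>1)"
  define c2 where "c2 = 1 + c1"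
  define M where "M = \<omega> * (c1 + c2 * Y)"
  have c1: "c1 > 0" using \<omega> \<tau>1 by (simp add: c1_def)
  have M: "M \<ge> 0" using c1 \<omega> Y by (simp add: M_def c2_def)
  show ?thesis
  proof (intro exI[of _ "2 * M + 4 * M\<^sup>2 + 2 * \<omega> * c2 + \<omega>\<^sup>2 * Y\<^sup>2"] conjI allI impI)
    show "0 \<le> 2 * M + 4 * M\<^sup>2 + 2 * \<omega> * c2 + \<omega>\<^sup>2 * Y\<^sup>2"
      using M \<omega> c1 by (simp add: c2_def)
    fix \<tau> y z assume \<tau>: "\<tau>1 \<le> \<tau>" and y: "\<bar>y\<bar> \<le> Y"
    define S C where "S = sinh (2 * \<omega> * \<tau>)" "C = cosh (2 * \<omega> * \<tau>)"
    have "2 * \<omega> * \<tau>1 \<le> 2 * \<omega> * \<tau>" using \<omega> \<tau> by simp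
    also have "\<dots> \<le> S" unfolding S_C_def using \<omega> \<tau> \<tau>1 by (intro sinh_ge_self) simp
    finally have S1: "2 * \<omega> * \<tau>1 \<le> S" .
    have "0 < 2 * \<omega> * \<tau>1" using \<omega> \<tau>1 by simp
    then have S: "S > 0" and iS: "1 / S \<le> c1" using S1 by (auto simp: c1_def frac_le)
    have "C - S = exp (- (2 * \<omega> * \<tau>))" by (simp add: S_C_def cosh_minus_sinh)
    then have "C \<le> S + 1" using \<omega> \<tau> \<tau>1 by (simp add: algebra_simps)
    then have "C / S \<le> 1 + 1 / S" using S by (simp add: field_simps)
    then have cS: "C / S \<le> c2" using iS by (simp add: c2_def)
    have C1: "C > 0" by (simp add: S_C_def)
    then have C0: "C / S \<ge> 0" using S by simp
    have p: "mehler_log_dy \<omega> \<tau> y z = \<omega> * (1 / S * z - C / S * y)"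
      unfolding mehler_log_dy_def S_C_def[symmetric] by (simp add: diff_divide_distrib right_diff_distrib)
    have "\<bar>1 / S * z - C / S * y\<bar> \<le> 1 / S * \<bar>z\<bar> + C / S * \<bar>y\<bar>"
      using S C1 abs_triangle_ineq4[of "1 / S * z" "C / S * y"] by (simp add: abs_mult)
    also have "\<dots> \<le> c1 * \<bar>z\<bar> + c2 * Y"
      using iS cS y c1 C0 Y by (intro add_mono mult_mono) (auto simp: c2_def)
    also have "\<dots> \<le> (c1 + c2 * Y) * (1 + \<bar>z\<bar>)"
      using c1 Y by (simp add: algebra_simps c2_def)
    finally have p1: "\<bar>mehler_log_dy \<omega> \<tau> y z\<bar> \<le> M * (1 + \<bar>z\<bar>)"
      unfolding p M_def using \<omega> by (simp add: abs_mult mult.assoc)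
    have a: "2 * \<bar>z\<bar> \<le> 1 + z\<^sup>2"
      using zero_le_power2[of "\<bar>z\<bar> - 1"] by (simp add: power2_diff)
    have "1 + \<bar>z\<bar> \<le> 1 + 2 * \<bar>z\<bar>" by simp
    also have "\<dots> \<le> 2 + z\<^sup>2" using a by simp
    also have "\<dots> \<le> 2 * (1 + z\<^sup>2)" by simp
    finally have z: "1 + \<bar>z\<bar> \<le> 2 * (1 + z\<^sup>2)" .
    have z2: "(1 + \<bar>z\<bar>)\<^sup>2 \<le> 2 * (1 + z\<^sup>2)"
      using a by (simp add: power2_sum)
    have p2: "\<bar>mehler_log_dy \<omega> \<tau> y z\<bar> \<le> 2 * M * (1 + z\<^sup>2)"
      using order_trans[OF p1 mult_left_mono[OF z M]] by (simp only: mult_ac)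
    have "(mehler_log_dy \<omega> \<tau> y z)\<^sup>2 \<le> (M * (1 + \<bar>z\<bar>))\<^sup>2"
      using p1 abs_le_square_iff[of "mehler_log_dy \<omega> \<tau> y z" "M * (1 + \<bar>z\<bar>)"] M by (simp add: abs_mult)
    also have "\<dots> \<le> M\<^sup>2 * (2 * (1 + z\<^sup>2))"
      unfolding power_mult_distrib by (intro mult_left_mono z2) simp
    finally have p3: "(mehler_log_dy \<omega> \<tau> y z)\<^sup>2 \<le> 2 * M\<^sup>2 * (1 + z\<^sup>2)" by (simp only: mult_ac)
    have "0 \<le> \<omega> * (C / S)" using \<omega> C0 by (intro mult_nonneg_nonneg) auto
    moreover have "\<omega> * (C / S) \<le> \<omega> * c2" using \<omega> cS by (intro mult_left_mono) auto
    ultimately have "0 \<le> \<omega> * C / S" "\<omega> * C / S \<le> \<omega> * c2" by simp_all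
    moreover have "\<omega> * c2 \<le> \<omega> * c2 * (1 + z\<^sup>2)"
      using mult_left_mono[of 1 "1 + z\<^sup>2" "\<omega> * c2"] \<omega> c1 by (simp add: c2_def)
    ultimately have k: "0 \<le> \<omega> * C / S" "\<omega> * C / S \<le> \<omega> * c2 * (1 + z\<^sup>2)"
      by (blast intro: order_trans)+
    have q: "\<bar>mehler_rel_dyy \<omega> \<tau> y z\<bar> \<le> (2 * M\<^sup>2 + \<omega> * c2) * (1 + z\<^sup>2)"
      unfolding mehler_rel_dyy_def S_C_def[symmetric] using p3 k by (simp add: distrib_right abs_le_iff) (smt (verit) zero_le_power2)
    have "y\<^sup>2 \<le> Y\<^sup>2" using y Y abs_le_square_iff[of y Y] by simp
    then have "\<omega>\<^sup>2 * y\<^sup>2 \<le> \<omega>\<^sup>2 * Y\<^sup>2" by (simp add: mult_left_mono)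
    also have "\<dots> \<le> \<omega>\<^sup>2 * Y\<^sup>2 * (1 + z\<^sup>2)"
      using mult_left_mono[of 1 "1 + z\<^sup>2" "\<omega>\<^sup>2 * Y\<^sup>2"] by simp
    finally have v: "\<omega>\<^sup>2 * y\<^sup>2 \<le> \<omega>\<^sup>2 * Y\<^sup>2 * (1 + z\<^sup>2)" .
    have "\<bar>mehler_rel_dyy \<omega> \<tau> y z - \<omega>\<^sup>2 * y\<^sup>2\<bar> \<le> \<bar>mehler_rel_dyy \<omega> \<tau> y z\<bar> + \<omega>\<^sup>2 * y\<^sup>2"
      using abs_triangle_ineq4[of "mehler_rel_dyy \<omega> \<tau> y z" "\<omega>\<^sup>2 * y\<^sup>2"] by simp
    then show "\<bar>mehler_log_dy \<omega> \<tau> y z\<bar> + \<bar>mehler_rel_dyy \<omega> \<tau> y z\<bar> + \<bar>mehler_rel_dyy \<omega> \<tau> y z - \<omega>\<^sup>2 * y\<^sup>2\<bar>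
       \<le> (2 * M + 4 * M\<^sup>2 + 2 * \<omega> * c2 + \<omega>\<^sup>2 * Y\<^sup>2) * (1 + z\<^sup>2)"
      using p2 q v by (simp only: distrib_right)
  qed
qed

text \<open>A single Gaussian dominates the kernel and all its derivatives that occur in the equation: half of
  the exponent of the kernel absorbs the polynomial factor \<open>1 + \<bar>z\<bar>\<^sup>2\<close>.\<close>
lemma kernel_weight_bound:
  fixes \<omega> :: "'n :: finite \<Rightarrow> real"
  assumes \<omega>: "\<And>i. \<omega> i > 0" and \<tau>1: "\<tau>1 > 0" and Y: "Y \<ge> 0"
  obtains A c where "c > 0"
    "\<And>\<tau> y z. \<tau> \<ge> \<tau>1 \<Longrightarrow> norm y \<le> Y \<Longrightarrow>
      mehler_prod \<omega> \<tau> y z * (1 + (\<Sum>i\<in>UNIV. \<bar>mehler_log_dy (\<omega> i) \<tau> (y $ i) (z $ i)\<bar> + \<bar>mehler_rel_dyy (\<omega> i) \<tau> (y $ i) (z $ i)\<bar>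
        + \<bar>mehler_rel_dyy (\<omega> i) \<tau> (y $ i) (z $ i) - (\<omega> i)\<^sup>2 * (y $ i)\<^sup>2\<bar>)) \<le> A * exp (- c * (norm z)\<^sup>2)"
proof -
  let ?w = "\<lambda>i \<tau> y z. \<bar>mehler_log_dy (\<omega> i) \<tau> y z\<bar> + \<bar>mehler_rel_dyy (\<omega> i) \<tau> y z\<bar> + \<bar>mehler_rel_dyy (\<omega> i) \<tau> y z - (\<omega> i)\<^sup>2 * y\<^sup>2\<bar>"
  have "\<forall>i. \<exists>B\<ge>0. \<forall>\<tau>\<ge>\<tau>1. \<forall>y z. \<bar>y\<bar> \<le> Y \<longrightarrow> ?w i \<tau> y z \<le> B * (1 + z\<^sup>2)"
    using kernel_coeff_bound[OF \<omega> \<tau>1 Y] by blast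
  then obtain B where B: "\<And>i. B i \<ge> 0" "\<And>i \<tau> y z. \<tau> \<ge> \<tau>1 \<Longrightarrow> \<bar>y\<bar> \<le> Y \<Longrightarrow> ?w i \<tau> y z \<le> B i * (1 + z\<^sup>2)"
    by metis
  obtain A c where Ac: "A \<ge> 0" "c > 0" 
    "\<And>\<tau> y z :: real ^ 'n. \<tau> \<ge> \<tau>1 \<Longrightarrow> (\<Prod>i\<in>UNIV. mehler_majorant (\<omega> i) \<tau> (y $ i) (z $ i)) \<le> A * exp (- c * (norm z)\<^sup>2)"
    by (rule mehler_majorant_prod_bound[OF \<omega> \<tau>1]) (rule that)
  define D where "D = 1 + (\<Sum>i\<in>UNIV. B i)"
  have D: "D \<ge> 0" using B(1) by (simp add: D_def sum_nonneg add_nonneg_nonneg)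
  show ?thesis
  proof (rule that[of "c / 2" "A * D * (1 + 2 / c)"])
    show "c / 2 > 0" using Ac by simp
    fix \<tau> and y z :: "real ^ 'n" assume \<tau>: "\<tau> \<ge> \<tau>1" and y: "norm y \<le> Y"
    have comp: "\<bar>y $ i\<bar> \<le> Y" for i by (rule order_trans[OF component_le_norm_cart y])
    define x where "x = (norm z)\<^sup>2"
    have x: "x \<ge> 0" by (simp add: x_def)
    have zi: "(z $ i)\<^sup>2 \<le> x" for i
      unfolding x_def norm_vec_sq by (rule member_le_sum) auto
    have "(\<Sum>i\<in>UNIV. ?w i \<tau> (y $ i) (z $ i)) \<le> (\<Sum>i\<in>UNIV. B i * (1 + x))"
    proof (rule sum_mono)
      fix i
      have "?w i \<tau> (y $ i) (z $ i) \<le> B i * (1 + (z $ i)\<^sup>2)" by (rule B(2)[OF \<tau> comp])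
      also have "\<dots> \<le> B i * (1 + x)" using zi B(1) by (intro mult_left_mono) auto
      finally show "?w i \<tau> (y $ i) (z $ i) \<le> B i * (1 + x)" .
    qed
    then have 1: "1 + (\<Sum>i\<in>UNIV. ?w i \<tau> (y $ i) (z $ i)) \<le> D * (1 + x)"
      using x by (simp add: D_def sum_distrib_right distrib_right)
    have 2: "mehler_prod \<omega> \<tau> y z \<le> A * exp (- c * x)"
      using mehler_prod_bounds(2)[where \<omega>=\<omega> and \<tau>=\<tau> and y=y and z=z, OF \<omega>] Ac(3)[OF \<tau>, of y z] \<tau> \<tau>1 by (simp add: x_def)
    have 3: "1 + x \<le> (1 + 2 / c) * exp (c / 2 * x)"
    proof -
      have "x \<le> 2 / c * (c / 2 * x)" using Ac by simp
      also have "\<dots> \<le> 2 / c * exp (c / 2 * x)"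
      proof (rule mult_left_mono)
        show "c / 2 * x \<le> exp (c / 2 * x)" using exp_ge_add_one_self[of "c / 2 * x"] by linarith
      qed (use Ac in simp)
      finally have "x \<le> 2 / c * exp (c / 2 * x)" .
      moreover have "1 \<le> exp (c / 2 * x)" using Ac x by simp
      ultimately show ?thesis by (simp only: distrib_right)
    qed
    have "mehler_prod \<omega> \<tau> y z * (1 + (\<Sum>i\<in>UNIV. ?w i \<tau> (y $ i) (z $ i))) \<le> A * exp (- c * x) * (D * (1 + x))"
      using 1 2 mehler_prod_bounds(1)[where \<omega>=\<omega> and \<tau>=\<tau> and y=y and z=z, OF \<omega>] \<tau> \<tau>1 Ac
      by (intro mult_mono) (auto intro!: add_nonneg_nonneg sum_nonneg)
    also have "\<dots> \<le> A * exp (- c * x) * (D * ((1 + 2 / c) * exp (c / 2 * x)))"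
      using 3 D Ac by (intro mult_left_mono) auto
    also have "\<dots> = A * D * (1 + 2 / c) * (exp (- c * x) * exp (c / 2 * x))"
      by (simp add: mult_ac)
    also have "exp (- c * x) * exp (c / 2 * x) = exp (- (c / 2) * x)"
      by (simp flip: exp_add)
    finally show "mehler_prod \<omega> \<tau> y z * (1 + (\<Sum>i\<in>UNIV. ?w i \<tau> (y $ i) (z $ i))) \<le> A * D * (1 + 2 / c) * exp (- (c / 2) * (norm z)\<^sup>2)"
      unfolding x_def .
  qed
qed

section \<open>The kernel integral solves the differential equation\<close>

lemma add_axis_nth: "(y + s *\<^sub>R axis i 1 :: real ^ 'n) $ j = y $ j + (if j = i then s else 0)"
  by (simp add: axis_def)

lemma DERIV_mehler_prod_y:
  fixes y z :: "real ^ 'n" and i :: 'n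
  assumes "\<And>i. \<omega> i > 0" "\<tau> > 0" and y'_def: "\<And>s. y' s = y + s *\<^sub>R axis i 1"
  shows "((\<lambda>s. mehler_prod \<omega> \<tau> (y' s) z) has_real_derivative
     mehler_prod \<omega> \<tau> (y' s) z * mehler_log_dy (\<omega> i) \<tau> (y' s $ i) (z $ i)) (at s)"
proof -
  have "((\<lambda>s. \<Prod>j\<in>UNIV. mehler_kernel (\<omega> j) \<tau> (y' s $ j) (z $ j)) has_real_derivative
     (\<Prod>j\<in>UNIV. mehler_kernel (\<omega> j) \<tau> (y' s $ j) (z $ j)) * (\<Sum>j\<in>UNIV. if j = i then mehler_log_dy (\<omega> j) \<tau> (y' s $ j) (z $ j) else 0)) (at s)"
  proof (rule DERIV_prod_logarithmic)
    fix j
    show "((\<lambda>s. mehler_kernel (\<omega> j) \<tau> (y' s $ j) (z $ j)) has_real_derivative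
       mehler_kernel (\<omega> j) \<tau> (y' s $ j) (z $ j) * (if j = i then mehler_log_dy (\<omega> j) \<tau> (y' s $ j) (z $ j) else 0)) (at s)"
    proof (cases "j = i")
      case True
      have "((\<lambda>s. y $ i + s) has_real_derivative 1) (at s)"
        by (auto intro!: derivative_eq_intros)
      from DERIV_chain2[OF DERIV_mehler_kernel_y this, of "\<omega> i" \<tau> "z $ i"] assms
      show ?thesis by (simp add: y'_def add_axis_nth True)
    qed (simp add: y'_def axis_def)
  qed
  then show ?thesis by (simp add: mehler_prod_def)
qed

lemma DERIV_mehler_prod_yy:
  fixes y z :: "real ^ 'n" and i :: 'n
  assumes "\<And>i. \<omega> i > 0" "\<tau> > 0" and y'_def: "\<And>s. y' s = y + s *\<^sub>R axis i 1"
  shows "((\<lambda>s. mehler_prod \<omega> \<tau> (y' s) z * mehler_log_dy (\<omega> i) \<tau> (y' s $ i) (z $ i)) has_real_derivative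
     mehler_prod \<omega> \<tau> (y' s) z * mehler_rel_dyy (\<omega> i) \<tau> (y' s $ i) (z $ i)) (at s)"
proof -
  have "((\<lambda>s. y $ i + s) has_real_derivative 1) (at s)"
    by (auto intro!: derivative_eq_intros)
  from DERIV_chain2[OF DERIV_mehler_log_dy this, of "\<omega> i" \<tau> "z $ i"] assms(1,2)
  have 1: "((\<lambda>s. mehler_log_dy (\<omega> i) \<tau> (y' s $ i) (z $ i)) has_real_derivative
      - (\<omega> i * cosh (2 * \<omega> i * \<tau>) / sinh (2 * \<omega> i * \<tau>))) (at s)"
    by (simp add: y'_def add_axis_nth)
  show ?thesis
    using DERIV_mult[OF DERIV_mehler_prod_y[where \<omega>=\<omega>, OF assms, of z s] 1]
    by (simp add: mehler_rel_dyy_def power2_eq_square algebra_simps)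
qed

lemma DERIV_mehler_prod_time:
  fixes y z :: "real ^ 'n"
  assumes "\<And>i. \<omega> i > 0" "\<tau> > 0"
  shows "((\<lambda>\<tau>. mehler_prod \<omega> \<tau> y z) has_real_derivative
     mehler_prod \<omega> \<tau> y z * (\<Sum>i\<in>UNIV. mehler_rel_dyy (\<omega> i) \<tau> (y $ i) (z $ i) - (\<omega> i)\<^sup>2 * (y $ i)\<^sup>2)) (at \<tau>)"
  unfolding mehler_prod_def
  by (rule DERIV_prod_logarithmic) (intro DERIV_mehler_kernel_time assms)

lemma continuous_on_mehler_prod:
  fixes y :: "real ^ 'n"
  assumes "\<And>i. \<omega> i > 0" "\<tau> > 0"
  shows "continuous_on UNIV (\<lambda>z. mehler_prod \<omega> \<tau> y z)"
    and "continuous_on UNIV (\<lambda>z. mehler_log_dy (\<omega> i) \<tau> (y $ i) (z $ i))"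
    and "continuous_on UNIV (\<lambda>z. mehler_rel_dyy (\<omega> i) \<tau> (y $ i) (z $ i))"
proof -
  have nz: "sinh (2 * \<omega> i * \<tau>) \<noteq> 0" for i using assms(1)[of i] assms(2) by simp
  show "continuous_on UNIV (\<lambda>z. mehler_prod \<omega> \<tau> y z)"
    and "continuous_on UNIV (\<lambda>z. mehler_log_dy (\<omega> i) \<tau> (y $ i) (z $ i))"
    and "continuous_on UNIV (\<lambda>z. mehler_rel_dyy (\<omega> i) \<tau> (y $ i) (z $ i))"
    unfolding mehler_prod_def mehler_kernel_def mehler_rel_dyy_def mehler_log_dy_def
    by (intro continuous_intros; use nz in simp)+
qed

definition mehler_integral :: "('n \<Rightarrow> real) \<Rightarrow> (real ^ 'n \<Rightarrow> real) \<Rightarrow> real \<Rightarrow> real ^ 'n \<Rightarrow> real" where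
  "mehler_integral \<omega> \<eta> \<tau> y = (\<integral>z. mehler_prod \<omega> \<tau> y z * \<eta> z \<partial>lborel)"

context
  fixes \<omega> :: "'n :: finite \<Rightarrow> real" and \<eta> :: "real ^ 'n \<Rightarrow> real"
  assumes \<omega>: "\<And>i. \<omega> i > 0"
    and \<eta>: "\<And>\<epsilon>. 0 < \<epsilon> \<Longrightarrow> integrable lborel (\<lambda>z. exp (- \<epsilon> * (norm z)\<^sup>2) * \<eta> z)"
begin

text \<open>Each derivative in the equation is the kernel times a factor; this is a common bound for the factors
  of coordinate \<open>i\<close>.\<close>
abbreviation "coeff_weight i \<tau> y z \<equiv> \<bar>mehler_log_dy (\<omega> i) \<tau> (y $ i) (z $ i)\<bar> + \<bar>mehler_rel_dyy (\<omega> i) \<tau> (y $ i) (z $ i)\<bar>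
        + \<bar>mehler_rel_dyy (\<omega> i) \<tau> (y $ i) (z $ i) - (\<omega> i)\<^sup>2 * (y $ i)\<^sup>2\<bar>"

text \<open>One rule for the derivatives in space and in time: \<open>\<tau> s\<close> and \<open>y s\<close> are the parameters of the
  kernel along a curve, of which one is constant in each application.\<close>
lemma kernel_integral_Leibniz:
  fixes k k' :: "real \<Rightarrow> real ^ 'n \<Rightarrow> real"
  assumes r: "r > 0" and \<tau>1: "\<tau>1 > 0" and Y: "Y \<ge> 0"
    and pars: "\<And>s. \<bar>s - s0\<bar> < r \<Longrightarrow> \<tau> s \<ge> \<tau>1 \<and> norm (y s) \<le> Y"
    and der: "\<And>s z. \<bar>s - s0\<bar> < r \<Longrightarrow> ((\<lambda>s. k s z) has_real_derivative k' s z) (at s)"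
    and meas: "\<And>s. \<bar>s - s0\<bar> < r \<Longrightarrow> k s \<in> borel_measurable borel" "k' s0 \<in> borel_measurable borel"
    and bound: "\<And>s z. \<bar>s - s0\<bar> < r \<Longrightarrow> \<bar>k s z\<bar> \<le> mehler_prod \<omega> (\<tau> s) (y s) z * (1 + (\<Sum>i\<in>UNIV. coeff_weight i (\<tau> s) (y s) z))"
      "\<And>s z. \<bar>s - s0\<bar> < r \<Longrightarrow> \<bar>k' s z\<bar> \<le> mehler_prod \<omega> (\<tau> s) (y s) z * (1 + (\<Sum>i\<in>UNIV. coeff_weight i (\<tau> s) (y s) z))"
  shows "((\<lambda>s. \<integral>z. k s z * \<eta> z \<partial>lborel) has_real_derivative (\<integral>z. k' s0 z * \<eta> z \<partial>lborel)) (at s0)"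
    and "integrable lborel (\<lambda>z. k s0 z * \<eta> z)" "integrable lborel (\<lambda>z. k' s0 z * \<eta> z)"
proof -
  obtain A c where c: "c > 0" and A:
    "\<And>\<tau> y z. \<tau> \<ge> \<tau>1 \<Longrightarrow> norm y \<le> Y \<Longrightarrow> mehler_prod \<omega> \<tau> y z * (1 + (\<Sum>i\<in>UNIV. coeff_weight i \<tau> y z)) \<le> A * exp (- c * (norm z)\<^sup>2)"
    by (rule kernel_weight_bound[OF \<omega> \<tau>1 Y]) (rule that)
  have bk: "\<bar>k s z\<bar> \<le> A * exp (- c * (norm z)\<^sup>2)" "\<bar>k' s z\<bar> \<le> A * exp (- c * (norm z)\<^sup>2)" if "\<bar>s - s0\<bar> < r" for s z
    using bound[OF that, of z] A[of "\<tau> s" "y s" z] pars[OF that] by linarith+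
  show "integrable lborel (\<lambda>z. k s0 z * \<eta> z)" "integrable lborel (\<lambda>z. k' s0 z * \<eta> z)"
    using r by (auto intro!: integrable_gaussian_bound[OF \<eta> _ c bk(1)] integrable_gaussian_bound[OF \<eta> _ c bk(2)] meas)
  show "((\<lambda>s. \<integral>z. k s z * \<eta> z \<partial>lborel) has_real_derivative (\<integral>z. k' s0 z * \<eta> z \<partial>lborel)) (at s0)"
  proof (rule DERIV_lebesgue_integral[OF r, where g = "\<lambda>z. \<bar>A * (exp (- c * (norm z)\<^sup>2) * \<eta> z)\<bar>"])
    fix s assume s: "\<bar>s - s0\<bar> < r"
    show "integrable lborel (\<lambda>z. k s z * \<eta> z)"
      by (rule integrable_gaussian_bound[OF \<eta> meas(1)[OF s] c bk(1)[OF s]])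
    fix z
    show "((\<lambda>s. k s z * \<eta> z) has_real_derivative k' s z * \<eta> z) (at s)"
      by (intro DERIV_cmult_right der s)
    have "\<bar>k' s z\<bar> * \<bar>\<eta> z\<bar> \<le> \<bar>A * exp (- c * (norm z)\<^sup>2)\<bar> * \<bar>\<eta> z\<bar>"
      using bk(2)[OF s, of z] by (intro mult_right_mono) linarith+
    then show "\<bar>k' s z * \<eta> z\<bar> \<le> \<bar>A * (exp (- c * (norm z)\<^sup>2) * \<eta> z)\<bar>"
      by (simp add: abs_mult)
  next
    show "(\<lambda>z. k' s0 z * \<eta> z) \<in> borel_measurable lborel"
      using meas(2) borel_measurable_of_gaussian_integrable[OF \<eta>] by simp
    show "integrable lborel (\<lambda>z. \<bar>A * (exp (- c * (norm z)\<^sup>2) * \<eta> z)\<bar>)"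
      using \<eta>[OF c] by (intro integrable_abs integrable_mult_right)
  qed
qed

lemma mult_weight_le:
  assumes "\<tau> > 0" "\<bar>x\<bar> \<le> 1 + (\<Sum>i\<in>UNIV. coeff_weight i \<tau> y z)"
  shows "\<bar>mehler_prod \<omega> \<tau> y z * x\<bar> \<le> mehler_prod \<omega> \<tau> y z * (1 + (\<Sum>i\<in>UNIV. coeff_weight i \<tau> y z))"
  using assms mehler_prod_bounds(1)[where \<omega>=\<omega> and \<tau>=\<tau> and y=y and z=z, OF \<omega>]
  by (simp add: abs_mult mult_left_mono)

lemma weight_le_sum: "coeff_weight i \<tau> y z \<le> (\<Sum>i\<in>UNIV. coeff_weight i \<tau> y z)"
  by (rule member_le_sum[where f = "\<lambda>i. coeff_weight i \<tau> y z"]) auto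

lemma borel_kernel:
  assumes "\<tau> > 0"
  shows "(\<lambda>z. mehler_prod \<omega> \<tau> y z) \<in> borel_measurable borel"
    "(\<lambda>z. mehler_log_dy (\<omega> i) \<tau> (y $ i) (z $ i)) \<in> borel_measurable borel"
    "(\<lambda>z. mehler_rel_dyy (\<omega> i) \<tau> (y $ i) (z $ i)) \<in> borel_measurable borel"
  using continuous_on_mehler_prod[where \<omega>=\<omega>, OF \<omega> assms] by (auto intro: borel_measurable_continuous_onI)

lemma norm_add_axis_le: "\<bar>s\<bar> < 1 \<Longrightarrow> norm (y + s *\<^sub>R axis i 1 :: real ^ 'n) \<le> norm y + 1"
  using norm_triangle_ineq[of y "s *\<^sub>R axis i 1"] by simp

lemma kernel_bounds_by_weight:
  assumes \<tau>: "\<tau> > 0"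
  shows "\<bar>mehler_prod \<omega> \<tau> y z\<bar> \<le> mehler_prod \<omega> \<tau> y z * (1 + (\<Sum>j\<in>UNIV. coeff_weight j \<tau> y z))"
    "\<bar>mehler_prod \<omega> \<tau> y z * mehler_log_dy (\<omega> i) \<tau> (y $ i) (z $ i)\<bar> \<le> mehler_prod \<omega> \<tau> y z * (1 + (\<Sum>j\<in>UNIV. coeff_weight j \<tau> y z))"
    "\<bar>mehler_prod \<omega> \<tau> y z * mehler_rel_dyy (\<omega> i) \<tau> (y $ i) (z $ i)\<bar> \<le> mehler_prod \<omega> \<tau> y z * (1 + (\<Sum>j\<in>UNIV. coeff_weight j \<tau> y z))"
proof -
  show "\<bar>mehler_prod \<omega> \<tau> y z\<bar> \<le> mehler_prod \<omega> \<tau> y z * (1 + (\<Sum>j\<in>UNIV. coeff_weight j \<tau> y z))"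
    using mult_weight_le[OF \<tau>, of 1 y z] by (simp add: sum_nonneg)
  have "\<bar>mehler_log_dy (\<omega> i) \<tau> (y $ i) (z $ i)\<bar> \<le> 1 + (\<Sum>j\<in>UNIV. coeff_weight j \<tau> y z)"
    "\<bar>mehler_rel_dyy (\<omega> i) \<tau> (y $ i) (z $ i)\<bar> \<le> 1 + (\<Sum>j\<in>UNIV. coeff_weight j \<tau> y z)"
    using weight_le_sum[of i \<tau> y z] by auto
  then show "\<bar>mehler_prod \<omega> \<tau> y z * mehler_log_dy (\<omega> i) \<tau> (y $ i) (z $ i)\<bar> \<le> mehler_prod \<omega> \<tau> y z * (1 + (\<Sum>j\<in>UNIV. coeff_weight j \<tau> y z))"
    "\<bar>mehler_prod \<omega> \<tau> y z * mehler_rel_dyy (\<omega> i) \<tau> (y $ i) (z $ i)\<bar> \<le> mehler_prod \<omega> \<tau> y z * (1 + (\<Sum>j\<in>UNIV. coeff_weight j \<tau> y z))"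
    by (auto intro: mult_weight_le[OF \<tau>])
qed

lemma DERIV_mehler_integral_y:
  assumes \<tau>: "\<tau> > 0"
  shows "((\<lambda>s. mehler_integral \<omega> \<eta> \<tau> (y + s *\<^sub>R axis i 1)) has_real_derivative
     (\<integral>z. mehler_prod \<omega> \<tau> y z * mehler_log_dy (\<omega> i) \<tau> (y $ i) (z $ i) * \<eta> z \<partial>lborel)) (at 0)"
proof -
  define y' where "y' s = y + s *\<^sub>R axis i 1" for s :: real
  have y': "norm (y' s) \<le> norm y + 1" if "\<bar>s\<bar> < 1" for s
    unfolding y'_def by (rule norm_add_axis_le[OF that])
  have "((\<lambda>s. \<integral>z. mehler_prod \<omega> \<tau> (y' s) z * \<eta> z \<partial>lborel) has_real_derivative
     (\<integral>z. mehler_prod \<omega> \<tau> (y' 0) z * mehler_log_dy (\<omega> i) \<tau> (y' 0 $ i) (z $ i) * \<eta> z \<partial>lborel)) (at 0)"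
    by (rule kernel_integral_Leibniz(1)[of 1 \<tau> "norm y + 1" _ "\<lambda>_. \<tau>" y',
      where k' = "\<lambda>s z. mehler_prod \<omega> \<tau> (y' s) z * mehler_log_dy (\<omega> i) \<tau> (y' s $ i) (z $ i)"])
      (use \<tau> y' kernel_bounds_by_weight in \<open>auto intro!: DERIV_mehler_prod_y[where \<omega>=\<omega>, OF \<omega> _ y'_def] borel_measurable_times borel_kernel\<close>)
  then show ?thesis by (simp add: mehler_integral_def y'_def)
qed

lemma DERIV_mehler_integral_yy:
  assumes \<tau>: "\<tau> > 0"
  shows "((\<lambda>s. \<integral>z. mehler_prod \<omega> \<tau> (y + s *\<^sub>R axis i 1) z * mehler_log_dy (\<omega> i) \<tau> ((y + s *\<^sub>R axis i 1) $ i) (z $ i) * \<eta> z \<partial>lborel)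
     has_real_derivative (\<integral>z. mehler_prod \<omega> \<tau> y z * mehler_rel_dyy (\<omega> i) \<tau> (y $ i) (z $ i) * \<eta> z \<partial>lborel)) (at 0)"
    and "integrable lborel (\<lambda>z. mehler_prod \<omega> \<tau> y z * mehler_rel_dyy (\<omega> i) \<tau> (y $ i) (z $ i) * \<eta> z)"
proof -
  define y' where "y' s = y + s *\<^sub>R axis i 1" for s :: real
  have y': "norm (y' s) \<le> norm y + 1" if "\<bar>s\<bar> < 1" for s
    unfolding y'_def by (rule norm_add_axis_le[OF that])
  note * = kernel_integral_Leibniz[of 1 \<tau> "norm y + 1" 0 "\<lambda>_. \<tau>" y' "\<lambda>s z. mehler_prod \<omega> \<tau> (y' s) z * mehler_log_dy (\<omega> i) \<tau> (y' s $ i) (z $ i)"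
    "\<lambda>s z. mehler_prod \<omega> \<tau> (y' s) z * mehler_rel_dyy (\<omega> i) \<tau> (y' s $ i) (z $ i)", OF _ _ _ _ _ _ _ kernel_bounds_by_weight(2,3)]
  have "((\<lambda>s. \<integral>z. mehler_prod \<omega> \<tau> (y' s) z * mehler_log_dy (\<omega> i) \<tau> (y' s $ i) (z $ i) * \<eta> z \<partial>lborel)
     has_real_derivative (\<integral>z. mehler_prod \<omega> \<tau> (y' 0) z * mehler_rel_dyy (\<omega> i) \<tau> (y' 0 $ i) (z $ i) * \<eta> z \<partial>lborel)) (at 0)"
    by (rule *(1)) (use \<tau> y' in \<open>auto intro!: DERIV_mehler_prod_yy[where \<omega>=\<omega>, OF \<omega> _ y'_def] borel_measurable_times borel_kernel\<close>)
  then show "((\<lambda>s. \<integral>z. mehler_prod \<omega> \<tau> (y + s *\<^sub>R axis i 1) z * mehler_log_dy (\<omega> i) \<tau> ((y + s *\<^sub>R axis i 1) $ i) (z $ i) * \<eta> z \<partial>lborel)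
     has_real_derivative (\<integral>z. mehler_prod \<omega> \<tau> y z * mehler_rel_dyy (\<omega> i) \<tau> (y $ i) (z $ i) * \<eta> z \<partial>lborel)) (at 0)"
    by (simp add: y'_def)
  have "integrable lborel (\<lambda>z. mehler_prod \<omega> \<tau> (y' 0) z * mehler_rel_dyy (\<omega> i) \<tau> (y' 0 $ i) (z $ i) * \<eta> z)"
    by (rule *(3)) (use \<tau> y' in \<open>auto intro!: DERIV_mehler_prod_yy[where \<omega>=\<omega>, OF \<omega> _ y'_def] borel_measurable_times borel_kernel\<close>)
  then show "integrable lborel (\<lambda>z. mehler_prod \<omega> \<tau> y z * mehler_rel_dyy (\<omega> i) \<tau> (y $ i) (z $ i) * \<eta> z)"
    by (simp add: y'_def)
qed

lemma DERIV_mehler_integral_time: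
  assumes \<tau>: "\<tau> > 0"
  shows "((\<lambda>\<tau>. mehler_integral \<omega> \<eta> \<tau> y) has_real_derivative
     (\<integral>z. mehler_prod \<omega> \<tau> y z * (\<Sum>i\<in>UNIV. mehler_rel_dyy (\<omega> i) \<tau> (y $ i) (z $ i) - (\<omega> i)\<^sup>2 * (y $ i)\<^sup>2) * \<eta> z \<partial>lborel)) (at \<tau>)"
    and "integrable lborel (\<lambda>z. mehler_prod \<omega> \<tau> y z * \<eta> z)"
proof -
  have pos1: "s \<ge> \<tau> / 2" if "\<bar>s - \<tau>\<bar> < \<tau> / 2" for s using that by arith
  then have pos: "s > 0" "s \<ge> \<tau> / 2" if "\<bar>s - \<tau>\<bar> < \<tau> / 2" for s using that \<tau> by force+
  have b: "\<bar>mehler_prod \<omega> s y z\<bar> \<le> mehler_prod \<omega> s y z * (1 + (\<Sum>j\<in>UNIV. coeff_weight j s y z))"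
    "\<bar>mehler_prod \<omega> s y z * (\<Sum>i\<in>UNIV. mehler_rel_dyy (\<omega> i) s (y $ i) (z $ i) - (\<omega> i)\<^sup>2 * (y $ i)\<^sup>2)\<bar> \<le>
       mehler_prod \<omega> s y z * (1 + (\<Sum>j\<in>UNIV. coeff_weight j s y z))" if "\<bar>s - \<tau>\<bar> < \<tau> / 2" for s z
  proof -
    show "\<bar>mehler_prod \<omega> s y z\<bar> \<le> mehler_prod \<omega> s y z * (1 + (\<Sum>j\<in>UNIV. coeff_weight j s y z))"
      using mult_weight_le[OF pos(1)[OF that], of 1 y z] by (simp add: sum_nonneg)
    have "\<bar>\<Sum>i\<in>UNIV. mehler_rel_dyy (\<omega> i) s (y $ i) (z $ i) - (\<omega> i)\<^sup>2 * (y $ i)\<^sup>2\<bar> \<le> (\<Sum>j\<in>UNIV. coeff_weight j s y z)"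
      by (rule order_trans[OF sum_abs]) (auto intro!: sum_mono)
    then show "\<bar>mehler_prod \<omega> s y z * (\<Sum>i\<in>UNIV. mehler_rel_dyy (\<omega> i) s (y $ i) (z $ i) - (\<omega> i)\<^sup>2 * (y $ i)\<^sup>2)\<bar> \<le>
       mehler_prod \<omega> s y z * (1 + (\<Sum>j\<in>UNIV. coeff_weight j s y z))"
      by (intro mult_weight_le pos(1)[OF that]) linarith
  qed
  note * = kernel_integral_Leibniz[of "\<tau> / 2" "\<tau> / 2" "norm y" \<tau> "\<lambda>s. s" "\<lambda>_. y" "\<lambda>s z. mehler_prod \<omega> s y z"
    "\<lambda>s z. mehler_prod \<omega> s y z * (\<Sum>i\<in>UNIV. mehler_rel_dyy (\<omega> i) s (y $ i) (z $ i) - (\<omega> i)\<^sup>2 * (y $ i)\<^sup>2)", OF _ _ _ _ _ _ _ b]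
  show "((\<lambda>\<tau>. mehler_integral \<omega> \<eta> \<tau> y) has_real_derivative
     (\<integral>z. mehler_prod \<omega> \<tau> y z * (\<Sum>i\<in>UNIV. mehler_rel_dyy (\<omega> i) \<tau> (y $ i) (z $ i) - (\<omega> i)\<^sup>2 * (y $ i)\<^sup>2) * \<eta> z \<partial>lborel)) (at \<tau>)"
    unfolding mehler_integral_def
    by (rule *(1)) (use \<tau> pos in \<open>auto intro!: DERIV_mehler_prod_time \<omega> borel_measurable_times borel_measurable_sum borel_measurable_diff borel_kernel\<close>)
  show "integrable lborel (\<lambda>z. mehler_prod \<omega> \<tau> y z * \<eta> z)"
    by (rule *(2)) (use \<tau> pos in \<open>auto intro!: DERIV_mehler_prod_time \<omega> borel_measurable_times borel_measurable_sum borel_measurable_diff borel_kernel\<close>)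
qed

lemma mehler_integral_solves:
  assumes \<tau>: "\<tau> > 0"
  shows "partially_differentiable i (mehler_integral \<omega> \<eta> \<tau>) y" "partially_differentiable i (partial_deriv i (mehler_integral \<omega> \<eta> \<tau>)) y"
    "((\<lambda>\<tau>. mehler_integral \<omega> \<eta> \<tau> y) has_real_derivative laplacian (mehler_integral \<omega> \<eta> \<tau>) y - (\<Sum>i\<in>UNIV. (\<omega> i)\<^sup>2 * (y $ i)\<^sup>2) * mehler_integral \<omega> \<eta> \<tau> y) (at \<tau>)"
proof -
  show "partially_differentiable i (mehler_integral \<omega> \<eta> \<tau>) y"
    using DERIV_mehler_integral_y[OF \<tau>] by (auto simp: partially_differentiable_def field_differentiable_def)
  have p: "partial_deriv i (mehler_integral \<omega> \<eta> \<tau>) = (\<lambda>y. \<integral>z. mehler_prod \<omega> \<tau> y z * mehler_log_dy (\<omega> i) \<tau> (y $ i) (z $ i) * \<eta> z \<partial>lborel)" for i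
    unfolding partial_deriv_def by (intro ext DERIV_imp_deriv DERIV_mehler_integral_y \<tau>)
  show "partially_differentiable i (partial_deriv i (mehler_integral \<omega> \<eta> \<tau>)) y"
    using DERIV_mehler_integral_yy(1)[OF \<tau>] unfolding p partially_differentiable_def field_differentiable_def by blast
  have pp: "partial_deriv i (partial_deriv i (mehler_integral \<omega> \<eta> \<tau>)) y = (\<integral>z. mehler_prod \<omega> \<tau> y z * mehler_rel_dyy (\<omega> i) \<tau> (y $ i) (z $ i) * \<eta> z \<partial>lborel)" for i
    unfolding p unfolding partial_deriv_def by (intro DERIV_imp_deriv DERIV_mehler_integral_yy \<tau>)
  have "(\<integral>z. mehler_prod \<omega> \<tau> y z * (\<Sum>i\<in>UNIV. mehler_rel_dyy (\<omega> i) \<tau> (y $ i) (z $ i) - (\<omega> i)\<^sup>2 * (y $ i)\<^sup>2) * \<eta> z \<partial>lborel)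
    = (\<integral>z. (\<Sum>i\<in>UNIV. mehler_prod \<omega> \<tau> y z * mehler_rel_dyy (\<omega> i) \<tau> (y $ i) (z $ i) * \<eta> z)
         - (\<Sum>i\<in>UNIV. (\<omega> i)\<^sup>2 * (y $ i)\<^sup>2) * (mehler_prod \<omega> \<tau> y z * \<eta> z) \<partial>lborel)"
    by (intro Bochner_Integration.integral_cong refl)
       (simp add: sum_subtractf sum_distrib_left sum_distrib_right left_diff_distrib right_diff_distrib mult_ac)
  also have "\<dots> = (\<Sum>i\<in>UNIV. \<integral>z. mehler_prod \<omega> \<tau> y z * mehler_rel_dyy (\<omega> i) \<tau> (y $ i) (z $ i) * \<eta> z \<partial>lborel)
     - (\<Sum>i\<in>UNIV. (\<omega> i)\<^sup>2 * (y $ i)\<^sup>2) * mehler_integral \<omega> \<eta> \<tau> y"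
    using DERIV_mehler_integral_yy(2)[OF \<tau>] DERIV_mehler_integral_time(2)[OF \<tau>] unfolding mehler_integral_def
    by (subst Bochner_Integration.integral_diff) (auto intro!: Bochner_Integration.integrable_sum)
  finally show "((\<lambda>\<tau>. mehler_integral \<omega> \<eta> \<tau> y) has_real_derivative laplacian (mehler_integral \<omega> \<eta> \<tau>) y - (\<Sum>i\<in>UNIV. (\<omega> i)\<^sup>2 * (y $ i)\<^sup>2) * mehler_integral \<omega> \<eta> \<tau> y) (at \<tau>)"
    using DERIV_mehler_integral_time(1)[OF \<tau>, of y] by (simp add: laplacian_def pp)
qed

end

text \<open>The equation concerns times after \<open>t0\<close> only, hence \<open>u\<close> may be modified at \<open>t0\<close>; the candidate for
  the Cauchy problem takes the initial value there.\<close>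
lemma kernel_integral_solves_pde:
  fixes d :: "real ^ 'n"
  assumes d: "\<And>i. 0 < d $ i"
    and \<eta>: "\<And>\<epsilon>. 0 < \<epsilon> \<Longrightarrow> integrable lborel (\<lambda>z. exp (- \<epsilon> * (norm z)\<^sup>2) * \<eta>0 z)"
    and eq: "\<And>t y. t > t0 \<Longrightarrow> u t y = (\<integral>z. kappa (diag d) t0 y t z * \<eta>0 z \<partial>lborel)"
  shows "solves_pde (diag d) t0 u"
proof -
  define \<omega> where "\<omega> = (\<lambda>i. sqrt (d $ i))"
  have \<omega>: "\<omega> i > 0" and \<omega>2: "(\<omega> i)\<^sup>2 = d $ i" for i using d[of i] by (simp_all add: \<omega>_def)
  have u: "u t y = mehler_integral \<omega> \<eta>0 (t - t0) y" if "t > t0" for t y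
    unfolding eq[OF that] mehler_integral_def kappa_eq_mehler_prod[OF d that] \<omega>_def ..
  show ?thesis
    unfolding solves_pde_def
  proof (intro allI impI)
    fix t y assume t: "t0 < t"
    have ut: "u t = mehler_integral \<omega> \<eta>0 (t - t0)" using u[OF t] by (intro ext)
    have \<tau>: "t - t0 > 0" using t by simp
    have U1: "partially_differentiable i (u t) y" for i
      unfolding ut by (rule mehler_integral_solves(1)[where \<omega>=\<omega> and \<eta>=\<eta>0, OF \<omega> \<eta> \<tau>])
    have U2: "partially_differentiable i (partial_deriv i (u t)) y" for i
      unfolding ut by (rule mehler_integral_solves(2)[where \<omega>=\<omega> and \<eta>=\<eta>0, OF \<omega> \<eta> \<tau>])
    have "((\<lambda>\<tau>. mehler_integral \<omega> \<eta>0 \<tau> y) has_real_derivative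
        laplacian (u t) y - (y \<bullet> (diag d *v y)) * u t y) (at (t - t0))"
      unfolding ut quadratic_form_diag \<omega>2[symmetric]
      by (rule mehler_integral_solves[where \<omega>=\<omega> and \<eta>=\<eta>0, OF \<omega> \<eta> \<tau>])
    then have "((\<lambda>s. mehler_integral \<omega> \<eta>0 (s - t0) y) has_real_derivative
        laplacian (u t) y - (y \<bullet> (diag d *v y)) * u t y) (at t)"
      using DERIV_shift[of "\<lambda>\<tau>. mehler_integral \<omega> \<eta>0 \<tau> y" _ t "- t0"] by simp
    then have "((\<lambda>s. u s y) has_real_derivative laplacian (u t) y - (y \<bullet> (diag d *v y)) * u t y) (at t)"
      by (rule has_field_derivative_transform_within_open[of _ _ _ "{t0<..}"]) (use t u in auto)
    then show "(\<forall>i. partially_differentiable i (u t) y \<and> partially_differentiable i (partial_deriv i (u t)) y) \<and>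
        ((\<lambda>s. u s y) has_real_derivative laplacian (u t) y - (y \<bullet> (diag d *v y)) * u t y) (at t)"
      using U1 U2 by simp
  qed
qed

section \<open>Behaviour up to the initial time\<close>

lemma integral_affine_vec:
  fixes f :: "real ^ 'n \<Rightarrow> real" and \<sigma> y :: "real ^ 'n"
  assumes \<sigma>: "\<And>i. \<sigma> $ i > 0" and f: "f \<in> borel_measurable borel"
  shows "(\<integral>z. f z \<partial>lborel) = (\<integral>\<xi>. (\<Prod>i\<in>UNIV. \<sigma> $ i) * f (\<chi> i. y $ i + \<sigma> $ i * \<xi> $ i) \<partial>lborel)"
proof -
  define T where "T x = y + (\<Sum>j\<in>Basis. ((\<sigma> \<bullet> j) * (x \<bullet> j)) *\<^sub>R j)" for x
  have nz: "\<sigma> \<bullet> j \<noteq> 0" if "j \<in> Basis" for j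
    using that \<sigma> by (auto simp: Basis_vec_def inner_axis less_imp_neq[symmetric])
  have T: "T x = (\<chi> i. y $ i + \<sigma> $ i * x $ i)" for x
  proof -
    define v where "v = (\<chi> i. \<sigma> $ i * x $ i)"
    have "(\<Sum>j\<in>Basis. ((\<sigma> \<bullet> j) * (x \<bullet> j)) *\<^sub>R j) = (\<Sum>j\<in>Basis. (v \<bullet> j) *\<^sub>R j)"
      by (intro sum.cong refl) (auto simp: v_def Basis_vec_def inner_axis)
    then show ?thesis unfolding T_def euclidean_representation by (simp add: v_def vec_eq_iff)
  qed
  have [measurable]: "T \<in> borel \<rightarrow>\<^sub>M borel" unfolding T_def by measurable
  have "(\<integral>z. f z \<partial>lborel) = (\<integral>z. f z \<partial>density (distr lborel borel T) (\<lambda>_. (\<Prod>j\<in>Basis. \<bar>\<sigma> \<bullet> j\<bar>)))"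
    using lborel_affine_euclidean[of "\<lambda>j. \<sigma> \<bullet> j" y, OF nz] unfolding T_def by simp
  also have "\<dots> = (\<integral>x. (\<Prod>j\<in>Basis. \<bar>\<sigma> \<bullet> j\<bar>) * f (T x) \<partial>lborel)"
    using f by (subst integral_density) (auto simp: integral_distr prod_nonneg)
  also have "(\<Prod>j\<in>Basis. \<bar>\<sigma> \<bullet> j\<bar>) = (\<Prod>i\<in>UNIV. \<sigma> $ i)"
    by (subst prod_Basis_vec[where f = "\<lambda>b c. \<bar>\<sigma> \<bullet> c\<bar>"]) (simp add: inner_axis less_imp_le[OF \<sigma>])
  finally show ?thesis by (simp add: T)
qed

text \<open>The scale on which the kernel is concentrated around \<open>y\<close> in each coordinate. It vanishes for
  \<open>\<tau> = 0\<close>.\<close>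
definition spread :: "('n \<Rightarrow> real) \<Rightarrow> real \<Rightarrow> real ^ 'n" where
  "spread \<omega> \<tau> = (\<chi> i. sqrt (sinh (2 * \<omega> i * \<tau>) / \<omega> i))"

text \<open>The integrand after the substitution \<open>z = y + s \<xi>\<close>, where \<open>s\<close> is the spread. In contrast to the
  kernel it is regular for \<open>\<tau> = 0\<close>.\<close>
definition heat_integrand :: "('n \<Rightarrow> real) \<Rightarrow> (real ^ 'n \<Rightarrow> real) \<Rightarrow> real \<Rightarrow> real ^ 'n \<Rightarrow> real ^ 'n \<Rightarrow> real" where
  "heat_integrand \<omega> \<eta> \<tau> y \<xi> =
    (\<Prod>i\<in>UNIV. std_normal_density (\<xi> $ i) *
       exp (- (\<omega> i / 2) * tanh (\<omega> i * \<tau>) * ((y $ i)\<^sup>2 + (y $ i + spread \<omega> \<tau> $ i * \<xi> $ i)\<^sup>2))) *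
    \<eta> (\<chi> i. y $ i + spread \<omega> \<tau> $ i * \<xi> $ i)"

lemma mehler_kernel_spread:
  assumes "\<omega> i > 0" "\<tau> > 0"
  shows "spread \<omega> \<tau> $ i * mehler_kernel (\<omega> i) \<tau> y (y + spread \<omega> \<tau> $ i * x) =
    std_normal_density x * exp (- (\<omega> i / 2) * tanh (\<omega> i * \<tau>) * (y\<^sup>2 + (y + spread \<omega> \<tau> $ i * x)\<^sup>2))"
proof -
  define S where "S = sinh (2 * \<omega> i * \<tau>)"
  have S: "S > 0" using assms by (simp add: S_def)
  have s: "spread \<omega> \<tau> $ i = sqrt (S / \<omega> i)" by (simp add: spread_def S_def)
  have "sqrt (S / \<omega> i) * sqrt (\<omega> i / (2 * pi * S)) = 1 / sqrt (2 * pi)"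
    using S assms by (simp add: real_sqrt_mult[symmetric]) (simp add: real_sqrt_divide)
  moreover have "(y + sqrt (S / \<omega> i) * x - y)\<^sup>2 * \<omega> i / (2 * S) = x\<^sup>2 / 2"
    using S assms by (simp add: power_mult_distrib)
  ultimately show ?thesis
    unfolding mehler_kernel_split[OF assms] s S_def[symmetric] std_normal_density_def
    by (simp add: mult.assoc[symmetric])
qed

lemma integral_mehler_prod_eq_heat:
  fixes \<omega> :: "'n :: finite \<Rightarrow> real"
  assumes \<omega>: "\<And>i. \<omega> i > 0" and \<tau>: "\<tau> > 0" and m: "(\<lambda>z. mehler_prod \<omega> \<tau> y z * \<eta> z) \<in> borel_measurable borel"
  shows "(\<integral>z. mehler_prod \<omega> \<tau> y z * \<eta> z \<partial>lborel) = (\<integral>\<xi>. heat_integrand \<omega> \<eta> \<tau> y \<xi> \<partial>lborel)"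
proof -
  have s: "spread \<omega> \<tau> $ i > 0" for i using \<omega>[of i] \<tau> by (simp add: spread_def)
  have p: "(\<Prod>i\<in>UNIV. spread \<omega> \<tau> $ i) * mehler_prod \<omega> \<tau> y (\<chi> i. y $ i + spread \<omega> \<tau> $ i * \<xi> $ i) =
    (\<Prod>i\<in>UNIV. std_normal_density (\<xi> $ i) *
       exp (- (\<omega> i / 2) * tanh (\<omega> i * \<tau>) * ((y $ i)\<^sup>2 + (y $ i + spread \<omega> \<tau> $ i * \<xi> $ i)\<^sup>2)))" for \<xi>
    unfolding mehler_prod_def prod.distrib[symmetric] vec_lambda_beta
    by (intro prod.cong refl mehler_kernel_spread \<omega> \<tau>)
  show ?thesis
    unfolding integral_affine_vec[OF s m, of y] heat_integrand_def p[symmetric]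
    by (simp only: mult.assoc)
qed

text \<open>The standard normal density times \<open>exp (\<bar>\<xi>\<bar>\<^sup>2 / 4)\<close>: half of the decay of the density is
  left to absorb the growth of the data.\<close>
definition heat_weight :: "real ^ 'n \<Rightarrow> real" where
  "heat_weight \<xi> = (\<Prod>i\<in>UNIV. 1 / sqrt (2 * pi) * exp (- (1/4) * (\<xi> $ i)\<^sup>2))"

lemma integrable_heat_weight: "integrable lborel (heat_weight :: real ^ 'n \<Rightarrow> real)"
proof -
  have "integrable lborel (\<lambda>x :: real. exp (- (1/4) * x\<^sup>2))"
    using has_bochner_integral_exp_neg_square[of "1/4"] by (simp add: has_bochner_integral_iff)
  then have "integrable lborel (\<lambda>x. 1 / sqrt (2 * pi) * exp (- (1/4) * x\<^sup>2))"
    by (rule integrable_mult_right)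
  from has_bochner_integral_prod_vec[where ?'n = 'n, of "\<lambda>_ x. 1 / sqrt (2 * pi) * exp (- (1/4) * x\<^sup>2)", OF this]
  show ?thesis by (simp add: has_bochner_integral_iff heat_weight_def[abs_def])
qed

text \<open>Subgaussian data at \<open>z = y + s \<xi>\<close> are at most \<open>C exp (\<delta> \<bar>z\<bar>\<^sup>2)\<close>, and
  \<open>\<bar>z\<bar>\<^sup>2 \<le> 2 \<bar>y\<bar>\<^sup>2 + 2 s\<^sup>2 \<bar>\<xi>\<bar>\<^sup>2\<close>. Since \<open>s\<^sup>2\<close> is bounded by \<open>B\<close> up to time \<open>T\<close>, a small \<open>\<delta>\<close>
  meets both the prescribed growth in \<open>y\<close> and the decay available in \<open>\<xi>\<close>.\<close>
lemma heat_integrand_bound: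
  fixes \<omega> :: "'n :: finite \<Rightarrow> real"
  assumes \<omega>: "\<And>i. \<omega> i > 0" and \<eta>: "subgaussian_growth \<eta>" and \<epsilon>: "\<epsilon> > 0"
  shows "\<exists>C. \<forall>\<tau>\<in>{0..T}. \<forall>y \<xi>. \<bar>heat_integrand \<omega> \<eta> \<tau> y \<xi>\<bar> \<le> C * exp (\<epsilon> * (norm y)\<^sup>2) * heat_weight \<xi>"
proof -
  define B where "B = (\<Sum>i\<in>UNIV. \<bar>sinh (2 * \<omega> i * T) / \<omega> i\<bar>) + 1"
  have B: "B > 0" by (simp add: B_def sum_nonneg add_nonneg_pos)
  define \<delta> where "\<delta> = min (\<epsilon> / 2) (1 / (8 * B))"
  have \<delta>: "\<delta> > 0" "2 * \<delta> \<le> \<epsilon>" "2 * \<delta> * B \<le> 1 / 4"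
    using \<epsilon> B by (auto simp: \<delta>_def min_def field_simps)
  obtain C where C: "\<And>z. \<bar>\<eta> z\<bar> \<le> C * exp (\<delta> * (norm z)\<^sup>2)"
    using \<eta> \<delta>(1) by (auto simp: subgaussian_growth_def)
  have C0: "C \<ge> 0" using C[of 0] by simp
  show ?thesis
  proof (intro exI[of _ C] ballI allI)
    fix \<tau> and y \<xi> :: "real ^ 'n" assume \<tau>: "\<tau> \<in> {0..T}"
    define s where "s = spread \<omega> \<tau>"
    define z where "z = (\<chi> i. y $ i + s $ i * \<xi> $ i)"
    have s2: "(s $ i)\<^sup>2 \<le> B" for i
    proof -
      have "(s $ i)\<^sup>2 = sinh (2 * \<omega> i * \<tau>) / \<omega> i" using \<omega>[of i] \<tau> by (simp add: s_def spread_def)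
      also have "\<dots> \<le> sinh (2 * \<omega> i * T) / \<omega> i" using \<omega>[of i] \<tau> by (intro divide_right_mono) auto
      also have "\<dots> \<le> \<bar>sinh (2 * \<omega> i * T) / \<omega> i\<bar>" by (rule abs_ge_self)
      also have "\<dots> \<le> (\<Sum>i\<in>UNIV. \<bar>sinh (2 * \<omega> i * T) / \<omega> i\<bar>)"
        by (rule member_le_sum[where f = "\<lambda>i. \<bar>sinh (2 * \<omega> i * T) / \<omega> i\<bar>"]) auto
      finally show ?thesis by (simp add: B_def)
    qed
    have "\<delta> * (norm z)\<^sup>2 \<le> \<epsilon> * (norm y)\<^sup>2 + (\<Sum>i\<in>UNIV. 1 / 4 * (\<xi> $ i)\<^sup>2)"
    proof -
      have "\<delta> * (z $ i)\<^sup>2 \<le> \<epsilon> * (y $ i)\<^sup>2 + 1 / 4 * (\<xi> $ i)\<^sup>2" for i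
      proof -
        have "(y $ i + s $ i * \<xi> $ i)\<^sup>2 \<le> 2 * (y $ i)\<^sup>2 + 2 * ((s $ i)\<^sup>2 * (\<xi> $ i)\<^sup>2)"
          using zero_le_power2[of "y $ i - s $ i * \<xi> $ i"]
          unfolding power_mult_distrib[symmetric] power2_sum power2_diff by linarith
        also have "\<dots> \<le> 2 * (y $ i)\<^sup>2 + 2 * (B * (\<xi> $ i)\<^sup>2)"
          using s2[of i] by (intro add_left_mono mult_left_mono mult_right_mono) auto
        finally have "\<delta> * (z $ i)\<^sup>2 \<le> \<delta> * (2 * (y $ i)\<^sup>2 + 2 * (B * (\<xi> $ i)\<^sup>2))"
          using \<delta>(1) by (simp add: z_def)
        also have "\<dots> = 2 * \<delta> * (y $ i)\<^sup>2 + 2 * \<delta> * B * (\<xi> $ i)\<^sup>2" by (simp add: algebra_simps)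
        also have "\<dots> \<le> \<epsilon> * (y $ i)\<^sup>2 + 1 / 4 * (\<xi> $ i)\<^sup>2"
          using \<delta>(2,3) by (intro add_mono mult_right_mono) auto
        finally show ?thesis .
      qed
      then have "(\<Sum>i\<in>UNIV. \<delta> * (z $ i)\<^sup>2) \<le> (\<Sum>i\<in>UNIV. \<epsilon> * (y $ i)\<^sup>2 + 1 / 4 * (\<xi> $ i)\<^sup>2)"
        by (intro sum_mono) auto
      then show ?thesis by (simp add: norm_vec_sq sum_distrib_left sum.distrib)
    qed
    then have "exp (\<delta> * (norm z)\<^sup>2) \<le> exp (\<epsilon> * (norm y)\<^sup>2) * (\<Prod>i\<in>UNIV. exp (1 / 4 * (\<xi> $ i)\<^sup>2))"
      by (simp add: exp_sum[symmetric] flip: exp_add)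
    then have \<eta>b: "\<bar>\<eta> z\<bar> \<le> C * (exp (\<epsilon> * (norm y)\<^sup>2) * (\<Prod>i\<in>UNIV. exp (1 / 4 * (\<xi> $ i)\<^sup>2)))"
      using C[of z] C0 by (meson mult_left_mono order_trans)
    define P where "P = (\<Prod>i\<in>UNIV. std_normal_density (\<xi> $ i) *
       exp (- (\<omega> i / 2) * tanh (\<omega> i * \<tau>) * ((y $ i)\<^sup>2 + (y $ i + s $ i * \<xi> $ i)\<^sup>2)))"
    have P0: "P \<ge> 0" unfolding P_def by (intro prod_nonneg) auto
    have P1: "P \<le> (\<Prod>i\<in>UNIV. std_normal_density (\<xi> $ i))"
      unfolding P_def
    proof (intro prod_mono conjI)
      fix i
      have "0 \<le> \<omega> i / 2 * tanh (\<omega> i * \<tau>) * ((y $ i)\<^sup>2 + (y $ i + s $ i * \<xi> $ i)\<^sup>2)"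
        using \<omega>[of i] \<tau> by (intro mult_nonneg_nonneg) auto
      then show "std_normal_density (\<xi> $ i) * exp (- (\<omega> i / 2) * tanh (\<omega> i * \<tau>) * ((y $ i)\<^sup>2 + (y $ i + s $ i * \<xi> $ i)\<^sup>2))
         \<le> std_normal_density (\<xi> $ i)"
        by (intro mult_left_le) auto
    qed auto
    have "\<bar>heat_integrand \<omega> \<eta> \<tau> y \<xi>\<bar> = P * \<bar>\<eta> z\<bar>"
      using P0 by (simp add: heat_integrand_def P_def z_def s_def abs_mult)
    also have "\<dots> \<le> (\<Prod>i\<in>UNIV. std_normal_density (\<xi> $ i)) * (C * (exp (\<epsilon> * (norm y)\<^sup>2) * (\<Prod>i\<in>UNIV. exp (1 / 4 * (\<xi> $ i)\<^sup>2))))"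
      using P0 P1 \<eta>b by (intro mult_mono) (auto intro: prod_nonneg)
    also have "\<dots> = C * exp (\<epsilon> * (norm y)\<^sup>2) * (\<Prod>i\<in>UNIV. std_normal_density (\<xi> $ i) * exp (1 / 4 * (\<xi> $ i)\<^sup>2))"
      by (simp add: prod.distrib)
    also have "(\<Prod>i\<in>UNIV. std_normal_density (\<xi> $ i) * exp (1 / 4 * (\<xi> $ i)\<^sup>2)) = heat_weight \<xi>"
      unfolding heat_weight_def std_normal_density_def
      by (intro prod.cong refl) (simp add: mult.assoc flip: exp_add)
    finally show "\<bar>heat_integrand \<omega> \<eta> \<tau> y \<xi>\<bar> \<le> C * exp (\<epsilon> * (norm y)\<^sup>2) * heat_weight \<xi>" .
  qed
qed

lemma borel_measurable_heat_integrand: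
  assumes "continuous_on UNIV \<eta>"
  shows "heat_integrand \<omega> \<eta> \<tau> y \<in> borel_measurable borel"
proof (rule borel_measurable_continuous_onI)
  have "continuous_on UNIV (\<lambda>\<xi>. \<eta> (\<chi> i. y $ i + spread \<omega> \<tau> $ i * \<xi> $ i))"
    by (rule continuous_on_compose2[OF assms]) (auto intro!: continuous_intros)
  then show "continuous_on UNIV (heat_integrand \<omega> \<eta> \<tau> y)"
    unfolding heat_integrand_def[abs_def] std_normal_density_def
    by (intro continuous_intros) auto
qed

lemma heat_integral_growth:
  fixes \<omega> :: "'n :: finite \<Rightarrow> real"
  assumes \<omega>: "\<And>i. \<omega> i > 0" and \<eta>: "subgaussian_growth \<eta>" and c\<eta>: "continuous_on UNIV \<eta>" and \<epsilon>: "\<epsilon> > 0"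
  shows "\<exists>C. \<forall>\<tau>\<in>{0..T}. \<forall>y. \<bar>\<integral>\<xi>. heat_integrand \<omega> \<eta> \<tau> y \<xi> \<partial>lborel\<bar> \<le> C * exp (\<epsilon> * (norm y)\<^sup>2)"
proof -
  obtain C where C: "\<And>\<tau> y \<xi>. \<tau> \<in> {0..T} \<Longrightarrow> \<bar>heat_integrand \<omega> \<eta> \<tau> y \<xi>\<bar> \<le> C * exp (\<epsilon> * (norm y)\<^sup>2) * heat_weight \<xi>"
    using heat_integrand_bound[where \<omega>=\<omega>, OF \<omega> \<eta> \<epsilon>] by blast
  show ?thesis
  proof (intro exI[of _ "C * (\<integral>\<xi>. heat_weight (\<xi> :: real ^ 'n) \<partial>lborel)"] ballI allI)
    fix \<tau> and y :: "real ^ 'n" assume \<tau>: "\<tau> \<in> {0..T}"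
    have w: "integrable lborel (\<lambda>\<xi> :: real ^ 'n. C * exp (\<epsilon> * (norm y)\<^sup>2) * heat_weight \<xi>)"
      by (intro integrable_mult_right integrable_heat_weight)
    have "\<bar>\<integral>\<xi>. heat_integrand \<omega> \<eta> \<tau> y \<xi> \<partial>lborel\<bar> \<le> (\<integral>\<xi>. C * exp (\<epsilon> * (norm y)\<^sup>2) * heat_weight (\<xi> :: real ^ 'n) \<partial>lborel)"
    proof (rule integral_abs_bound_integral[OF _ w])
      show "\<bar>heat_integrand \<omega> \<eta> \<tau> y \<xi>\<bar> \<le> C * exp (\<epsilon> * (norm y)\<^sup>2) * heat_weight \<xi>" for \<xi>
        by (rule C[OF \<tau>])
      show "integrable lborel (heat_integrand \<omega> \<eta> \<tau> y)"
        by (rule Bochner_Integration.integrable_bound[OF w])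
           (use C[OF \<tau>] borel_measurable_heat_integrand[OF c\<eta>] in \<open>auto intro!: AE_I2 intro: order_trans[OF _ abs_ge_self]\<close>)
    qed
    then show "\<bar>\<integral>\<xi>. heat_integrand \<omega> \<eta> \<tau> y \<xi> \<partial>lborel\<bar> \<le> C * (\<integral>\<xi>. heat_weight (\<xi> :: real ^ 'n) \<partial>lborel) * exp (\<epsilon> * (norm y)\<^sup>2)"
      by (simp add: mult_ac)
  qed
qed

lemma heat_integral_0:
  fixes \<eta> :: "real ^ 'n \<Rightarrow> real"
  shows "(\<integral>\<xi>. heat_integrand \<omega> \<eta> 0 y \<xi> \<partial>lborel) = \<eta> y"
proof -
  have "has_bochner_integral lborel (\<lambda>\<xi> :: real ^ 'n. \<Prod>i\<in>UNIV. std_normal_density (\<xi> $ i)) (\<Prod>i\<in>(UNIV :: 'n set). \<integral>x. std_normal_density x \<partial>lborel)"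
    by (rule has_bochner_integral_prod_vec) auto
  then have "(\<integral>\<xi>. (\<Prod>i\<in>UNIV. std_normal_density (\<xi> $ i)) * \<eta> y \<partial>(lborel :: (real ^ 'n) measure)) = \<eta> y"
    by (simp add: has_bochner_integral_iff)
  then show ?thesis by (simp add: heat_integrand_def spread_def)
qed

text \<open>Dominated convergence along convergent sequences of parameters, including those that reach the
  initial time.\<close>
lemma continuous_on_heat_integral:
  fixes \<omega> :: "'n :: finite \<Rightarrow> real"
  assumes \<omega>: "\<And>i. \<omega> i > 0" and \<eta>: "subgaussian_growth \<eta>" and c\<eta>: "continuous_on UNIV \<eta>"
  shows "continuous_on ({0..} \<times> UNIV) (\<lambda>(\<tau>, y). \<integral>\<xi>. heat_integrand \<omega> \<eta> \<tau> y \<xi> \<partial>lborel)"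
proof (rule continuous_on_sequentiallyI)
  fix X and a :: "real \<times> (real ^ 'n)"
  assume a: "a \<in> {0..} \<times> UNIV" and X: "\<forall>n. X n \<in> {0..} \<times> UNIV" and lim: "X \<longlonglongrightarrow> a"
  have t: "(\<lambda>n. fst (X n)) \<longlonglongrightarrow> fst a" and y: "(\<lambda>n. snd (X n)) \<longlonglongrightarrow> snd a"
    using lim by (auto intro: tendsto_fst tendsto_snd)
  obtain T where T: "\<And>n. \<bar>fst (X n)\<bar> \<le> T"
    using Bseq_def convergent_imp_Bseq[of "\<lambda>n. fst (X n)"] t by (auto simp: convergent_def Bseq_def)
  obtain R where R: "\<And>n. norm (snd (X n)) \<le> R"
    using convergent_imp_Bseq[of "\<lambda>n. snd (X n)"] y by (auto simp: convergent_def Bseq_def)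
  obtain C where C: "\<And>\<tau> y \<xi>. \<tau> \<in> {0..T} \<Longrightarrow> \<bar>heat_integrand \<omega> \<eta> \<tau> y \<xi>\<bar> \<le> C * exp (1 * (norm y)\<^sup>2) * heat_weight \<xi>"
    using heat_integrand_bound[where \<omega>=\<omega>, OF \<omega> \<eta> zero_less_one] by blast
  have w0: "heat_weight \<xi> > 0" for \<xi> :: "real ^ 'n" unfolding heat_weight_def by (intro prod_pos) auto
  have C0: "C \<ge> 0"
  proof -
    have "0 \<in> {0..T}" using T[of 0] by auto
    then have "0 \<le> C * exp (1 * (norm (0 :: real ^ 'n))\<^sup>2) * heat_weight (0 :: real ^ 'n)"
      using C[of 0 0 0] abs_ge_zero order_trans by blast
    then show ?thesis using w0[of 0] by (simp add: zero_le_mult_iff)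
  qed
  have cont: "(\<lambda>n. heat_integrand \<omega> \<eta> (fst (X n)) (snd (X n)) \<xi>) \<longlonglongrightarrow> heat_integrand \<omega> \<eta> (fst a) (snd a) \<xi>" for \<xi>
  proof -
    have s: "(\<lambda>n. spread \<omega> (fst (X n)) $ i) \<longlonglongrightarrow> spread \<omega> (fst a) $ i" for i
      unfolding spread_def using \<omega>[of i] by (auto intro!: tendsto_intros t)
    have "(\<lambda>n. \<eta> (\<chi> i. snd (X n) $ i + spread \<omega> (fst (X n)) $ i * \<xi> $ i)) \<longlonglongrightarrow> \<eta> (\<chi> i. snd a $ i + spread \<omega> (fst a) $ i * \<xi> $ i)"
    proof (rule isCont_tendsto_compose[where g = \<eta>])
      show "isCont \<eta> (\<chi> i. snd a $ i + spread \<omega> (fst a) $ i * \<xi> $ i)"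
        using c\<eta> by (simp add: continuous_on_eq_continuous_at)
    qed (intro tendsto_intros s y)
    then show ?thesis
      unfolding heat_integrand_def by (intro tendsto_intros s y t) auto
  qed
  have "(\<lambda>n. \<integral>\<xi>. heat_integrand \<omega> \<eta> (fst (X n)) (snd (X n)) \<xi> \<partial>lborel) \<longlonglongrightarrow> (\<integral>\<xi>. heat_integrand \<omega> \<eta> (fst a) (snd a) \<xi> \<partial>lborel)"
  proof (rule integral_dominated_convergence[where w = "\<lambda>\<xi>. C * exp (1 * R\<^sup>2) * heat_weight \<xi>"])
    show "AE \<xi> in lborel. norm (heat_integrand \<omega> \<eta> (fst (X n)) (snd (X n)) \<xi>) \<le> C * exp (1 * R\<^sup>2) * heat_weight \<xi>" for n
    proof (rule AE_I2)
      fix \<xi>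
      have "fst (X n) \<in> {0..T}" using X T[of n] by (auto simp: mem_Times_iff abs_le_iff)
      then have "\<bar>heat_integrand \<omega> \<eta> (fst (X n)) (snd (X n)) \<xi>\<bar> \<le> C * exp (1 * (norm (snd (X n)))\<^sup>2) * heat_weight \<xi>"
        by (rule C)
      also have "\<dots> \<le> C * exp (1 * R\<^sup>2) * heat_weight \<xi>"
        using R[of n] C0 w0[of \<xi>] by (intro mult_right_mono mult_left_mono) (auto intro!: power_mono)
      finally show "norm (heat_integrand \<omega> \<eta> (fst (X n)) (snd (X n)) \<xi>) \<le> C * exp (1 * R\<^sup>2) * heat_weight \<xi>" by simp
    qed
  qed (auto intro!: AE_I2 cont borel_measurable_heat_integrand c\<eta> integrable_mult_right integrable_heat_weight)
  then show "(\<lambda>n. case X n of (\<tau>, y) \<Rightarrow> \<integral>\<xi>. heat_integrand \<omega> \<eta> \<tau> y \<xi> \<partial>lborel) \<longlonglongrightarrow>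
     (case a of (\<tau>, y) \<Rightarrow> \<integral>\<xi>. heat_integrand \<omega> \<eta> \<tau> y \<xi> \<partial>lborel)"
    by (simp add: case_prod_beta)
qed

section \<open>The Cauchy problem\<close>

text \<open>The kernel integral and its substituted form are used side by side: the former solves the equation,
  the latter controls the approach to the initial time and the growth.\<close>
lemma kernel_integral_is_solution:
  fixes d :: "real ^ 'n"
  assumes d: "\<And>i. 0 < d $ i"
    and \<eta>: "\<And>\<epsilon>. 0 < \<epsilon> \<Longrightarrow> integrable lborel (\<lambda>z. exp (- \<epsilon> * (norm z)\<^sup>2) * \<eta>0 z)"
    and c\<eta>: "continuous_on UNIV \<eta>0" and g\<eta>: "subgaussian_growth \<eta>0"
  shows "is_solution (diag d) t0 \<eta>0
    (\<lambda>t y. if t > t0 then \<integral>z. kappa (diag d) t0 y t z * \<eta>0 z \<partial>lborel else \<eta>0 y)" (is "is_solution _ _ _ ?u")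
proof -
  define \<omega> where "\<omega> = (\<lambda>i. sqrt (d $ i))"
  have \<omega>: "\<omega> i > 0" for i using d[of i] by (simp add: \<omega>_def)
  define V where "V \<tau> y = (\<integral>\<xi>. heat_integrand \<omega> \<eta>0 \<tau> y \<xi> \<partial>lborel)" for \<tau> y
  have u: "?u t y = V (t - t0) y" if t: "t \<ge> t0" for t y
  proof (cases "t = t0")
    case True
    then show ?thesis by (simp add: V_def heat_integral_0)
  next
    case False
    then have t': "t0 < t" using t by simp
    have "(\<lambda>z. mehler_prod \<omega> (t - t0) y z * \<eta>0 z) \<in> borel_measurable borel"
      using hermite_series_has_sum(2)[OF d t' \<eta>, of y] t'
      by (auto simp: kappa_eq_mehler_prod[OF d t'] \<omega>_def dest!: borel_measurable_integrable)
    from integral_mehler_prod_eq_heat[where \<omega>=\<omega>, OF \<omega> _ this] t'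
    show ?thesis by (simp add: V_def kappa_eq_mehler_prod[OF d t'] \<omega>_def)
  qed
  show ?thesis
    unfolding is_solution_def
  proof (intro conjI allI impI)
    show "solves_pde (diag d) t0 ?u"
      by (rule kernel_integral_solves_pde[OF d \<eta>]) auto
    show "?u t0 y = \<eta>0 y" for y by simp
    have "continuous_on ({t0..} \<times> UNIV) (\<lambda>p. (\<lambda>(\<tau>, y). V \<tau> y) (fst p - t0, snd p))"
      by (rule continuous_on_compose2[OF continuous_on_heat_integral[where \<omega>=\<omega>, OF \<omega> g\<eta> c\<eta>, folded V_def]])
         (auto intro!: continuous_intros)
    then show "continuous_on ({t0..} \<times> UNIV) (\<lambda>(t, y). ?u t y)"
      by (rule continuous_on_eq) (auto simp: u)
    fix T \<epsilon> :: real assume "T \<ge> t0" and \<epsilon>: "\<epsilon> > 0"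
    obtain C where C: "\<And>\<tau> y. \<tau> \<in> {0..T - t0} \<Longrightarrow> \<bar>V \<tau> y\<bar> \<le> C * exp (\<epsilon> * (norm y)\<^sup>2)"
      using heat_integral_growth[where \<omega>=\<omega>, OF \<omega> g\<eta> c\<eta> \<epsilon>] unfolding V_def by blast
    have "\<bar>?u t y\<bar> \<le> C * exp (\<epsilon> * (norm y)\<^sup>2)" if "t \<in> {t0..T}" for t y
      using C[of "t - t0" y] that u[of t y] by auto
    then show "\<exists>C. \<forall>t\<in>{t0..T}. \<forall>y. \<bar>?u t y\<bar> \<le> C * exp (\<epsilon> * (norm y)\<^sup>2)"
      by blast
  qed
qed

theorem theorem4p3:
  fixes d :: "real ^ 'n" and t0 :: real and \<eta>0 :: "real ^ 'n \<Rightarrow> real"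
  assumes "\<And>i. 0 < d $ i"
    and "0 \<le> t0"
    and "\<And>\<epsilon>. 0 < \<epsilon> \<Longrightarrow> integrable lborel (\<lambda>z. exp (- \<epsilon> * (norm z)\<^sup>2) * \<eta>0 z)"
  shows "(\<forall>t>t0. \<forall>y.
            (\<forall>m. integrable lborel (\<lambda>z. hermite_term d t0 y t z m * \<eta>0 z)) \<and>
            integrable lborel (\<lambda>z. kappa (diag d) t0 y t z * \<eta>0 z) \<and>
            ((\<lambda>m. \<integral>z. hermite_term d t0 y t z m * \<eta>0 z \<partial>lborel) has_sum
              (\<integral>z. kappa (diag d) t0 y t z * \<eta>0 z \<partial>lborel)) UNIV)
       \<and> solves_pde (diag d) t0 (\<lambda>t y. \<integral>z. kappa (diag d) t0 y t z * \<eta>0 z \<partial>lborel)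
       \<and> (continuous_on UNIV \<eta>0 \<and> subgaussian_growth \<eta>0 \<longrightarrow>
            (\<exists>\<eta>. is_solution (diag d) t0 \<eta>0 \<eta> \<and>
                 (\<forall>\<eta>'. is_solution (diag d) t0 \<eta>0 \<eta>' \<longrightarrow> (\<forall>t\<ge>t0. \<forall>y. \<eta>' t y = \<eta> t y)) \<and>
                 (\<forall>t>t0. \<forall>y.
                    ((\<lambda>m. \<integral>z. hermite_term d t0 y t z m * \<eta>0 z \<partial>lborel) has_sum \<eta> t y) UNIV \<and>
                    \<eta> t y = (\<integral>z. kappa (diag d) t0 y t z * \<eta>0 z \<partial>lborel))))"
proof (intro conjI impI)
  note series = hermite_series_has_sum[OF assms(1) _ assms(3)]
  show "\<forall>t>t0. \<forall>y.
            (\<forall>m. integrable lborel (\<lambda>z. hermite_term d t0 y t z m * \<eta>0 z)) \<and>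
            integrable lborel (\<lambda>z. kappa (diag d) t0 y t z * \<eta>0 z) \<and>
            ((\<lambda>m. \<integral>z. hermite_term d t0 y t z m * \<eta>0 z \<partial>lborel) has_sum
              (\<integral>z. kappa (diag d) t0 y t z * \<eta>0 z \<partial>lborel)) UNIV"
    by (intro allI impI conjI series)
  show "solves_pde (diag d) t0 (\<lambda>t y. \<integral>z. kappa (diag d) t0 y t z * \<eta>0 z \<partial>lborel)"
    by (rule kernel_integral_solves_pde[OF assms(1,3)]) auto
  assume "continuous_on UNIV \<eta>0 \<and> subgaussian_growth \<eta>0"
  then have sol: "is_solution (diag d) t0 \<eta>0
      (\<lambda>t y. if t > t0 then \<integral>z. kappa (diag d) t0 y t z * \<eta>0 z \<partial>lborel else \<eta>0 y)"
    (is "is_solution _ _ _ ?u")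
    by (intro kernel_integral_is_solution assms(1,3)) auto
  show "\<exists>\<eta>. is_solution (diag d) t0 \<eta>0 \<eta> \<and>
                 (\<forall>\<eta>'. is_solution (diag d) t0 \<eta>0 \<eta>' \<longrightarrow> (\<forall>t\<ge>t0. \<forall>y. \<eta>' t y = \<eta> t y)) \<and>
                 (\<forall>t>t0. \<forall>y.
                    ((\<lambda>m. \<integral>z. hermite_term d t0 y t z m * \<eta>0 z \<partial>lborel) has_sum \<eta> t y) UNIV \<and>
                    \<eta> t y = (\<integral>z. kappa (diag d) t0 y t z * \<eta>0 z \<partial>lborel))"
  proof (intro exI[of _ ?u] conjI allI impI)
    show "is_solution (diag d) t0 \<eta>0 ?u" by (fact sol)
    show "\<eta>' t y = ?u t y" if "is_solution (diag d) t0 \<eta>0 \<eta>'" "t0 \<le> t" for \<eta>' t y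
      by (rule solution_unique[OF assms(1) that(1) sol that(2)])
    fix t y assume t: "t0 < t"
    show "((\<lambda>m. \<integral>z. hermite_term d t0 y t z m * \<eta>0 z \<partial>lborel) has_sum ?u t y) UNIV"
      using series(3)[OF t] t by simp
    show "?u t y = (\<integral>z. kappa (diag d) t0 y t z * \<eta>0 z \<partial>lborel)"
      using t by simp
  qed
qed

end
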